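(* The following eight evaluations hold: \[\sum_{n=1}^\infty \frac{H_n\bar H_n}{n^3}(-1)^{n-1}=2\,\mathrm{Li}_5\left(\tfrac12\right)-\frac1{60}\ln^5 2-\frac{37}{16}\zeta(5)-\frac78\zeta(3)\ln^2 2+\frac16\zeta(2)\ln^3 2+4\zeta(4)\ln 2-\frac18\zeta(2)\zeta(3),\] \[\sum_{n=1}^\infty \frac{H_n\bar H_n}{n^3}=2\,\mathrm{Li}_5\left(\tfrac12\right)-\frac1{60}\ln^5 2-\frac{193}{64}\zeta(5)-\frac78\zeta(3)\ln^2 2+\frac16\zeta(2)\ln^3 2+4\zeta(4)\ln 2+\frac38\zeta(2)\zeta(3),\] \[\sum_{n=1}^\infty \frac{H_n\bar H_n^{(3)}}{n}(-1)^{n-1}=2\,\mathrm{Li}_5\left(\tfrac12\right)-\frac1{60}\ln^5 2-\frac38\zeta(3)\ln^2 2-\frac{37}{16}\zeta(5)+\frac16\zeta(2)\ln^3 2+\zeta(2)\zeta(3)+\frac14\zeta(4)\ln 2,\] \[\sum_{n=1}^\infty \frac{H_nH_n^{(3)}}{n}(-1)^{n-1}=-4\,\mathrm{Li}_5\left(\tfrac12\right)-2\,\mathrm{Li}_4\left(\tfrac12\right)\ln 2-\frac1{20}\ln^5 2+\frac38\zeta(3)\ln^2 2+\frac{167}{32}\zeta(5)+\frac16\zeta(2)\ln^3 2-\frac1{16}\zeta(2)\zeta(3)-\frac{49}{16}\zeta(4)\ln 2,\] \[\sum_{n=1}^\infty \frac{H_nH_n^{(2)}}{n^2}(-1)^{n-1}=-4\,\mathrm{Li}_5\left(\tfrac12\right)-4\,\mathrm{Li}_4\left(\tfrac12\right)\ln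 2-\frac2{15}\ln^5 2-\frac74\zeta(3)\ln^2 2+\frac{23}{8}\zeta(5)+\frac23\zeta(2)\ln^3 2+\frac{15}{16}\zeta(2)\zeta(3),\] \[\sum_{n=1}^\infty \frac{\bar H_n\bar H_n^{(2)}}{n^2}=4\,\mathrm{Li}_5\left(\tfrac12\right)-\frac1{30}\ln^5 2-\frac74\zeta(3)\ln^2 2-\frac{23}{8}\zeta(5)+\frac13\zeta(2)\ln^3 2-\frac34\zeta(2)\zeta(3)+\frac{49}{8}\zeta(4)\ln 2,\] \[\sum_{n=1}^\infty \frac{H_n^{(2)}\bar H_n}{n^2}(-1)^{n-1}=-4\,\mathrm{Li}_5\left(\tfrac12\right)+\frac1{30}\ln^5 2+\frac74\zeta(3)\ln^2 2-\frac{29}{64}\zeta(5)-\frac13\zeta(2)\ln^3 2+\frac{15}{8}\zeta(2)\zeta(3)-\frac{23}{16}\zeta(4)\ln 2,\] \[\sum_{n=1}^\infty \frac{\bar H_n\bar H_n^{(2)}}{n^2}(-1)^{n-1}=8\,\mathrm{Li}_5\left(\tfrac12\right)+4\,\mathrm{Li}_4\left(\tfrac12\right)\ln 2+\frac1{10}\ln^5 2-\frac{35}{4}\zeta(5)-\frac13\zeta(2)\ln^3 2+\frac1{16}\zeta(2)\zeta(3)+\frac{49}{8}\zeta(4)\ln 2.\]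
   Context: For positive integers $n,p$: $H_n^{(p)}=\sum_{j=1}^n j^{-p}$, $H_n=H_n^{(1)}$; $\bar H_n^{(p)}=\sum_{j=1}^n (-1)^{j-1}j^{-p}$, $\bar H_n=\bar H_n^{(1)}$. $\zeta$ is the Riemann zeta function and $\mathrm{Li}_p(x)=\sum_{n\ge1}x^n/n^p$. The infinite sums are limits of partial sums (they may converge only conditionally). *)

theory Defs
  imports "HOL-Analysis.Analysis"
begin

definition gen_harm :: "nat \<Rightarrow> nat \<Rightarrow> real" where
  "gen_harm p n = (\<Sum>j=1..n. 1 / real j ^ p)"

definition alt_harm :: "nat \<Rightarrow> nat \<Rightarrow> real" where
  "alt_harm p n = (\<Sum>j=1..n. (-1) ^ (j - 1) / real j ^ p)"

(* The ordinary harmonic numbers are the library's harm. *)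
lemma gen_harm_1: "gen_harm 1 n = harm n"
  by (simp add: gen_harm_def harm_def divide_inverse)

(* The Riemann zeta function at integer arguments p \<ge> 2, where it is given by its Dirichlet
   series; for p < 2 the series diverges and the value is meaningless. *)
definition zeta :: "nat \<Rightarrow> real" where
  "zeta p = (\<Sum>n. 1 / real (Suc n) ^ p)"

(* Indices are shifted by one, since suminf starts at 0. Only meaningful where the series
   converges, in particular for \<bar>x\<bar> < 1. *)
definition polylog :: "nat \<Rightarrow> real \<Rightarrow> real" where
  "polylog p x = (\<Sum>n. x ^ Suc n / real (Suc n) ^ p)"

end

(*
  By the quasi-shuffle (stuffle) product every Euler sum of the theorem is a sum of six alternating
  multiple zeta values of weight 5 and depth at most 3. These values satisfy linear relations: the
  stuffle product, which is exact already for truncated sums; the shuffle product, which comes from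
  iterated integrals; and, when one factor is the divergent zeta(1), the equality of both products
  after the divergent term has cancelled. Together with zeta(-n) = (2^(1-n) - 1) zeta(n) they
  determine all values of weight 5 and depth 2 (parity), and in depth 3 they express the required
  values through the single unknown zeta(-3,1,1). The latter is an iterated integral over the two
  forms dx/x and dx/(1+x) only. The substitutions x -> x/(1+x) and x -> 1-x turn such integrals
  into iterated integrals at 1/2, among them Li_4(1/2) and Li_5(1/2), and this gives zeta(-3,1,1).
*)

theory Submission
  imports Defs
begin

section \<open>Alternating multiple harmonic sums\<close>

unbundle no vec_syntax and fps_syntax

text \<open>The difficulty is convergence. A leading entry \<open>-1\<close> gives sums that may
  converge only conditionally, and the regularized relations involve the divergent harmonic series,
  so products are never rearranged in the limit. The stuffle product is an identity of finite sums
  and the shuffle product an identity of formal power series. What links them is a crude rate: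
  convergent sums approach their limit like \<open>N^(-1/2)\<close>, while all sums grow at most
  like a power of the logarithm. No integral is formed either: an iterated integral is the power
  series determined by its equation under \<open>x d/dx\<close>, and Abel's theorem carries it to
  the end point \<open>1\<close>.

  The products at \<open>1\<close> cannot produce polylogarithms at the interior point
  \<open>1/2\<close>. Landen's substitution sends \<open>1\<close> to \<open>1/2\<close> and so
  expands these in alternating values at \<open>1\<close>; reflection fixes \<open>1/2\<close> and
  yields one further relation among the same alternating values.\<close>

text \<open>An index \<open>s\<close> stands for the factor \<open>sgn(s)^n / n^|s|\<close>, and a list \<open>[s1, ..., sk]\<close> for the sum over
  \<open>N \<ge> n1 > ... > nk \<ge> 1\<close>; negative entries are the barred entries of the
      literature.\<close>

definition signed_pow :: "int \<Rightarrow> nat \<Rightarrow> real" where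
  "signed_pow s n = (if s < 0 then (-1) ^ n else 1) / real n ^ nat \<bar>s\<bar>"

fun mhs :: "int list \<Rightarrow> nat \<Rightarrow> real" where
  "mhs [] N = 1"
| "mhs (s # t) N = (\<Sum>n<N. signed_pow s (Suc n) * mhs t n)"

text \<open>The contraction of two entries in the quasi-shuffle algebra, for two summation variables
  that coincide: exponents add and signs multiply.\<close>

definition merge_ix :: "int \<Rightarrow> int \<Rightarrow> int" where
  "merge_ix a b = (if (a < 0) = (b < 0) then \<bar>a\<bar> + \<bar>b\<bar> else - (\<bar>a\<bar> +
      \<bar>b\<bar>))"

fun stuffle :: "int list \<Rightarrow> int list \<Rightarrow> int list list" where
  "stuffle [] v = [v]"
| "stuffle u [] = [u]"
| "stuffle (a # u) (b # v) = map ((#) a) (stuffle u (b # v)) @ map ((#) b) (stuffle (a # u) v)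
     @ map ((#) (merge_ix a b)) (stuffle u v)"

lemma signed_pow_merge:
  assumes "a \<noteq> 0" "b \<noteq> 0"
  shows "signed_pow (merge_ix a b) n = signed_pow a n * signed_pow b n"
proof -
  have "nat (\<bar>a\<bar> + \<bar>b\<bar>) = nat \<bar>a\<bar> + nat \<bar>b\<bar>"
    by simp
  moreover have "\<bar>merge_ix a b\<bar> = \<bar>a\<bar> + \<bar>b\<bar>" "merge_ix a b < 0
      \<longleftrightarrow> (a < 0) \<noteq> (b < 0)"
    using assms by (auto simp: merge_ix_def)
  moreover have "(-1::real) ^ n * (-1) ^ n = 1"
    by (simp flip: power_mult_distrib)
  ultimately show ?thesis
    by (simp add: signed_pow_def power_add)
qed

lemma mhs_Suc: "mhs (s # t) (Suc N) = mhs (s # t) N + signed_pow s (Suc N) * mhs t N"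
  by simp

lemma sum_list_mhs_Cons_0: "(\<Sum>w\<leftarrow>map ((#) s) W. mhs w 0) = 0"
  by (induction W) auto

lemma sum_list_mhs_Cons_Suc: "(\<Sum>w\<leftarrow>map ((#) s) W. mhs w (Suc N)) =
    (\<Sum>w\<leftarrow>map ((#) s) W. mhs w N) + signed_pow s (Suc N) * (\<Sum>w\<leftarrow>W. mhs w N)"
  by (induction W) (auto simp: algebra_simps)

text \<open>A discrete product rule: from \<open>N\<close> to \<open>Suc N\<close> a product changes
  by \<open>du * v + u * dv + du * dv\<close>, and these three increments are the three branches of
  \<open>stuffle\<close>, the last one with the merged entry. The induction is on \<open>N\<close>,
  with both words arbitrary.\<close>

lemma mhs_stuffle:
  assumes "0 \<notin> set u" "0 \<notin> set v"
  shows "mhs u N * mhs v N = (\<Sum>w\<leftarrow>stuffle u v. mhs w N)"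
  using assms
proof (induction N arbitrary: u v)
  case 0
  show ?case
    by (cases u; cases v) (auto simp del: map_map simp: sum_list_mhs_Cons_0)
next
  case (Suc N)
  show ?case
  proof (cases u)
    case u: (Cons a u')
    show ?thesis
    proof (cases v)
      case v: (Cons b v')
      have IH: "mhs u N * mhs v N = (\<Sum>w\<leftarrow>stuffle u v. mhs w N)"
        "mhs u' N * mhs v N = (\<Sum>w\<leftarrow>stuffle u' v. mhs w N)"
        "mhs u N * mhs v' N = (\<Sum>w\<leftarrow>stuffle u v'. mhs w N)"
        "mhs u' N * mhs v' N = (\<Sum>w\<leftarrow>stuffle u' v'. mhs w N)"
        using Suc.prems unfolding u v by (intro Suc.IH; simp)+
      have m: "signed_pow (merge_ix a b) (Suc N) = signed_pow a (Suc N) * signed_pow b (Suc N)"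
        using Suc.prems u v by (intro signed_pow_merge) auto
      have "(\<Sum>w\<leftarrow>stuffle u v. mhs w (Suc N)) = (\<Sum>w\<leftarrow>stuffle u v. mhs w N)
          + signed_pow a (Suc N) * (\<Sum>w\<leftarrow>stuffle u' v. mhs w N)
          + signed_pow b (Suc N) * (\<Sum>w\<leftarrow>stuffle u v'. mhs w N)
          + signed_pow (merge_ix a b) (Suc N) * (\<Sum>w\<leftarrow>stuffle u' v'. mhs w N)"
        unfolding u v stuffle.simps map_append sum_list_append sum_list_mhs_Cons_Suc
        by (simp add: algebra_simps)
      also have "\<dots> = mhs u (Suc N) * mhs v (Suc N)"
        unfolding u v mhs_Suc m IH[unfolded u v, symmetric] by (simp add: algebra_simps)
      finally show ?thesis by simp
    qed (use u in simp)
  qed simp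
qed

section \<open>Iterated integrals as power series\<close>

text \<open>The letter \<open>a = 1, -1\<close> stands for the form \<open>a dx / (1 - a x)\<close> and the letter \<open>0\<close> for \<open>dx / x\<close>;
  \<open>psi a\<close> is \<open>x\<close> times the form. Division by \<open>n = 0\<close> makes
      the constant coefficient of an integral vanish.\<close>

definition psi :: "int \<Rightarrow> real fps" where
  "psi a = (if a = 0 then 1 else Abs_fps (\<lambda>n. if n = 0 then 0 else of_int a ^ n))"

fun hpl :: "int list \<Rightarrow> real fps" where
  "hpl [] = 1"
| "hpl (a # w) = Abs_fps (\<lambda>n. (psi a * hpl w) $ n / real n)"

fun shuf :: "int list \<Rightarrow> int list \<Rightarrow> int list list" where
  "shuf [] v = [v]"
| "shuf w [] = [w]"
| "shuf (a # w) (b # v) = map ((#) a) (shuf w (b # v)) @ map ((#) b) (shuf (a # w) v)"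

text \<open>The Euler operator \<open>x d/dx\<close>. Compared with the derivative it saves a factor
  \<open>1/x\<close>, so that the form \<open>dx / x\<close> becomes the power series
  \<open>1\<close>.\<close>

definition theta :: "real fps \<Rightarrow> real fps" where
  "theta f = fps_X * fps_deriv f"

lemma theta_nth: "theta f $ n = real n * f $ n"
  by (cases n) (auto simp: theta_def)

lemma theta_mult: "theta (f * g) = theta f * g + f * theta g"
  by (simp add: theta_def algebra_simps)

lemma theta_add: "theta (f + g) = theta f + theta g"
  by (simp add: theta_def algebra_simps)

lemma fps_eq_theta:
  assumes "theta f = theta g" "f $ 0 = g $ 0"
  shows "f = g"
proof (rule fps_ext)
  fix n show "f $ n = g $ n"
    using assms theta_nth[of f n] theta_nth[of g n] by (cases n) auto
qed

text \<open>Integrals over words ending in \<open>0\<close> diverge at the lower end point.\<close>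

abbreviation proper :: "int list \<Rightarrow> bool" where
  "proper w \<equiv> w = [] \<or> last w \<noteq> 0"

lemma hpl_Cons_0 [simp]: "hpl (a # w) $ 0 = 0"
  by simp

text \<open>The defining equation of an iterated integral. Only the constant coefficient of the
  integrand could spoil it, since \<open>theta\<close> kills it; it is nonzero just for the word
  \<open>[0]\<close>, whose integral would be a logarithm, and \<open>proper\<close> excludes this
  case.\<close>

lemma theta_hpl_Cons:
  assumes "proper (a # w)"
  shows "theta (hpl (a # w)) = psi a * hpl w"
proof (rule fps_ext)
  fix n
  have "(psi a * hpl w) $ 0 = 0"
    using assms by (cases w) (auto simp: psi_def)
  then show "theta (hpl (a # w)) $ n = (psi a * hpl w) $ n"
    by (cases n) (auto simp: theta_nth)
qed

lemma theta_sum_list_hpl: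
  assumes "\<And>x. x \<in> set W \<Longrightarrow> proper (a # x)"
  shows "theta (\<Sum>x\<leftarrow>map ((#) a) W. hpl x) = psi a * (\<Sum>x\<leftarrow>W. hpl x)"
  using assms
  by (induction W) (auto simp: theta_add theta_hpl_Cons theta_def[of 0] algebra_simps simp del: hpl.simps(2))

lemma sum_list_hpl_nth_0: "(\<Sum>x\<leftarrow>map ((#) a) W. hpl x) $ 0 = 0"
  by (induction W) auto

lemma shuf_proper: "x \<in> set (shuf w v) \<Longrightarrow> proper w \<Longrightarrow> proper v
    \<Longrightarrow>
    proper x \<and> (w \<noteq> [] \<or> v \<noteq> [] \<longrightarrow> x \<noteq> [])"
proof (induction w v arbitrary: x rule: shuf.induct)
  case (3 a w b v)
  then show ?case by (fastforce split: if_splits)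
qed auto

text \<open>Integration by parts: under \<open>theta\<close> the product rule strips the first
  letter of one factor or of the other, which is the recursion of \<open>shuf\<close>. Only the
  constant coefficient is lost under \<open>theta\<close>, and for nonempty words it vanishes on
  both sides.\<close>

lemma hpl_shuf:
  assumes "proper w" "proper v"
  shows "hpl w * hpl v = (\<Sum>x\<leftarrow>shuf w v. hpl x)"
  using assms
proof (induction w v rule: shuf.induct)
  case (3 a w b v)
  have p: "proper w" "proper v" "proper (a # w)" "proper (b # v)" using 3 by (auto split: if_splits)
  have pa: "proper (a # x)" if "x \<in> set (shuf w (b # v))" for x
    using shuf_proper[OF that] p by auto
  have pb: "proper (b # x)" if "x \<in> set (shuf (a # w) v)" for x
    using shuf_proper[OF that] p by auto
  have ta: "theta (\<Sum>x\<leftarrow>map ((#) a) (shuf w (b # v)). hpl x) = psi a *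
      (\<Sum>x\<leftarrow>shuf w (b # v). hpl x)"
    by (rule theta_sum_list_hpl) (rule pa)
  have tb: "theta (\<Sum>x\<leftarrow>map ((#) b) (shuf (a # w) v). hpl x) = psi b *
      (\<Sum>x\<leftarrow>shuf (a # w) v. hpl x)"
    by (rule theta_sum_list_hpl) (rule pb)
  show ?case
  proof (rule fps_eq_theta)
    show "theta (hpl (a # w) * hpl (b # v)) = theta (\<Sum>x\<leftarrow>shuf (a # w) (b # v). hpl x)"
      unfolding shuf.simps map_append sum_list_append theta_add ta tb
      unfolding 3(1)[OF p(1,4), symmetric] 3(2)[OF p(3,2), symmetric]
      by (simp add: theta_mult theta_hpl_Cons[OF p(3)] theta_hpl_Cons[OF p(4)] algebra_simps
          del: hpl.simps(2))
    show "(hpl (a # w) * hpl (b # v)) $ 0 = (\<Sum>x\<leftarrow>shuf (a # w) (b # v). hpl x) $ 0"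
      unfolding shuf.simps map_append sum_list_append fps_add_nth sum_list_hpl_nth_0 by simp
  qed
qed auto

text \<open>The coefficients of an integral involve the letters through \<open>l1^(n1 - n2) * l2^(n2 - n3) * ...\<close>, so an
  entry of the index is negative iff the letter differs from the preceding one, which is the
      argument \<open>a\<close>;
  \<open>k\<close> counts the zeros in between.\<close>

fun word_ix :: "int \<Rightarrow> int \<Rightarrow> int list \<Rightarrow> int list" where
  "word_ix a k [] = []"
| "word_ix a k (l # w) = (if l = 0 then word_ix a (k + 1) w
     else (if l = a then k + 1 else - (k + 1)) # word_ix l 0 w)"

abbreviation ix :: "int list \<Rightarrow> int list" where
  "ix w \<equiv> word_ix 1 0 w"

text \<open>The increments of \<open>mhs u\<close>. The empty index corresponds to the power series
  \<open>1\<close>, so its whole mass sits at \<open>n = 0\<close>.\<close>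

definition mhs_diff :: "int list \<Rightarrow> nat \<Rightarrow> real" where
  "mhs_diff u n = (case u of [] \<Rightarrow> of_bool (n = 0) | s # t \<Rightarrow> if n = 0 then 0
      else signed_pow s n * mhs t (n - 1))"

lemma sum_mhs_diff: "(\<Sum>n\<le>N. mhs_diff u n) = mhs u N"
  by (induction N) (auto simp: mhs_diff_def split: list.splits)

abbreviation letters :: "int list \<Rightarrow> bool" where
  "letters w \<equiv> set w \<subseteq> {0, 1, -1}"

text \<open>The parameters \<open>a\<close> and \<open>k\<close> make the induction possible:
  \<open>k\<close> zeros read so far contribute \<open>n^(-k)\<close>, and \<open>a\<close> is the
  last nonzero letter. In the convolution with \<open>psi l\<close> the powers
  \<open>l^(n - i)\<close> and \<open>l^i\<close> combine to \<open>l^n = a^n * (a * l)^n\<close>,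
  whose second factor is the sign of the next entry.\<close>

lemma hpl_nth_ix:
  assumes "proper w" "letters w" "a = 1 \<or> a = -1" "k \<ge> 0" "w \<noteq> []"
  shows "hpl w $ n / real n ^ nat k = of_int a ^ n * mhs_diff (word_ix a k w) n"
  using assms
proof (induction w arbitrary: a k n)
  case (Cons l w)
  show ?case
  proof (cases "l = 0")
    case True
    then have w: "w \<noteq> []" using Cons.prems by auto
    have "hpl w $ n / real n ^ nat (k + 1) = of_int a ^ n * mhs_diff (word_ix a (k + 1) w) n"
      using Cons.prems w True by (intro Cons.IH) auto
    moreover have "nat (k + 1) = Suc (nat k)" using Cons.prems by auto
    ultimately show ?thesis using True by (simp add: psi_def field_simps)
  next
    case False
    then have l: "l = 1 \<or> l = -1" using Cons.prems by auto
    have ll: "of_int l ^ i * of_int l ^ i = (1::real)" for i :: nat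
      using l by (auto simp flip: power_mult_distrib)
    have la: "of_int l = (if l = a then of_int a else - of_int a :: real)"
      using l Cons.prems by auto
    have h: "hpl w $ m = of_int l ^ m * mhs_diff (word_ix l 0 w) m" for m
    proof (cases "w = []")
      case False
      then show ?thesis using Cons.IH[of l 0 m] Cons.prems l by auto
    qed (auto simp: mhs_diff_def)
    show ?thesis
    proof (cases n)
      case (Suc m)
      have "(psi l * hpl w) $ n = (\<Sum>i\<le>n. psi l $ (n - i) * hpl w $ i)"
        by (simp add: mult.commute[of "psi l"] fps_mult_nth atLeast0AtMost mult.commute)
      \<comment> \<open>The term \<open>i = n\<close> drops out because \<open>psi l\<close> has no
        constant coefficient; this makes the nested summation strict.\<close>
      also have "\<dots> = (\<Sum>i\<le>m. psi l $ (n - i) * hpl w $ i)"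
        unfolding Suc using False by (simp add: psi_def)
      also have "\<dots> = (\<Sum>i\<le>m. of_int l ^ n * mhs_diff (word_ix l 0 w) i)"
      proof (rule sum.cong)
        fix i assume "i \<in> {..m}"
        then have i: "n - i \<noteq> 0" "n = (n - i) + i" using Suc by auto
        have "psi l $ (n - i) * hpl w $ i = of_int l ^ (n - i) * of_int l ^ i * mhs_diff (word_ix l
            0 w) i"
          using False i(1) by (simp add: psi_def h)
        also have "of_int l ^ (n - i) * of_int l ^ i = (of_int l ^ n :: real)"
          using i(2) by (metis power_add)
        finally show "psi l $ (n - i) * hpl w $ i = of_int l ^ n * mhs_diff (word_ix l 0 w) i" .
      qed auto
      also have "\<dots> = of_int l ^ n * mhs (word_ix l 0 w) m"
        by (simp add: sum_mhs_diff flip: sum_distrib_left)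
      finally have 1: "(psi l * hpl w) $ n = of_int l ^ n * mhs (word_ix l 0 w) m" .
      have k: "nat (k + 1) = Suc (nat k)" "nat (1 + k) = Suc (nat k)" "nat \<bar>- 1 - k\<bar> = Suc
          (nat k)" "\<not> k < -1" using Cons.prems by auto
      have s: "signed_pow (if l = a then k + 1 else - (k + 1)) n = of_int l ^ n * of_int a ^ n /
          real n ^ Suc (nat k)"
        using ll[of n] Cons.prems(4) l Cons.prems(3) k
        by (auto simp: signed_pow_def simp flip: power_mult_distrib)
      have aa: "of_int a ^ n * (of_int a ^ n * z) = (z::real)" for z
        using Cons.prems by (auto simp flip: power_mult_distrib mult.assoc)
      have "hpl (l # w) $ n / real n ^ nat k = of_int l ^ n * mhs (word_ix l 0 w) m / real n ^ Suc
          (nat k)"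
        using 1 by (simp add: divide_divide_eq_left)
      also have "\<dots> = of_int a ^ n * (of_int l ^ n * of_int a ^ n / real n ^ Suc (nat k) * mhs
          (word_ix l 0 w) m)"
        using aa[of "of_int l ^ n * mhs (word_ix l 0 w) m / real n ^ Suc (nat k)"]
        by (simp add: mult_ac del: power_Suc)
      also have "\<dots> = of_int a ^ n * mhs_diff (word_ix a k (l # w)) n"
        unfolding s[symmetric] using False Suc by (simp add: mhs_diff_def)
      finally show ?thesis .
    qed (use False in \<open>auto simp: mhs_diff_def\<close>)
  qed
qed simp

lemma hpl_nth:
  assumes "proper w" "letters w"
  shows "hpl w $ n = mhs_diff (ix w) n"
  using hpl_nth_ix[of w 1 0 n] assms by (cases "w = []") (auto simp: mhs_diff_def)

section \<open>Rates of convergence\<close>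

lemma harm_power_bound:
  assumes "0 < e"
  shows "\<exists>C>0. \<forall>n. harm (Suc n) ^ k \<le> C * real (Suc n) powr e"
proof (cases "k = 0")
  case True
  then show ?thesis using assms by (intro exI[of _ 1]) (auto simp: ge_one_powr_ge_zero)
next
  case False
  \<comment> \<open>The logarithm is at most \<open>n^d / d\<close>, and for this \<open>d\<close>
    the \<open>k\<close>-th power of \<open>n^d\<close> is \<open>n^e\<close>.\<close>
  define d where "d = e / k"
  have d: "d > 0" "d * k = e" using False assms by (auto simp: d_def)
  have "harm (Suc n) ^ k \<le> (1 / d + 1) ^ k * real (Suc n) powr e" for n
  proof -
    have "harm (Suc n) - ln (real (Suc n)) \<le> harm (Suc 0) - ln (real (Suc 0))"
      using decseq_harm_diff_ln unfolding decseq_def by blast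
    then have "harm (Suc n) \<le> ln (real (Suc n)) + 1"
      by (simp add: harm_expand)
    also have "ln (real (Suc n)) \<le> real (Suc n) powr d / d"
      using d by (intro ln_powr_bound) auto
    also have "real (Suc n) powr d / d + 1 \<le> (1 / d + 1) * real (Suc n) powr d"
      using ge_one_powr_ge_zero[of "real (Suc n)" d] d by (simp add: field_simps)
    finally have "harm (Suc n) ^ k \<le> ((1 / d + 1) * real (Suc n) powr d) ^ k"
      by (intro power_mono harm_nonneg) simp
    also have "\<dots> = (1 / d + 1) ^ k * real (Suc n) powr e"
      using d by (simp add: power_mult_distrib powr_power mult.commute)
    finally show ?thesis .
  qed
  then show ?thesis using d by (intro exI[of _ "(1 / d + 1) ^ k"]) (auto intro!: zero_less_power
      add_pos_pos)
qed

lemma abs_signed_pow: "\<bar>signed_pow s n\<bar> = 1 / real n ^ nat \<bar>s\<bar>"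
  by (auto simp: signed_pow_def abs_mult power_abs)

lemma abs_signed_pow_le: "s \<noteq> 0 \<Longrightarrow> \<bar>signed_pow s (Suc n)\<bar> \<le> 1 /
    real (Suc n)"
  unfolding abs_signed_pow
  by (intro divide_left_mono self_le_power) auto

lemma abs_mhs_le: "0 \<notin> set u \<Longrightarrow> \<bar>mhs u N\<bar> \<le> harm N ^ length u"
proof (induction u arbitrary: N)
  case (Cons s t)
  have "\<bar>mhs (s # t) N\<bar> \<le> (\<Sum>n<N. \<bar>signed_pow s (Suc n)\<bar> * \<bar>mhs t
      n\<bar>)"
    by (auto simp flip: abs_mult intro: order.trans[OF sum_abs])
  also have "\<dots> \<le> (\<Sum>n<N. 1 / real (Suc n) * harm N ^ length t)"
  proof (intro sum_mono mult_mono)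
    fix n assume n: "n \<in> {..<N}"
    show "\<bar>signed_pow s (Suc n)\<bar> \<le> 1 / real (Suc n)"
      using Cons by (intro abs_signed_pow_le) auto
    have "\<bar>mhs t n\<bar> \<le> harm n ^ length t" using Cons by auto
    also have "\<dots> \<le> harm N ^ length t"
      using n by (intro power_mono harm_mono harm_nonneg) auto
    finally show "\<bar>mhs t n\<bar> \<le> harm N ^ length t" .
  qed auto
  also have "\<dots> = harm N ^ length (s # t)"
    by (simp add: harm_altdef sum_distrib_right inverse_eq_divide)
  finally show ?case .
qed simp

lemma harm_Suc_ge_1: "(1::real) \<le> harm (Suc n)"
  using harm_mono[of 1 "Suc n", where 'a = real] by (simp add: harm_expand)

lemma abs_mhs_diff_le:
  assumes "0 \<notin> set u"
  shows "\<bar>mhs_diff u (Suc n)\<bar> \<le> harm (Suc n) ^ length u / real (Suc n)"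
proof (cases u)
  case Nil
  then show ?thesis by (simp add: mhs_diff_def)
next
  case (Cons s t)
  have "\<bar>mhs_diff u (Suc n)\<bar> = \<bar>signed_pow s (Suc n)\<bar> * \<bar>mhs t n\<bar>"
    by (simp add: Cons mhs_diff_def abs_mult)
  also have "\<dots> \<le> 1 / real (Suc n) * harm n ^ length t"
    using assms Cons by (intro mult_mono abs_signed_pow_le abs_mhs_le) auto
  also have "harm n ^ length t \<le> (harm (Suc n) :: real) ^ length t"
    by (intro power_mono harm_mono harm_nonneg) auto
  also have "\<dots> \<le> harm (Suc n) ^ length u"
    using harm_Suc_ge_1 Cons by (intro power_increasing) auto
  finally show ?thesis by (simp add: divide_right_mono)
qed

text \<open>From index \<open>N\<close> on the weight is at least \<open>sqrt (Suc N)\<close>, and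
  the tail gains this factor over the weighted series.\<close>

lemma summable_tail_sqrt:
  fixes b :: "nat \<Rightarrow> real"
  assumes "summable (\<lambda>n. sqrt (Suc n) * \<bar>b n\<bar>)"
  shows "\<exists>l C. \<forall>N. \<bar>(\<Sum>n<N. b n) - l\<bar> \<le> C / sqrt (Suc N)"
proof -
  define K where "K = (\<Sum>n. sqrt (Suc n) * \<bar>b n\<bar>)"
  have b: "summable (\<lambda>n. \<bar>b n\<bar>)"
  proof (rule summable_comparison_test'[OF assms, of 0])
    fix n :: nat
    have "1 * \<bar>b n\<bar> \<le> sqrt (Suc n) * \<bar>b n\<bar>" by (intro mult_right_mono) auto
    then show "norm \<bar>b n\<bar> \<le> sqrt (Suc n) * \<bar>b n\<bar>" by simp
  qed
  have "\<bar>(\<Sum>n<N. b n) - suminf b\<bar> \<le> K / sqrt (Suc N)" for N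
  proof -
    have bN: "summable (\<lambda>n. \<bar>b (n + N)\<bar>)"
      using b by (rule summable_ignore_initial_segment)
    have aN: "summable (\<lambda>n. sqrt (Suc (n + N)) * \<bar>b (n + N)\<bar>)"
      using assms by (rule summable_ignore_initial_segment)
    have "\<bar>(\<Sum>n<N. b n) - suminf b\<bar> = \<bar>\<Sum>n. b (n + N)\<bar>"
      using suminf_minus_initial_segment[OF summable_rabs_cancel[OF b], of N] by simp
    also have "\<dots> \<le> (\<Sum>n. \<bar>b (n + N)\<bar>)" by (rule summable_rabs[OF bN])
    also have "\<dots> \<le> (\<Sum>n. sqrt (Suc (n + N)) * \<bar>b (n + N)\<bar> / sqrt (Suc N))"
    proof (rule suminf_le[OF _ bN])
      fix n
      show "\<bar>b (n + N)\<bar> \<le> sqrt (Suc (n + N)) * \<bar>b (n + N)\<bar> / sqrt (Suc N)"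
        using mult_right_mono[of "sqrt (Suc N)" "sqrt (Suc (n + N))" "\<bar>b (n + N)\<bar>"]
        by (simp add: field_simps)
    qed (intro summable_divide aN)
    also have "\<dots> = (\<Sum>n. sqrt (Suc (n + N)) * \<bar>b (n + N)\<bar>) / sqrt (Suc N)"
      by (rule suminf_divide[OF aN])
    also have "(\<Sum>n. sqrt (Suc (n + N)) * \<bar>b (n + N)\<bar>) \<le> K"
      unfolding K_def using suminf_minus_initial_segment[OF assms, of N] sum_nonneg[of "{..<N}"
          "\<lambda>n. sqrt (Suc n) * \<bar>b n\<bar>"]
      by simp
    finally show ?thesis by (simp add: divide_right_mono)
  qed
  then show ?thesis by blast
qed

lemma harm_summable_sqrt:
  fixes b :: "nat \<Rightarrow> real"
  assumes "\<And>n. \<bar>b n\<bar> \<le> c * harm (Suc n) ^ k / real (Suc n) ^ 2" "c \<ge> 0"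
  shows "summable (\<lambda>n. sqrt (Suc n) * \<bar>b n\<bar>)"
proof -
  \<comment> \<open>The exponent \<open>1/4\<close> leaves room for the weight:
    \<open>1/2 + 1/4 - 2 = -5/4 < -1\<close>.\<close>
  obtain C where C: "C > 0" "\<And>n. harm (Suc n) ^ k \<le> C * real (Suc n) powr (1/4)"
    using harm_power_bound[of "1/4" k] by auto
  have "summable (\<lambda>n. real n powr (-5/4))" by (simp add: summable_real_powr_iff)
  then have "summable (\<lambda>n. real (Suc n) powr (-5/4))" by (subst summable_Suc_iff)
  then have s: "summable (\<lambda>n. c * C * real (Suc n) powr (-5/4))" by (rule summable_mult)
  show ?thesis
  proof (rule summable_comparison_test'[OF s, of 0])
    fix n
    have "sqrt (Suc n) * \<bar>b n\<bar> \<le> sqrt (Suc n) * (c * (C * real (Suc n) powr (1/4)) /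
        real (Suc n) ^ 2)"
      using assms C by (intro mult_left_mono order.trans[OF assms(1)] divide_right_mono) auto
    also have "\<dots> = c * C * (real (Suc n) powr (1/2) * real (Suc n) powr (1/4) * real (Suc n)
        powr (-2))"
      by (simp add: powr_half_sqrt powr_minus field_simps)
    also have "real (Suc n) powr (1/2) * real (Suc n) powr (1/4) * real (Suc n) powr (-2) = real
        (Suc n) powr (-5/4)"
      by (simp flip: powr_add)
    finally show "norm (sqrt (Suc n) * \<bar>b n\<bar>) \<le> c * C * real (Suc n) powr (-5/4)" by simp
  qed
qed

lemma harm_power_over_sqrt: "(\<lambda>n. harm n ^ k / sqrt (Suc n)) \<longlonglongrightarrow> 0"
proof -
  obtain C where C: "C > 0" "\<And>n. harm (Suc n) ^ k \<le> C * real (Suc n) powr (1/4)"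
    using harm_power_bound[of "1/4" k] by auto
  have "(\<lambda>n. real n powr (-1/4)) \<longlonglongrightarrow> 0"
    by (rule tendsto_neg_powr[OF _ filterlim_real_sequentially]) simp
  then have 0: "(\<lambda>n. C * real (Suc n) powr (-1/4)) \<longlonglongrightarrow> C * 0"
    by (intro tendsto_mult_left LIMSEQ_Suc)
  show ?thesis
  proof (rule Lim_null_comparison)
    show "(\<lambda>n. C * real (Suc n) powr (-1/4)) \<longlonglongrightarrow> 0" using 0 by simp
    show "\<forall>\<^sub>F n in sequentially. norm (harm n ^ k / sqrt (Suc n)) \<le> C * real (Suc
        n) powr (-1/4)"
    proof (intro always_eventually allI)
      fix n
      have "harm n ^ k \<le> (harm (Suc n) ^ k :: real)"
        by (intro power_mono harm_mono harm_nonneg) auto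
      also note C(2)[of n]
      finally have "harm n ^ k / sqrt (Suc n) \<le> C * real (Suc n) powr (1/4) / sqrt (Suc n)"
        by (intro divide_right_mono) auto
      also have "\<dots> = C * (real (Suc n) powr (1/4) * real (Suc n) powr (-1/2))"
        by (simp add: powr_half_sqrt powr_minus field_simps)
      also have "real (Suc n) powr (1/4) * real (Suc n) powr (-1/2) = real (Suc n) powr (-1/4)"
        by (simp flip: powr_add)
      finally show "norm (harm n ^ k / sqrt (Suc n)) \<le> C * real (Suc n) powr (-1/4)"
        by (simp add: harm_nonneg)
    qed
  qed
qed

text \<open>The alternating sum is averaged with its own shift. This trades the terms
  \<open>a n\<close> for differences, which are small enough for absolute convergence when the first
  entry is \<open>-1\<close>.\<close>

lemma alternating_sum_shift:
  fixes a :: "nat \<Rightarrow> real"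
  shows "2 * (\<Sum>n<N. (-1) ^ Suc n * a n) = (\<Sum>n<N. (-1) ^ Suc n * (a n - a (Suc n))) - a 0 +
      (-1) ^ N * a N"
  by (induction N) (auto simp: algebra_simps)

text \<open>If the first entry has absolute value at least 2, the terms are of order
  \<open>log^k n / n^2\<close>. For the first entry \<open>-1\<close> the averaged alternating sum
  has terms of that order, and its boundary term \<open>a N\<close> is of order
  \<open>log^k N / N\<close>. The rate \<open>N^(-1/2)\<close> is far from sharp, but it absorbs
  every power of the logarithm.\<close>

lemma mhs_rate:
  assumes "0 \<notin> set u" "u = [] \<or> hd u \<noteq> 1"
  shows "\<exists>l C. \<forall>N. \<bar>mhs u N - l\<bar> \<le> C / sqrt (Suc N)"
proof (cases u)
  case Nil
  then show ?thesis by (intro exI[of _ 1] exI[of _ 0]) simp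
next
  case (Cons s t)
  then have s: "s \<noteq> 0" "s \<noteq> 1" and t: "0 \<notin> set t" using assms by auto
  have mt: "\<bar>mhs t n\<bar> \<le> harm (Suc n) ^ length t" for n
  proof -
    have "\<bar>mhs t n\<bar> \<le> harm n ^ length t" by (rule abs_mhs_le[OF t])
    also have "\<dots> \<le> harm (Suc n) ^ length t"
      by (intro power_mono harm_mono harm_nonneg) auto
    finally show ?thesis .
  qed
  show ?thesis
  proof (cases "s = -1")
    case False
    have "\<bar>signed_pow s (Suc n) * mhs t n\<bar> \<le> 1 * harm (Suc n) ^ length t / real (Suc
        n) ^ 2" for n
    proof -
      have "\<bar>signed_pow s (Suc n)\<bar> \<le> 1 / real (Suc n) ^ 2"
        unfolding abs_signed_pow using s False by (intro divide_left_mono power_increasing) auto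
      then have "\<bar>signed_pow s (Suc n)\<bar> * \<bar>mhs t n\<bar> \<le> 1 / real (Suc n) ^ 2 *
          harm (Suc n) ^ length t"
        using mt by (intro mult_mono) auto
      then show ?thesis by (simp add: abs_mult)
    qed
    from summable_tail_sqrt[OF harm_summable_sqrt[OF this]] show ?thesis by (simp add: Cons)
  next
    case True
    define a where "a n = mhs t n / real (Suc n)" for n
    define b where "b n = (-1) ^ Suc n * (a n - a (Suc n))" for n :: nat
    have sum: "2 * mhs u N = (\<Sum>n<N. b n) - a 0 + (-1) ^ N * a N" for N
      using alternating_sum_shift[of a N]
      by (simp add: Cons True a_def b_def signed_pow_def mult.commute)
    have "\<bar>b n\<bar> \<le> 2 * harm (Suc n) ^ length t / real (Suc n) ^ 2" for n
    proof -
      have "mhs t (Suc n) = mhs t n + mhs_diff t (Suc n)"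
        using sum_mhs_diff[of t n] sum_mhs_diff[of t "Suc n"] by simp
      \<comment> \<open>Either the denominator changes, which costs
        \<open>1 / ((n + 1) * (n + 2))\<close>, or the inner sum changes by its increment; both
        parts are of order \<open>log^k n / n^2\<close>.\<close>
      then have "a n - a (Suc n) = mhs t n * (1 / (real (Suc n) * real (Suc (Suc n)))) - mhs_diff t
          (Suc n) / real (Suc (Suc n))"
        by (simp add: a_def divide_simps) (simp add: algebra_simps)
      then have "\<bar>b n\<bar> \<le> \<bar>mhs t n\<bar> * (1 / (real (Suc n) * real (Suc (Suc
          n)))) + \<bar>mhs_diff t (Suc n)\<bar> / real (Suc (Suc n))"
        by (auto simp: b_def abs_mult power_abs intro!: order.trans[OF abs_triangle_ineq4])
      also have "\<dots> \<le> harm (Suc n) ^ length t * (1 / (real (Suc n) * real (Suc n))) + harm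
          (Suc n) ^ length t / real (Suc n) / real (Suc n)"
        by (intro add_mono mult_mono mt frac_le abs_mhs_diff_le[OF t]) (auto simp: harm_nonneg)
      finally show ?thesis by (simp add: power2_eq_square)
    qed
    from summable_tail_sqrt[OF harm_summable_sqrt[OF this]]
    obtain l C where l: "\<And>N. \<bar>(\<Sum>n<N. b n) - l\<bar> \<le> C / sqrt (Suc N)" by auto
    obtain D where D: "D > 0" "\<And>n. harm (Suc n) ^ length t \<le> D * real (Suc n) powr (1/2)"
      using harm_power_bound[of "1/2" "length t"] by auto
    have a: "\<bar>a N\<bar> \<le> D / sqrt (Suc N)" for N
    proof -
      have "\<bar>a N\<bar> \<le> D * real (Suc N) powr (1/2) / real (Suc N)"
        unfolding a_def by (simp add: abs_mult divide_right_mono order.trans[OF mt D(2)] del: of_nat_Suc)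
      also have "\<dots> = D / sqrt (Suc N)"
        by (simp add: powr_half_sqrt field_simps del: of_nat_Suc)
      finally show ?thesis .
    qed
    define l' where "l' = (l - a 0) / 2"
    then have l': "2 * l' = l - a 0" by simp
    have "\<bar>mhs u N - l'\<bar> \<le> ((C + D) / 2) / sqrt (Suc N)" for N
    proof -
      have "2 * \<bar>mhs u N - l'\<bar> = \<bar>2 * (mhs u N - l')\<bar>"
        by (simp only: abs_mult)
      also have "2 * (mhs u N - l') = ((\<Sum>n<N. b n) - l) + (-1) ^ N * a N"
        unfolding right_diff_distrib sum l' by simp
      also have "\<bar>\<dots>\<bar> \<le> \<bar>(\<Sum>n<N. b n) - l\<bar> + \<bar>(-1) ^ N * a N\<bar>"
        by (rule abs_triangle_ineq)
      also have "\<bar>(-1) ^ N * a N\<bar> = \<bar>a N\<bar>"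
        by (simp add: abs_mult)
      also have "\<bar>(\<Sum>n<N. b n) - l\<bar> + \<bar>a N\<bar> \<le> C / sqrt (Suc N) + D /
          sqrt (Suc N)"
        using l a by (intro add_mono)
      finally show ?thesis by (simp add: add_divide_distrib)
    qed
    then show ?thesis by blast
  qed
qed

section \<open>Alternating multiple zeta values as limits\<close>

definition mzv :: "int list \<Rightarrow> real" where
  "mzv u = lim (mhs u)"

text \<open>The condition under which the limit in \<open>mzv\<close> is known to exist. A leading
  entry \<open>1\<close> is excluded, as in the harmonic series itself.\<close>

abbreviation admissible :: "int list \<Rightarrow> bool" where
  "admissible u \<equiv> 0 \<notin> set u \<and> (u = [] \<or> hd u \<noteq> 1)"

lemma inverse_sqrt_bound_tendsto_0:
  fixes f :: "nat \<Rightarrow> real"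
  assumes "\<And>N. \<bar>f N\<bar> \<le> C / sqrt (Suc N)"
  shows "f \<longlonglongrightarrow> 0"
proof (rule Lim_null_comparison)
  have "(\<lambda>N. C * (harm N ^ 0 / sqrt (Suc N))) \<longlonglongrightarrow> C * 0"
    by (intro tendsto_mult_left harm_power_over_sqrt)
  then show "(\<lambda>N. C / sqrt (Suc N)) \<longlonglongrightarrow> 0" by simp
  show "\<forall>\<^sub>F N in sequentially. norm (f N) \<le> C / sqrt (Suc N)"
    using assms by (intro always_eventually) simp
qed

lemma mhs_mzv_rate:
  assumes "admissible u"
  shows "\<exists>C. \<forall>N. \<bar>mhs u N - mzv u\<bar> \<le> C / sqrt (Suc N)"
proof -
  obtain l C where lC: "\<And>N. \<bar>mhs u N - l\<bar> \<le> C / sqrt (Suc N)"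
    using mhs_rate assms by blast
  have "(\<lambda>N. mhs u N - l) \<longlonglongrightarrow> 0"
    by (rule inverse_sqrt_bound_tendsto_0) (rule lC)
  then have "mhs u \<longlonglongrightarrow> l" by (simp add: LIM_zero_iff)
  then have "mzv u = l" by (auto simp: mzv_def intro: limI)
  then show ?thesis using lC by blast
qed

lemma mhs_tendsto:
  assumes "admissible u"
  shows "mhs u \<longlonglongrightarrow> mzv u"
proof -
  obtain C where C: "\<And>N. \<bar>mhs u N - mzv u\<bar> \<le> C / sqrt (Suc N)"
    using mhs_mzv_rate[OF assms] by blast
  have "(\<lambda>N. mhs u N - mzv u) \<longlonglongrightarrow> 0"
    by (rule inverse_sqrt_bound_tendsto_0) (rule C)
  then show ?thesis by (simp add: LIM_zero_iff)
qed

lemma sum_list_mhs_tendsto: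
  assumes "\<And>u. u \<in> set U \<Longrightarrow> admissible u"
  shows "(\<lambda>N. \<Sum>u\<leftarrow>U. mhs u N) \<longlonglongrightarrow>
      (\<Sum>u\<leftarrow>U. mzv u)"
  using assms
proof (induction U)
  case (Cons u U)
  then have "mhs u \<longlonglongrightarrow> mzv u" by (intro mhs_tendsto) auto
  with Cons show ?case by (auto intro: tendsto_add)
qed simp

section \<open>Comparison of the shuffle and stuffle products\<close>

text \<open>With \<open>k = N + 1 - m\<close> the partial fraction
  \<open>1 / (m * k) = (1/m + 1/k) / (m + k)\<close> has the constant denominator
  \<open>m + k = N + 1\<close>, and either half sums to \<open>harm N\<close>.\<close>

lemma sum_inverse_mult_sqrt_le:
  "(\<Sum>m=1..N. 1 / (real m * sqrt (Suc (N - m)))) \<le> 2 * harm N / sqrt (Suc N)"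
proof -
  have "(\<Sum>m=1..N. 1 / (real m * sqrt (Suc (N - m))))
      \<le> (\<Sum>m=1..N. (1 / real m + 1 / real (Suc (N - m))) / sqrt (Suc N))"
  proof (intro sum_mono)
    fix m assume m: "m \<in> {1..N}"
    define k where "k = Suc (N - m)"
    have k: "m > 0" "k > 0" "Suc N = m + k" using m by (auto simp: k_def)
    have "1 / (real m * sqrt k) = sqrt k / (real m * real k)"
      using k by (simp add: field_simps)
    also have "\<dots> \<le> sqrt (m + k) / (real m * real k)"
      using k by (intro divide_right_mono) auto
    also have "\<dots> = (1 / real m + 1 / real k) / sqrt (m + k)"
      using k by (simp add: divide_simps)
    finally show "1 / (real m * sqrt (Suc (N - m))) \<le> (1 / real m + 1 / real (Suc (N - m))) /
        sqrt (Suc N)"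
      by (simp only: k(3) k_def)
  qed
  also have "\<dots> = ((\<Sum>m=1..N. 1 / real m) + (\<Sum>m=1..N. 1 / real (Suc (N - m)))) / sqrt
      (Suc N)"
    by (simp only: sum.distrib flip: sum_divide_distrib)
  also have "(\<Sum>m=1..N. 1 / real (Suc (N - m))) = (\<Sum>m=1..N. 1 / real m)"
    by (rule sum.reindex_bij_witness[of _ "\<lambda>m. Suc N - m" "\<lambda>m. Suc N - m"]) (auto
        simp: Suc_diff_le)
  also have "(\<Sum>m=1..N. 1 / real m) = harm N"
    by (simp add: harm_def inverse_eq_divide)
  finally show ?thesis by simp
qed

text \<open>Since \<open>d\<close> need not be absolutely summable, the classical theorem on Cauchy
  products does not apply. The rate of \<open>e\<close> compensates: the convolution is of order
  \<open>harm N ^ (k + 1) / sqrt N\<close>.\<close>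

lemma convolution_tendsto_0:
  fixes d e :: "nat \<Rightarrow> real"
  assumes d: "\<And>n. \<bar>d (Suc n)\<bar> \<le> harm (Suc n) ^ k / real (Suc n)" and d0: "d 0 = 0"
    and e: "\<And>n. \<bar>e n\<bar> \<le> C / sqrt (Suc n)"
  shows "(\<lambda>N. \<Sum>m\<le>N. d m * e (N - m)) \<longlonglongrightarrow> 0"
proof (rule Lim_null_comparison)
  have "(\<lambda>N. 2 * C * (harm N ^ Suc k / sqrt (Suc N))) \<longlonglongrightarrow> 2 * C * 0"
    by (intro tendsto_mult_left harm_power_over_sqrt)
  then show "(\<lambda>N. 2 * C * (harm N ^ Suc k / sqrt (Suc N))) \<longlonglongrightarrow> 0" by simp
  have C: "C \<ge> 0" using e[of 0] by simp
  show "\<forall>\<^sub>F N in sequentially. norm (\<Sum>m\<le>N. d m * e (N - m)) \<le> 2 * C *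
      (harm N ^ Suc k / sqrt (Suc N))"
  proof (intro always_eventually allI)
    fix N :: nat
    have "{..N} = insert 0 {1..N}" by force
    then have "norm (\<Sum>m\<le>N. d m * e (N - m)) = \<bar>\<Sum>m=1..N. d m * e (N - m)\<bar>"
      using d0 by simp
    also have "\<dots> \<le> (\<Sum>m=1..N. \<bar>d m\<bar> * \<bar>e (N - m)\<bar>)"
      by (rule order.trans[OF sum_abs]) (simp add: abs_mult)
    also have "\<dots> \<le> (\<Sum>m=1..N. (harm N ^ k / real m) * (C / sqrt (Suc (N - m))))"
    proof (intro sum_mono mult_mono e)
      fix m assume "m \<in> {1..N}"
      then obtain n where n: "m = Suc n" "Suc n \<le> N" by (cases m) auto
      have "\<bar>d m\<bar> \<le> harm (Suc n) ^ k / real (Suc n)" using d n by simp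
      also have "\<dots> \<le> harm N ^ k / real (Suc n)"
        using n by (intro divide_right_mono power_mono harm_mono harm_nonneg) auto
      finally show "\<bar>d m\<bar> \<le> harm N ^ k / real m" by (simp add: n)
    qed (auto intro!: divide_nonneg_nonneg zero_le_power harm_nonneg)
    also have "\<dots> = C * harm N ^ k * (\<Sum>m=1..N. 1 / (real m * sqrt (Suc (N - m))))"
      by (simp add: sum_distrib_left algebra_simps)
    also have "\<dots> \<le> C * harm N ^ k * (2 * harm N / sqrt (Suc N))"
      by (intro mult_left_mono sum_inverse_mult_sqrt_le) (auto simp: C harm_nonneg)
    finally show "norm (\<Sum>m\<le>N. d m * e (N - m)) \<le> 2 * C * (harm N ^ Suc k / sqrt (Suc N))"
      by (simp add: algebra_simps)
  qed
qed

lemma sum_fps_mult_nth: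
  fixes f g :: "'a :: comm_semiring_1 fps"
  shows "(\<Sum>n\<le>N. (f * g) $ n) = (\<Sum>m\<le>N. f $ m * (\<Sum>j\<le>N - m. g $ j))"
proof (induction N)
  case (Suc N)
  have "(\<Sum>m\<le>N. f $ m * (\<Sum>j\<le>Suc N - m. g $ j))
      = (\<Sum>m\<le>N. f $ m * (\<Sum>j\<le>N - m. g $ j) + f $ m * g $ (Suc N - m))"
    by (intro sum.cong refl) (auto simp: Suc_diff_le distrib_left)
  with Suc show ?case
    by (simp add: fps_mult_nth atLeast0AtMost sum.distrib add_ac)
qed (simp add: fps_mult_nth)

lemma word_ix_nonzero: "k \<ge> 0 \<Longrightarrow> 0 \<notin> set (word_ix a k w)"
  by (induction w arbitrary: a k) auto

lemma hd_word_ix: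
  assumes "k \<ge> 1" "proper w" "letters w" "w \<noteq> []"
  shows "word_ix a k w \<noteq> [] \<and> hd (word_ix a k w) \<noteq> 1"
  using assms by (induction w arbitrary: k) (auto split: if_splits)

text \<open>Divergence at \<open>1\<close> can come only from a leading form
  \<open>dx / (1 - x)\<close>: a leading \<open>0\<close> raises the first exponent to at least 2,
  and a leading \<open>-1\<close> makes the first entry negative.\<close>

lemma admissible_ix:
  assumes "proper w" "letters w" "w = [] \<or> hd w \<noteq> 1"
  shows "admissible (ix w)"
proof (cases w)
  case (Cons l w')
  show ?thesis
  proof (cases "l = 0")
    case True
    then show ?thesis using Cons assms hd_word_ix[of 1 w' 1] word_ix_nonzero[of 0 1 w]
      by (auto split: if_splits)
  next
    case False
    then show ?thesis using Cons assms word_ix_nonzero[of 0 1 w] by auto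
  qed
qed simp

lemma shuf_letters: "x \<in> set (shuf w v) \<Longrightarrow> set x \<subseteq> set w \<union> set v"
  by (induction w v arbitrary: x rule: shuf.induct) fastforce+

lemma sum_hpl: "proper w \<Longrightarrow> letters w \<Longrightarrow> (\<Sum>n\<le>N. hpl w $ n) =
    mhs (ix w) N"
  by (simp add: hpl_nth sum_mhs_diff)

lemma sum_sum_list_fps_nth:
  "(\<Sum>x\<leftarrow>xs. \<Sum>n\<le>N. F x $ n) = (\<Sum>n\<le>N. (\<Sum>x\<leftarrow>xs. F x) $ n)"
  by (induction xs) (auto simp: sum.distrib)

text \<open>Truncated at \<open>N\<close>, the shuffle product is \<open>\<Sum>m\<le>N. v_m * W(N - m)\<close>. Replacing \<open>W(N - m)\<close> by its limit costs a
  convolution with the tail of \<open>W\<close>, which is of order \<open>N^(-1/2)\<close>. The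
      factor \<open>v\<close> may diverge, and so this
  yields the shuffle relations as well as the regularized ones.\<close>

lemma shuf_minus_product_tendsto_0:
  assumes v: "proper v" "letters v" "v \<noteq> []" and w: "proper w" "letters w" "w = [] \<or> hd w
      \<noteq> 1"
  shows "(\<lambda>N. (\<Sum>x\<leftarrow>shuf v w. mhs (ix x) N) - mhs (ix v) N * mhs (ix w) N)
      \<longlonglongrightarrow> 0"
proof -
  define e where "e N = mhs (ix w) N - mzv (ix w)" for N
  obtain C where C: "\<And>N. \<bar>e N\<bar> \<le> C / sqrt (Suc N)"
    using mhs_mzv_rate[OF admissible_ix[OF w]] unfolding e_def by blast
  have nz: "0 \<notin> set (ix v)" by (rule word_ix_nonzero) simp
  have sh: "(\<Sum>x\<leftarrow>shuf v w. mhs (ix x) N) = (\<Sum>m\<le>N. hpl v $ m * mhs (ix w) (N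
      - m))" for N
  proof -
    have x: "proper x \<and> letters x" if "x \<in> set (shuf v w)" for x
      using shuf_proper[OF that] shuf_letters[OF that] v w by fastforce
    have "(\<Sum>x\<leftarrow>shuf v w. mhs (ix x) N) = (\<Sum>x\<leftarrow>shuf v w. \<Sum>n\<le>N.
        hpl x $ n)"
      by (intro arg_cong[of _ _ sum_list] map_cong refl) (use x sum_hpl in auto)
    also have "\<dots> = (\<Sum>n\<le>N. (\<Sum>x\<leftarrow>shuf v w. hpl x) $ n)"
      by (rule sum_sum_list_fps_nth)
    also have "\<dots> = (\<Sum>n\<le>N. (hpl v * hpl w) $ n)"
      using v w by (simp add: hpl_shuf)
    also have "\<dots> = (\<Sum>m\<le>N. hpl v $ m * mhs (ix w) (N - m))"
      using w by (simp add: sum_fps_mult_nth sum_hpl)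
    finally show ?thesis .
  qed
  have "(\<lambda>N. \<Sum>m\<le>N. hpl v $ m * e (N - m)) \<longlonglongrightarrow> 0"
  proof (rule convolution_tendsto_0[OF _ _ C])
    show "\<bar>hpl v $ Suc n\<bar> \<le> harm (Suc n) ^ length (ix v) / real (Suc n)" for n
      using abs_mhs_diff_le[OF nz] v by (simp add: hpl_nth)
    show "hpl v $ 0 = 0" using v by (cases v) auto
  qed
  \<comment> \<open>\<open>mhs (ix v)\<close> may be unbounded, but it grows only logarithmically,
    so the rate of \<open>e\<close> wins.\<close>
  moreover have "(\<lambda>N. mhs (ix v) N * e N) \<longlonglongrightarrow> 0"
  proof (rule Lim_null_comparison)
    have "(\<lambda>N. C * (harm N ^ length (ix v) / sqrt (Suc N))) \<longlonglongrightarrow> C * 0"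
      by (intro tendsto_mult_left harm_power_over_sqrt)
    then show "(\<lambda>N. harm N ^ length (ix v) * (C / sqrt (Suc N))) \<longlonglongrightarrow>
        0" by (simp add: mult_ac)
    show "\<forall>\<^sub>F N in sequentially. norm (mhs (ix v) N * e N) \<le> harm N ^ length (ix
        v) * (C / sqrt (Suc N))"
    proof (intro always_eventually allI)
      fix N
      have "\<bar>mhs (ix v) N\<bar> * \<bar>e N\<bar> \<le> harm N ^ length (ix v) * (C / sqrt (Suc N))"
        by (intro mult_mono C abs_mhs_le nz) (auto simp: harm_nonneg)
      then show "norm (mhs (ix v) N * e N) \<le> harm N ^ length (ix v) * (C / sqrt (Suc N))"
        by (simp add: abs_mult)
    qed
  qed
  ultimately have "(\<lambda>N. (\<Sum>m\<le>N. hpl v $ m * e (N - m)) - mhs (ix v) N * e N)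
      \<longlonglongrightarrow> 0"
    using tendsto_diff by fastforce
  moreover have "(\<Sum>m\<le>N. hpl v $ m * e (N - m)) - mhs (ix v) N * e N =
      (\<Sum>x\<leftarrow>shuf v w. mhs (ix x) N) - mhs (ix v) N * mhs (ix w) N" for N
  proof -
    have "(\<Sum>m\<le>N. hpl v $ m * e (N - m)) = (\<Sum>x\<leftarrow>shuf v w. mhs (ix x) N) - mhs
        (ix v) N * mzv (ix w)"
      using v by (simp add: sh e_def right_diff_distrib sum_subtractf flip: sum_distrib_right sum_hpl)
    then show ?thesis by (simp add: e_def algebra_simps)
  qed
  ultimately show ?thesis by simp
qed

section \<open>Stuffle, shuffle and regularized relations\<close>

lemma mzv_stuffle:
  assumes "admissible u" "admissible v" "\<forall>x\<in>set (stuffle u v). admissible x"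
  shows "mzv u * mzv v = (\<Sum>x\<leftarrow>stuffle u v. mzv x)"
proof (rule LIMSEQ_unique)
  show "(\<lambda>N. mhs u N * mhs v N) \<longlonglongrightarrow> mzv u * mzv v"
    using assms by (intro tendsto_mult mhs_tendsto) auto
  show "(\<lambda>N. mhs u N * mhs v N) \<longlonglongrightarrow> (\<Sum>x\<leftarrow>stuffle u v.
      mzv x)"
    using assms by (simp add: mhs_stuffle sum_list_mhs_tendsto)
qed

lemma mzv_shuffle:
  assumes "proper v" "letters v" "v \<noteq> []" "hd v \<noteq> 1" "proper w" "letters w" "w = []
      \<or> hd w \<noteq> 1"
    and "\<forall>x\<in>set (shuf v w). admissible (ix x)"
  shows "mzv (ix v) * mzv (ix w) = (\<Sum>x\<leftarrow>shuf v w. mzv (ix x))"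
proof (rule LIMSEQ_unique)
  show "(\<lambda>N. mhs (ix v) N * mhs (ix w) N) \<longlonglongrightarrow> mzv (ix v) * mzv (ix w)"
    using assms by (intro tendsto_mult mhs_tendsto admissible_ix) auto
  have "(\<lambda>N. \<Sum>x\<leftarrow>shuf v w. mhs (ix x) N) \<longlonglongrightarrow>
      (\<Sum>x\<leftarrow>shuf v w. mzv (ix x))"
    using sum_list_mhs_tendsto[of "map ix (shuf v w)"] assms by (auto simp: o_def)
  from tendsto_diff[OF this shuf_minus_product_tendsto_0[of v w]] assms
  show "(\<lambda>N. mhs (ix v) N * mhs (ix w) N) \<longlonglongrightarrow> (\<Sum>x\<leftarrow>shuf
      v w. mzv (ix x))"
    by simp
qed

text \<open>Both lists start with the same divergent sum: the word \<open>1 # w\<close> has index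
  \<open>1 # ix w\<close>, which is also the first stuffle term. It cancels for every
  \<open>N\<close> before the limit is taken, and \<open>tl\<close> removes it on both
  sides.\<close>

lemma mzv_regularized:
  assumes w: "proper w" "letters w" "w \<noteq> []" "hd w \<noteq> 1"
    and adm: "\<forall>x\<in>set (tl (shuf [1] w)). admissible (ix x)" "\<forall>x\<in>set (tl
        (stuffle [1] (ix w))). admissible x"
  shows "(\<Sum>x\<leftarrow>tl (shuf [1] w). mzv (ix x)) = (\<Sum>x\<leftarrow>tl (stuffle [1] (ix
      w)). mzv x)"
proof (rule LIMSEQ_unique)
  show "(\<lambda>N. \<Sum>x\<leftarrow>tl (stuffle [1] (ix w)). mhs x N) \<longlonglongrightarrow>
      (\<Sum>x\<leftarrow>tl (stuffle [1] (ix w)). mzv x)"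
    using adm by (intro sum_list_mhs_tendsto) auto
  obtain s t where st: "ix w = s # t" 
    using hd_word_ix[of 1 "tl w" 1] w by (cases w) (auto split: if_splits simp: neq_Nil_conv)
  obtain b w' where bw: "w = b # w'" using w by (cases w) auto
  have 1: "(\<Sum>x\<leftarrow>shuf [1] w. mhs (ix x) N) = mhs (1 # ix w) N + (\<Sum>x\<leftarrow>tl
      (shuf [1] w). mhs (ix x) N)" for N
    by (simp add: bw)
  have "mhs (ix [1]) N * mhs (ix w) N = (\<Sum>x\<leftarrow>stuffle [1] (ix w). mhs x N)" for N
    using mhs_stuffle[of "[1]" "ix w" N] word_ix_nonzero[of 0 1 w] by simp
  then have 2: "mhs (ix [1]) N * mhs (ix w) N = mhs (1 # ix w) N + (\<Sum>x\<leftarrow>tl (stuffle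
      [1] (ix w)). mhs x N)" for N
    by (simp add: st)
  have "(\<lambda>N. \<Sum>x\<leftarrow>tl (shuf [1] w). mhs (ix x) N) \<longlonglongrightarrow>
      (\<Sum>x\<leftarrow>tl (shuf [1] w). mzv (ix x))"
    using sum_list_mhs_tendsto[of "map ix (tl (shuf [1] w))"] adm by (auto simp: o_def)
  from tendsto_diff[OF this shuf_minus_product_tendsto_0[of "[1]" w]] w
  show "(\<lambda>N. \<Sum>x\<leftarrow>tl (stuffle [1] (ix w)). mhs x N) \<longlonglongrightarrow>
      (\<Sum>x\<leftarrow>tl (shuf [1] w). mzv (ix x))"
    unfolding 1 2 by simp
qed

section \<open>Limits at the right end point\<close>

lemma less_fps_conv_radius:
  fixes f :: "real fps" and x :: real
  assumes "fps_conv_radius f \<ge> 1" "\<bar>x\<bar> < 1"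
  shows "ereal (norm x) < fps_conv_radius f"
proof -
  have "ereal (norm x) < 1" using assms(2) by (simp add: one_ereal_def)
  also note assms(1)
  finally show ?thesis .
qed

text \<open>Abel's theorem. Summation by parts expresses \<open>f(x) - S\<close> as
  \<open>(1 - x)\<close> times the power series of the errors of the partial sums; these are
  bounded, and small from some index on.\<close>

lemma abel_limit:
  fixes f :: "real fps"
  assumes "(\<lambda>N. \<Sum>n\<le>N. f $ n) \<longlonglongrightarrow> S"
  shows "fps_conv_radius f \<ge> 1" "(eval_fps f \<longlongrightarrow> S) (at_left 1)"
proof -
  have "summable (\<lambda>n. f $ n * 1 ^ n)"
    using assms by (auto simp: summable_def sums_def_le)
  from conv_radius_geI[OF this] show r: "fps_conv_radius f \<ge> 1"
    by (simp add: fps_conv_radius_def one_ereal_def)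
  define e where "e n = (\<Sum>k\<le>n. f $ k) - S" for n
  have e0: "e \<longlonglongrightarrow> 0" using assms by (simp add: e_def[abs_def] LIM_zero_iff)
  then obtain K where K: "\<And>n. \<bar>e n\<bar> \<le> K" "K > 0"
    using convergent_imp_Bseq[of e] by (auto simp: Bseq_def convergent_def)
  have eq: "(\<lambda>n. (1 - x) * (e n * x ^ n)) sums (eval_fps f x - S)" if x: "0 < x" "x < 1" for x
  proof -
    have "summable (\<lambda>n. K * x ^ n)" using x by (intro summable_mult summable_geometric) auto
    then have s: "summable (\<lambda>n. e n * x ^ n)"
      by (rule summable_comparison_test') (use x K in \<open>auto simp: abs_mult intro!:
          mult_right_mono\<close>)
    have "norm x < fps_conv_radius f" using x by (intro less_fps_conv_radius r) auto
    then have f: "(\<lambda>n. f $ n * x ^ n) sums eval_fps f x" by (rule sums_eval_fps)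
    have "(\<lambda>n. f $ Suc n * x ^ Suc n) sums (eval_fps f x - f $ 0)"
      using f by (subst sums_Suc_iff) simp
    moreover have "f $ Suc n = e (Suc n) - e n" for n by (simp add: e_def)
    ultimately have "(\<lambda>n. e (Suc n) * x ^ Suc n - x * (e n * x ^ n)) sums (eval_fps f x - f $ 0)"
      by (simp add: algebra_simps)
    moreover have "(\<lambda>n. e (Suc n) * x ^ Suc n) sums ((\<Sum>n. e n * x ^ n) - e 0)"
      using summable_sums[OF s] by (subst sums_Suc_iff) simp
    moreover have "(\<lambda>n. x * (e n * x ^ n)) sums (x * (\<Sum>n. e n * x ^ n))"
      by (intro sums_mult summable_sums s)
    ultimately have "(\<Sum>n. e n * x ^ n) - e 0 - x * (\<Sum>n. e n * x ^ n) = eval_fps f x - f $ 0"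
      using sums_unique2[OF sums_diff] by blast
    then have "eval_fps f x - S = (1 - x) * (\<Sum>n. e n * x ^ n)"
      by (simp add: e_def left_diff_distrib)
    then show ?thesis using sums_mult[OF summable_sums[OF s], of "1 - x"] by simp
  qed
  show "(eval_fps f \<longlongrightarrow> S) (at_left 1)"
  proof (rule tendstoI)
    fix \<epsilon> :: real assume \<epsilon>: "\<epsilon> > 0"
    obtain M where M: "\<And>n. n \<ge> M \<Longrightarrow> \<bar>e n\<bar> < \<epsilon> / 2"
      using LIMSEQ_D[OF e0, of "\<epsilon> / 2"] \<epsilon> by auto
    \<comment> \<open>The threshold makes \<open>(1 - x) * K * M < \<epsilon> / 2\<close>, the
      contribution of the first \<open>M\<close> errors; the \<open>+ 1\<close> keeps the
      denominator positive when \<open>M = 0\<close>.\<close>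
    have "eventually (\<lambda>x::real. x > max 0 (1 - \<epsilon> / (2 * (K * real M + 1)))) (at_left 1)"
      by (rule eventually_at_left_real[THEN eventually_mono, of "max 0 (1 - \<epsilon> / (2 * (K *
          real M + 1)))"])
         (use \<epsilon> K in \<open>auto intro!: divide_pos_pos add_nonneg_pos\<close>)
    moreover have "eventually (\<lambda>x::real. x < 1) (at_left 1)"
      by (simp add: eventually_at_filter)
    ultimately show "eventually (\<lambda>x. dist (eval_fps f x) S < \<epsilon>) (at_left 1)"
    proof eventually_elim
      case (elim x)
      then have x: "0 < x" "x < 1" "1 - x < \<epsilon> / (2 * (K * real M + 1))" by auto
      \<comment> \<open>The majorant is \<open>K\<close> on the first \<open>M\<close> terms plus a
        geometric series, which after multiplication by \<open>1 - x\<close> sums to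
        \<open>\<epsilon> / 2\<close>.\<close>
      define g where "g n = (1 - x) * ((if n < M then K else 0) + \<epsilon> / 2 * x ^ n)" for n
      have "(\<lambda>n. if n < M then K else 0) sums (\<Sum>n<M. K)"
        using sums_If_finite_set[of "{..<M}" "\<lambda>_. K"] by simp
      moreover have "(\<lambda>n. \<epsilon> / 2 * x ^ n) sums (\<epsilon> / 2 * (1 / (1 - x)))"
        using x by (intro sums_mult geometric_sums) auto
      ultimately have g: "g sums ((1 - x) * ((\<Sum>n<M. K) + \<epsilon> / 2 * (1 / (1 - x))))"
        unfolding g_def by (rule sums_mult[OF sums_add])
      have le: "\<bar>(1 - x) * (e n * x ^ n)\<bar> \<le> g n" for n
      proof -
        have "\<bar>e n\<bar> * x ^ n \<le> (if n < M then K else 0) + \<epsilon> / 2 * x ^ n"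
        proof (cases "n < M")
          case True
          have "\<bar>e n\<bar> * x ^ n \<le> K * 1" using K x by (intro mult_mono power_le_one) auto
          then show ?thesis using True \<epsilon> x by (simp add: add_increasing2)
        next
          case False
          then show ?thesis using M[of n] x by (simp add: mult_right_mono)
        qed
        then show ?thesis using x unfolding g_def by (simp add: abs_mult mult_left_mono)
      qed
      have "\<bar>eval_fps f x - S\<bar> = \<bar>\<Sum>n. (1 - x) * (e n * x ^ n)\<bar>"
        using eq[OF x(1,2)] by (simp add: sums_iff)
      also have "\<dots> \<le> suminf g"
        using norm_suminf_le[of "\<lambda>n. (1 - x) * (e n * x ^ n)" g] g le
        by (simp add: sums_iff)
      also have "\<dots> = (1 - x) * (K * real M) + (1 - x) * (\<epsilon> / 2 * (1 / (1 - x)))"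
        unfolding sums_unique[OF g, symmetric] by (simp add: distrib_left)
      also have "(1 - x) * (\<epsilon> / 2 * (1 / (1 - x))) = \<epsilon> / 2"
        using x by (simp add: field_simps)
      also have "(1 - x) * (K * real M) + \<epsilon> / 2 < \<epsilon>"
      proof -
        have "K * real M + 1 > 0" using K by (intro add_nonneg_pos) auto
        then have "(1 - x) * (2 * (K * real M + 1)) < \<epsilon>"
          using x(3) by (subst (asm) pos_less_divide_eq) auto
        moreover define A where "A = (1 - x) * (K * real M)"
        moreover have "(1 - x) * (2 * (K * real M + 1)) = 2 * A + 2 * (1 - x)"
          by (simp add: A_def algebra_simps)
        ultimately have "2 * A + 2 * (1 - x) < \<epsilon>" by simp
        then have "A + \<epsilon> / 2 < \<epsilon>" using x(2) by (simp add: field_simps)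
        then show ?thesis by (simp add: A_def)
      qed
      finally show ?case by (simp add: dist_real_def)
    qed
  qed
qed

lemma hpl_nth_tendsto_0:
  assumes "proper w" "letters w"
  shows "(\<lambda>n. hpl w $ n) \<longlonglongrightarrow> 0"
proof (rule LIMSEQ_offset[where k = 1])
  have nz: "0 \<notin> set (ix w)" by (rule word_ix_nonzero) simp
  show "(\<lambda>n. hpl w $ (n + 1)) \<longlonglongrightarrow> 0"
  proof (rule Lim_null_comparison)
    \<comment> \<open>The factor \<open>sqrt 2\<close> comes from
      \<open>n + 2 \<le> 2 * (n + 1)^2\<close>, which turns \<open>1 / (n + 1)\<close> into the
      shifted \<open>1 / sqrt (n + 2)\<close>.\<close>
    show "(\<lambda>n. harm (Suc n) ^ length (ix w) / sqrt (Suc (Suc n)) * sqrt 2)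
        \<longlonglongrightarrow> 0"
      using tendsto_mult_left_zero[OF LIMSEQ_Suc[OF harm_power_over_sqrt]] .
    show "\<forall>\<^sub>F n in sequentially. norm (hpl w $ (n + 1)) \<le> harm (Suc n) ^ length
        (ix w) / sqrt (Suc (Suc n)) * sqrt 2"
    proof (intro always_eventually allI)
      fix n
      have "norm (hpl w $ (n + 1)) \<le> harm (Suc n) ^ length (ix w) / real (Suc n)"
        using abs_mhs_diff_le[OF nz, of n] hpl_nth[OF assms] by simp
      also have "\<dots> \<le> harm (Suc n) ^ length (ix w) * (sqrt 2 / sqrt (Suc (Suc n)))"
      proof -
        have "sqrt (real (Suc (Suc n))) \<le> sqrt (2 * real (Suc n) ^ 2)"
          by (rule real_sqrt_le_mono) (simp add: power2_eq_square algebra_simps)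
        also have "\<dots> = sqrt 2 * real (Suc n)" by (simp add: real_sqrt_mult)
        finally have "1 / real (Suc n) \<le> sqrt 2 / sqrt (Suc (Suc n))"
          by (simp add: divide_simps mult.commute)
        then have "harm (Suc n) ^ length (ix w) * (1 / real (Suc n))
            \<le> harm (Suc n) ^ length (ix w) * (sqrt 2 / sqrt (Suc (Suc n)))"
          by (intro mult_left_mono) (auto simp: harm_nonneg)
        then show ?thesis by simp
      qed
      finally show "norm (hpl w $ (n + 1)) \<le> harm (Suc n) ^ length (ix w) / sqrt (Suc (Suc n)) *
          sqrt 2"
        by (simp add: field_simps)
    qed
  qed
qed

text \<open>The word may begin with \<open>1\<close>, so that the integral may be singular at
  \<open>1\<close>. The partial sums of the coefficients of \<open>(1 - x) * hpl w\<close> telescope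
  to the \<open>N\<close>-th coefficient of \<open>hpl w\<close>, which tends to 0; Abel's theorem
  turns this into a limit.\<close>

lemma hpl_times_one_minus_tendsto_0:
  assumes "proper w" "letters w"
  shows "((\<lambda>x. (1 - x) * eval_fps (hpl w) x) \<longlongrightarrow> 0) (at_left 1)"
    and hpl_conv_radius: "fps_conv_radius (hpl w) \<ge> 1"
proof -
  have "summable (\<lambda>n. hpl w $ n * of_real r ^ n)" if r: "0 < r" "ereal r < 1" for r :: real
  proof -
    obtain K where K: "\<And>n. \<bar>hpl w $ n\<bar> \<le> K"
      using convergent_imp_Bseq[OF convergentI[OF hpl_nth_tendsto_0[OF assms]]] by (auto simp: Bseq_def)
    have "summable (\<lambda>n. K * r ^ n)" using r by (intro summable_mult summable_geometric)
        (auto simp: one_ereal_def)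
    then show ?thesis
      by (rule summable_comparison_test') (use r K in \<open>auto simp: abs_mult intro!:
          mult_right_mono\<close>)
  qed
  then show r: "fps_conv_radius (hpl w) \<ge> 1"
    unfolding fps_conv_radius_def by (rule conv_radius_geI_ex')
  have "(\<Sum>n\<le>N. ((1 - fps_X) * hpl w) $ n) = hpl w $ N" for N
    by (induction N) (auto simp: left_diff_distrib)
  then have lim: "(\<lambda>N. \<Sum>n\<le>N. ((1 - fps_X) * hpl w) $ n) \<longlonglongrightarrow> 0"
    using hpl_nth_tendsto_0[OF assms] by simp
  have eq: "eval_fps ((1 - fps_X) * hpl w) x = (1 - x) * eval_fps (hpl w) x" if "0 < x" "x < 1" for x
  proof -
    have "fps_conv_radius (1 - fps_X :: real fps) \<ge> \<infinity>"
      using fps_conv_radius_diff[of 1 "fps_X :: real fps"] by simp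
    then show ?thesis
      using that less_fps_conv_radius[OF r, of x] by (subst eval_fps_mult) (auto simp: eval_fps_diff)
  qed
  have "eventually (\<lambda>x::real. x \<in> {0<..<1}) (at_left 1)"
    by (rule eventually_at_left_real) simp
  then have "eventually (\<lambda>x. eval_fps ((1 - fps_X) * hpl w) x = (1 - x) * eval_fps (hpl w)
      x) (at_left 1)"
    by eventually_elim (simp add: eq)
  then show "((\<lambda>x. (1 - x) * eval_fps (hpl w) x) \<longlongrightarrow> 0) (at_left 1)"
    by (rule Lim_transform_eventually[OF abel_limit(2)[OF lim]])
qed

lemma eval_hpl_tendsto:
  assumes "proper w" "letters w" "w = [] \<or> hd w \<noteq> 1"
  shows "(eval_fps (hpl w) \<longlongrightarrow> mzv (ix w)) (at_left 1)"
proof (rule abel_limit(2))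
  show "(\<lambda>N. \<Sum>n\<le>N. hpl w $ n) \<longlonglongrightarrow> mzv (ix w)"
    using mhs_tendsto[OF admissible_ix[OF assms]] assms by (simp add: sum_hpl)
qed

lemma has_derivative_eval_fps_theta:
  fixes x :: real
  assumes "fps_conv_radius f \<ge> 1" "0 < x" "x < 1"
  shows "(eval_fps f has_real_derivative (eval_fps (theta f) x / x)) (at x)"
proof -
  have r: "norm x < fps_conv_radius f"
    using assms by (intro less_fps_conv_radius) auto
  then have "norm x < fps_conv_radius (fps_deriv f)"
    using fps_conv_radius_deriv[of f] by (rule less_le_trans)
  then have "eval_fps (theta f) x = x * eval_fps (fps_deriv f) x"
    by (simp add: theta_def eval_fps_mult)
  then show ?thesis
    using has_field_derivative_eval_fps[OF r, of UNIV] assms by simp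
qed

lemma continuous_on_eval_fps_unit:
  fixes f :: "real fps"
  assumes "fps_conv_radius f \<ge> 1"
  shows "continuous_on {-1<..<1} (eval_fps f)"
  by (rule continuous_on_subset[OF continuous_on_eval_fps])
     (use less_fps_conv_radius[OF assms] in \<open>auto simp: in_eball_iff\<close>)

lemma theta_conv_radius: "fps_conv_radius (theta f) \<ge> fps_conv_radius f"
  unfolding theta_def
  using fps_conv_radius_mult[of fps_X "fps_deriv f"] fps_conv_radius_deriv[of f] by simp

section \<open>Landen's substitution\<close>

text \<open>For \<open>u = x / (1 + x)\<close> the chain rule gives \<open>G(u)\<close> the
  derivative \<open>theta G(u) / (x * (1 + x))\<close>. So \<open>ode\<close> says that both sides
  have the same derivative, and they agree at \<open>0\<close>.\<close>

lemma eval_fps_landen: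
  fixes F G :: "real fps"
  assumes F: "fps_conv_radius F \<ge> 1" and G: "fps_conv_radius G \<ge> 1" and 0: "F $ 0 = G $ 0"
    and ode: "\<And>x. 0 < x \<Longrightarrow> x < 1 \<Longrightarrow> (1 + x) * eval_fps (theta F)
        x = eval_fps (theta G) (x / (1 + x))"
    and x: "0 \<le> x" "x < 1"
  shows "eval_fps F x = eval_fps G (x / (1 + x))"
proof (cases "x = 0")
  case True
  then show ?thesis using 0 by (simp add: eval_fps_at_0)
next
  case False
  define h where "h y = eval_fps F y - eval_fps G (y / (1 + y))" for y
  have "h x = h 0"
  proof (rule DERIV_isconst_end[of 0 x h])
    show "0 < x" using False x by simp
    show "continuous_on {0..x} h"
    proof -
      have "continuous_on {0..x} (eval_fps F)"
        using x by (intro continuous_on_subset[OF continuous_on_eval_fps_unit[OF F]]) auto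
      moreover have "continuous_on {0..x} (\<lambda>y. eval_fps G (y / (1 + y)))"
        by (rule continuous_on_compose2[OF continuous_on_eval_fps_unit[OF G]])
           (use x in \<open>auto intro!: continuous_intros simp: less_divide_eq\<close>)
      ultimately show ?thesis unfolding h_def by (rule continuous_on_diff)
    qed
  next
    fix y assume y: "0 < y" "y < x"
    define u where "u = y / (1 + y)"
    have u: "0 < u" "u < 1" using y by (auto simp: u_def)
    have d1: "(eval_fps F has_real_derivative (eval_fps (theta F) y / y)) (at y)"
      using y x by (intro has_derivative_eval_fps_theta F) auto
    have d2: "(eval_fps G has_real_derivative (eval_fps (theta G) u / u)) (at u)"
      by (intro has_derivative_eval_fps_theta G u)
    have d3: "((\<lambda>y. y / (1 + y)) has_real_derivative 1 / (1 + y) ^ 2) (at y)"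
      using y by (auto intro!: derivative_eq_intros simp: field_simps power2_eq_square)
    have "(h has_real_derivative (eval_fps (theta F) y / y - eval_fps (theta G) u / u * (1 / (1 + y)
        ^ 2))) (at y)"
      unfolding h_def using DERIV_chain2[OF d2[unfolded u_def] d3] d1
      by (auto intro!: DERIV_diff simp: u_def)
    moreover have "z * t / (y / z) * (1 / z ^ 2) = t / y" if "z > 0" for z t :: real
      using that by (simp add: power2_eq_square)
    then have "eval_fps (theta G) u / u * (1 / (1 + y) ^ 2) = eval_fps (theta F) y / y"
      unfolding u_def ode[of y, symmetric, OF y(1) order.strict_trans[OF y(2) x(2)]]
      using y by simp
    ultimately show "(h has_real_derivative 0) (at y)" by simp
  qed
  also have "h 0 = 0" using 0 by (simp add: h_def eval_fps_at_0)
  finally show ?thesis by (simp add: h_def)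
qed

text \<open>The substitution \<open>x = t / (1 + t)\<close> turns \<open>dx / x\<close> into \<open>dt / t - dt / (1 + t)\<close> and \<open>dx / (1 - x)\<close> into
  \<open>dt / (1 + t)\<close>, and it maps \<open>t = 1\<close> to \<open>x = 1/2\<close>.\<close>

fun landen_words :: "int list \<Rightarrow> int list list" where
  "landen_words [] = [[]]"
| "landen_words (a # w) = (if a = 0 then map ((#) 0) (landen_words w) @ map ((#) (-1)) (landen_words w)
     else map ((#) (-1)) (landen_words w))"

text \<open>The sign arises because the letter \<open>-1\<close> stands for
  \<open>- dt / (1 + t)\<close>: the image of \<open>dx / (1 - x)\<close> is minus this letter,
  while that of \<open>dx / x\<close> is the sum of the letters \<open>0\<close> and
  \<open>-1\<close>.\<close>

definition landen_fps :: "int list \<Rightarrow> real fps" where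
  "landen_fps w = (-1) ^ count_list w 1 * (\<Sum>v\<leftarrow>landen_words w. hpl v)"

abbreviation binary :: "int list \<Rightarrow> bool" where
  "binary w \<equiv> set w \<subseteq> {0, 1}"

lemma landen_words:
  assumes "v \<in> set (landen_words w)" "proper w"
  shows "proper v \<and> letters v \<and> (v = [] \<or> hd v \<noteq> 1) \<and> (w = []
      \<longleftrightarrow> v = [])"
  using assms
proof (induction w arbitrary: v)
  case (Cons a w)
  then obtain x where x: "x \<in> set (landen_words w)" "v = 0 # x \<and> a = 0 \<or> v = -1 # x"
    by (auto split: if_splits)
  have "proper w" using Cons.prems by auto
  from Cons.IH[OF x(1) this] show ?case using x(2) Cons.prems by (auto split: if_splits)
qed auto

lemma psi_minus_1: "(1 + fps_X) * (1 + psi (-1)) = 1"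
proof (rule fps_ext)
  fix n
  have "(1 + fps_X) * (1 + psi (-1)) = (1 + psi (-1)) + fps_X * (1 + psi (-1))"
    by (simp add: algebra_simps)
  then show "((1 + fps_X) * (1 + psi (-1))) $ n = (1 :: real fps) $ n"
    by (cases n; cases "n - 1") (auto simp: psi_def)
qed

lemma theta_uminus_1_power: "theta ((-1) ^ k * f) = (-1) ^ k * theta f"
  by (cases "even k") (auto simp: theta_def)

text \<open>The transformed forms, multiplied by the variable, are
  \<open>1 + psi (-1) = 1 / (1 + x)\<close> and \<open>- psi (-1) = x / (1 + x)\<close>. Clearing
  the denominator \<open>1 + x\<close> keeps the equation among power series without
  division.\<close>

lemma theta_landen_fps:
  assumes "proper (a # w)" "binary (a # w)"
  shows "(1 + fps_X) * theta (landen_fps (a # w)) = (if a = 0 then 1 else fps_X) * landen_fps w"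
proof -
  have w: "proper w" using assms by auto
  have p: "proper (b # v)" if "v \<in> set (landen_words w)" "a = 0 \<or> b \<noteq> 0" for v b
    using landen_words[OF that(1) w] that(2) assms by auto
  have t: "theta (\<Sum>v\<leftarrow>map ((#) b) (landen_words w). hpl v) = psi b *
      (\<Sum>v\<leftarrow>landen_words w. hpl v)"
    if "a = 0 \<or> b \<noteq> 0" for b
    using p that by (intro theta_sum_list_hpl) auto
  define S where "S = (\<Sum>v\<leftarrow>landen_words w. hpl v)"
  show ?thesis
  proof (cases "a = 0")
    case True
    have "theta (landen_fps (a # w)) = (-1) ^ count_list w 1 * ((1 + psi (-1)) * S)"
      using True t[of 0] t[of "-1"]
      by (simp add: landen_fps_def theta_uminus_1_power theta_add S_def psi_def[of 0] algebra_simps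
          del: map_map)
    then have "(1 + fps_X) * theta (landen_fps (a # w)) = ((1 + fps_X) * (1 + psi (-1))) * ((-1) ^
        count_list w 1 * S)"
      by (simp only: mult_ac)
    then show ?thesis using True by (simp add: psi_minus_1 landen_fps_def S_def)
  next
    case False
    then have a: "a = 1" using assms by auto
    have "theta (landen_fps (a # w)) = - ((-1) ^ count_list w 1 * (psi (-1) * S))"
      unfolding landen_fps_def theta_uminus_1_power using t[of "-1"] a by (simp add: S_def del: map_map)
    then have "(1 + fps_X) * theta (landen_fps (a # w)) = - ((1 + fps_X) * psi (-1)) * ((-1) ^
        count_list w 1 * S)"
      by (simp only: mult_ac mult_minus_left mult_minus_right)
    also have "(1 + fps_X) * psi (-1) = (1 + fps_X) * (1 + psi (-1)) - (1 + fps_X)"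
      by (simp add: algebra_simps)
    also have "\<dots> = - fps_X" by (simp add: psi_minus_1)
    finally show ?thesis using False by (simp add: landen_fps_def S_def)
  qed
qed

lemma landen_fps_sums:
  assumes "proper w"
  shows "(\<lambda>N. \<Sum>n\<le>N. landen_fps w $ n) \<longlonglongrightarrow> (-1) ^ count_list w
      1 * (\<Sum>v\<leftarrow>landen_words w. mzv (ix v))"
proof -
  note lw = landen_words[OF _ assms]
  have "admissible (ix v)" if "v \<in> set (landen_words w)" for v
    using lw[OF that] by (intro admissible_ix) auto
  then have "(\<lambda>N. \<Sum>u\<leftarrow>map ix (landen_words w). mhs u N)
      \<longlonglongrightarrow> (\<Sum>u\<leftarrow>map ix (landen_words w). mzv u)"
    by (intro sum_list_mhs_tendsto) auto
  moreover have "(\<Sum>u\<leftarrow>map ix (landen_words w). mhs u N) = (\<Sum>n\<le>N.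
      (\<Sum>v\<leftarrow>landen_words w. hpl v) $ n)" for N
    unfolding sum_sum_list_fps_nth[symmetric] map_map o_def
    by (intro arg_cong[of _ _ sum_list] map_cong refl sum_hpl[symmetric]) (use lw in blast)+
  ultimately have "(\<lambda>N. \<Sum>n\<le>N. (\<Sum>v\<leftarrow>landen_words w. hpl v) $ n)
      \<longlonglongrightarrow> (\<Sum>v\<leftarrow>landen_words w. mzv (ix v))"
    by (simp add: o_def)
  then show ?thesis
    by (cases "even (count_list w 1)") (auto simp: landen_fps_def sum_negf intro: tendsto_minus)
qed

lemma landen_fps_conv_radius: "proper w \<Longrightarrow> fps_conv_radius (landen_fps w) \<ge> 1"
  by (rule abel_limit(1)[OF landen_fps_sums])

lemma landen_fps_nth_0: "landen_fps (a # w) $ 0 = 0"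
proof -
  have "(\<Sum>v\<leftarrow>landen_words (a # w). hpl v) $ 0 = 0"
    by (simp add: sum_list_hpl_nth_0 del: map_map)
  then show ?thesis
    by (cases "even (count_list (a # w) 1)") (simp_all add: landen_fps_def del: landen_words.simps)
qed

lemma eval_psi_1:
  fixes u :: real
  assumes "0 < u" "u < 1"
  shows "fps_conv_radius (psi 1) \<ge> 1" "eval_fps (psi 1) u = u / (1 - u)"
proof -
  have s: "(\<lambda>n. r * r ^ n) sums (r * (1 / (1 - r)))" if "0 < r" "r < 1" for r :: real
    using that by (intro sums_mult geometric_sums) auto
  have ps: "(\<lambda>n. psi 1 $ n * r ^ n) sums (r / (1 - r))" if "0 < r" "r < 1" for r :: real
  proof -
    have "(\<lambda>n. psi 1 $ Suc n * r ^ Suc n) sums (r / (1 - r))" using s[OF that] by (simp add: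
        psi_def)
    then show ?thesis by (subst (asm) sums_Suc_iff) (simp add: psi_def)
  qed
  then show "eval_fps (psi 1) u = u / (1 - u)"
    using assms by (simp add: eval_fps_def sums_iff)
  show "fps_conv_radius (psi 1) \<ge> 1"
    unfolding fps_conv_radius_def
  proof (rule conv_radius_geI_ex')
    fix r :: real assume "0 < r" "ereal r < 1"
    then have "(\<lambda>n. psi 1 $ n * r ^ n) sums (r / (1 - r))" by (intro ps) (auto simp:
        one_ereal_def)
    then show "summable (\<lambda>n. psi 1 $ n * of_real r ^ n)" by (simp add: sums_iff)
  qed
qed

lemma eval_theta_hpl:
  assumes "proper (a # w)" "binary (a # w)" "0 < u" "u < 1"
  shows "eval_fps (theta (hpl (a # w))) u = (if a = 0 then 1 else u / (1 - u)) * eval_fps (hpl w) u"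
proof -
  have w: "proper w" "letters w" using assms by auto
  have "eval_fps (psi a * hpl w) u = eval_fps (psi a) u * eval_fps (hpl w) u"
  proof (rule eval_fps_mult)
    have "fps_conv_radius (psi a) \<ge> 1"
      using assms eval_psi_1(1)[OF assms(3,4)] by (auto simp: psi_def[of 0])
    then show "norm u < fps_conv_radius (psi a)" using assms by (intro less_fps_conv_radius) auto
    show "norm u < fps_conv_radius (hpl w)"
      using assms by (intro less_fps_conv_radius hpl_conv_radius w) auto
  qed
  then show ?thesis
    using assms eval_psi_1(2)[OF assms(3,4)] unfolding theta_hpl_Cons[OF assms(1)]
    by (auto simp: psi_def[of 0])
qed

lemma eval_landen_fps:
  assumes "proper w" "binary w" "0 \<le> x" "x < 1"
  shows "eval_fps (landen_fps w) x = eval_fps (hpl w) (x / (1 + x))"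
  using assms
proof (induction w arbitrary: x)
  case Nil
  then show ?case by (simp add: landen_fps_def)
next
  case (Cons a w)
  have w: "proper w" "binary w" using Cons.prems by auto
  show ?case
  proof (rule eval_fps_landen[OF landen_fps_conv_radius[OF Cons.prems(1)] hpl_conv_radius[OF
      Cons.prems(1)]])
    show "letters (a # w)" using Cons.prems by auto
    show "landen_fps (a # w) $ 0 = hpl (a # w) $ 0"
      unfolding landen_fps_nth_0 hpl_Cons_0 ..
    fix x :: real assume x: "0 < x" "x < 1"
    define u where "u = x / (1 + x)"
    have u: "0 < u" "u < 1" "u / (1 - u) = x" using x by (auto simp: u_def field_simps)
    have r: "fps_conv_radius (theta (landen_fps (a # w))) \<ge> 1"
      using landen_fps_conv_radius[OF Cons.prems(1)] theta_conv_radius by (rule order.trans)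
    have r1: "fps_conv_radius (1 + fps_X :: real fps) \<ge> \<infinity>"
      using fps_conv_radius_add[of 1 "fps_X :: real fps"] by simp
    have e1: "eval_fps (1 + fps_X) x = 1 + x"
      by (simp add: eval_fps_add)
    have "(1 + x) * eval_fps (theta (landen_fps (a # w))) x = eval_fps ((1 + fps_X) * theta
        (landen_fps (a # w))) x"
      using r1 x less_fps_conv_radius[OF r, of x] by (subst eval_fps_mult) (auto simp: e1)
    also have "\<dots> = (if a = 0 then 1 else x) * eval_fps (landen_fps w) x"
      unfolding theta_landen_fps[OF Cons.prems(1,2)]
      using less_fps_conv_radius[OF landen_fps_conv_radius[OF w(1)], of x] x
      by (simp add: eval_fps_mult)
    also have "\<dots> = eval_fps (theta (hpl (a # w))) (x / (1 + x))"
      using Cons.IH[OF w, of x] x eval_theta_hpl[OF Cons.prems(1,2) u(1,2)] u(3) by (simp add: u_def)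
    finally show "(1 + x) * eval_fps (theta (landen_fps (a # w))) x = eval_fps (theta (hpl (a # w)))
        (x / (1 + x))" .
  qed (use Cons.prems in auto)
qed

section \<open>Iterated integrals at \<open>1/2\<close>\<close>

definition hpl_half :: "int list \<Rightarrow> real" where
  "hpl_half w = eval_fps (hpl w) (1/2)"

lemma hpl_half_Nil [simp]: "hpl_half [] = 1"
  by (simp add: hpl_half_def)

text \<open>Landen's identity is known for \<open>x < 1\<close>. As \<open>x\<close> tends to
  \<open>1\<close>, the transformed side is governed by Abel's theorem, whereas the other side is
  continuous because \<open>1/2\<close> lies inside the disc of convergence.\<close>

lemma hpl_half_landen:
  assumes "proper w" "binary w"
  shows "hpl_half w = (-1) ^ count_list w 1 * (\<Sum>v\<leftarrow>landen_words w. mzv (ix v))"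
proof (rule tendsto_unique)
  show "(eval_fps (landen_fps w) \<longlongrightarrow> (-1) ^ count_list w 1 *
      (\<Sum>v\<leftarrow>landen_words w. mzv (ix v))) (at_left 1)"
    by (rule abel_limit(2)[OF landen_fps_sums[OF assms(1)]])
  have r: "fps_conv_radius (hpl w) \<ge> 1" using assms by (intro hpl_conv_radius) auto
  have "isCont (eval_fps (hpl w)) (1 / (1 + 1))"
    using continuous_on_eval_fps_unit[OF r]
    by (auto simp: continuous_on_eq_continuous_at)
  moreover have "isCont (\<lambda>x::real. x / (1 + x)) 1"
    by (intro continuous_intros) auto
  ultimately have "isCont (\<lambda>x. eval_fps (hpl w) (x / (1 + x))) 1"
    by (rule isCont_o2[rotated])
  then have "((\<lambda>x. eval_fps (hpl w) (x / (1 + x))) \<longlongrightarrow> eval_fps (hpl w) (1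
      / (1 + 1))) (at_left 1)"
    by (simp add: isCont_def filterlim_at_split)
  moreover have "eventually (\<lambda>x::real. x \<in> {0<..<1}) (at_left 1)"
    by (rule eventually_at_left_real) simp
  then have "eventually (\<lambda>x. eval_fps (hpl w) (x / (1 + x)) = eval_fps (landen_fps w) x)
      (at_left 1)"
    by eventually_elim (auto simp: eval_landen_fps assms)
  ultimately have "(eval_fps (landen_fps w) \<longlongrightarrow> eval_fps (hpl w) (1 / (1 + 1)))
      (at_left 1)"
    by (rule Lim_transform_eventually)
  then show "(eval_fps (landen_fps w) \<longlongrightarrow> hpl_half w) (at_left 1)"
    by (simp add: hpl_half_def)
qed simp

lemma hpl_replicate_0: "hpl (replicate p 0 @ [1]) = Abs_fps (\<lambda>n. if n = 0 then 0 else 1 /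
    real n ^ Suc p)"
  by (induction p) (auto simp: psi_def fps_eq_iff)

lemma polylog_eq_hpl_half: "polylog (Suc p) (1/2) = hpl_half (replicate p 0 @ [1])"
proof -
  have "norm (1/2 :: real) < fps_conv_radius (hpl (replicate p 0 @ [1]))"
    by (intro less_fps_conv_radius hpl_conv_radius) auto
  then have "(\<lambda>n. hpl (replicate p 0 @ [1]) $ n * (1/2) ^ n) sums hpl_half (replicate p 0 @ [1])"
    unfolding hpl_half_def by (rule sums_eval_fps)
  then have "(\<lambda>n. hpl (replicate p 0 @ [1]) $ Suc n * (1/2) ^ Suc n) sums hpl_half
      (replicate p 0 @ [1])"
    by (subst sums_Suc_iff) (simp add: hpl_replicate_0)
  moreover have "(\<lambda>n. hpl (replicate p 0 @ [1]) $ Suc n * (1/2) ^ Suc n)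
      = (\<lambda>n. (1/2) ^ Suc n / real (Suc n) ^ Suc p)"
    by (simp add: hpl_replicate_0 del: power_Suc of_nat_Suc)
  ultimately show ?thesis unfolding polylog_def by (simp only: sums_iff)
qed

section \<open>Reflection\<close>

text \<open>The substitution \<open>x -> 1 - x\<close> exchanges \<open>dx / x\<close> and
  \<open>dx / (1 - x)\<close> and reverses the order of integration.\<close>

definition dual_word :: "int list \<Rightarrow> int list" where
  "dual_word w = rev (map (\<lambda>a. 1 - a) w)"

lemma eval_hpl_deriv:
  assumes "proper (a # w)" "binary (a # w)" "0 < x" "x < 1"
  shows "(eval_fps (hpl (a # w)) has_real_derivative (if a = 0 then 1 / x else 1 / (1 - x)) *
      eval_fps (hpl w) x) (at x)"
proof -
  have "fps_conv_radius (hpl (a # w)) \<ge> 1" using assms by (intro hpl_conv_radius) auto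
  from has_derivative_eval_fps_theta[OF this assms(3,4)]
  have "(eval_fps (hpl (a # w)) has_real_derivative (if a = 0 then 1 else x / (1 - x)) * eval_fps
      (hpl w) x / x) (at x)"
    unfolding eval_theta_hpl[OF assms] .
  moreover have "(if a = 0 then 1 else x / (1 - x)) * e / x = (if a = 0 then 1 / x else 1 / (1 - x))
      * e" for e
    using assms by simp
  ultimately show ?thesis by (simp only:)
qed

text \<open>The sum does not depend on \<open>x\<close>, since its derivative telescopes; as \<open>x\<close> tends to \<open>0\<close> only the last summand
  survives.\<close>

lemma hpl_dual_sum:
  assumes w: "binary w" "w \<noteq> []" "hd w = 0" "last w = 1" and x: "0 < x" "x < 1"
  shows "(\<Sum>i\<le>length w. eval_fps (hpl (drop i w)) x * eval_fps (hpl (dual_word (take i w)))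
      (1 - x)) = mzv (ix (dual_word w))"
proof -
  define n where "n = length w"
  define D where "D i = eval_fps (hpl (drop i w))" for i
  define E where "E i y = eval_fps (hpl (dual_word (take i w))) y" for i y
  define om where "om i y = (if w ! i = 0 then 1 / y else 1 / (1 - y))" for i and y :: real
  define Phi where "Phi y = (\<Sum>i\<le>n. D i y * E i (1 - y))" for y
  have pd: "proper (drop i w)" for i using w by (auto simp: last_drop)
  have bd: "binary (drop i w)" for i using w(1) set_drop_subset[of i w] by blast
  have bt: "binary (take i w)" for i using w(1) set_take_subset[of i w] by blast
  have be: "binary (dual_word (take i w))" for i using bt[of i] by (auto simp: dual_word_def)
  \<comment> \<open>\<open>hd w = 0\<close> becomes the last letter \<open>1\<close> of each
    nonempty dual prefix. Likewise \<open>last w = 1\<close> makes the suffixes proper, and it makes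
    the full dual word start with \<open>0\<close>, so that its value at \<open>1\<close>
    converges.\<close>
  have pe: "proper (dual_word (take i w))" for i
    using w by (cases w; cases i) (auto simp: dual_word_def)
  have ldrop: "letters (drop i w)" and ldual: "letters (dual_word (take i w))" for i
    using bd[of i] be[of i] by auto
  have D': "(D i has_real_derivative om i y * D (Suc i) y) (at y)" if "i < n" "0 < y" "y < 1" for i y
  proof -
    have c: "drop i w = w ! i # drop (Suc i) w" using that by (simp add: Cons_nth_drop_Suc n_def)
    show ?thesis
      using eval_hpl_deriv[of "w ! i" "drop (Suc i) w" y] pd[of i] bd[of i] that
      unfolding D_def om_def c by simp
  qed
  have E': "((\<lambda>y. E (Suc i) (1 - y)) has_real_derivative - (om i y * E i (1 - y))) (at y)"
    if "i < n" "0 < y" "y < 1" for i y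
  proof -
    have c: "dual_word (take (Suc i) w) = (1 - w ! i) # dual_word (take i w)"
      using that by (simp add: dual_word_def take_Suc_conv_app_nth n_def)
    have wi: "w ! i = 0 \<or> w ! i = 1" using w(1) that nth_mem[of i w] unfolding n_def by blast
    have "(eval_fps (hpl ((1 - w ! i) # dual_word (take i w))) has_real_derivative om i y * E i (1 -
        y)) (at (1 - y))"
      using eval_hpl_deriv[of "1 - w ! i" "dual_word (take i w)" "1 - y"] pe[of "Suc i"] be[of "Suc
          i"] that wi
      unfolding E_def om_def c by auto
    then have "((\<lambda>y. eval_fps (hpl ((1 - w ! i) # dual_word (take i w))) (1 - y))
        has_real_derivative
        om i y * E i (1 - y) * (-1)) (at y)"
      by (rule DERIV_chain2[where g = "\<lambda>y. 1 - y"]) (auto intro!: derivative_eq_intros)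
    then show ?thesis unfolding E_def c by simp
  qed
  have D_n: "D n y = 1" and E_0: "E 0 y = 1" for y
    by (simp_all add: D_def E_def n_def dual_word_def)
  have const: "(Phi has_real_derivative 0) (at y)" if y: "0 < y" "y < 1" for y
  proof -
    \<comment> \<open>\<open>A i\<close> comes from differentiating the first factor of the
      \<open>i\<close>-th summand. The second factor contributes \<open>- A (i - 1)\<close>, because
      removing the first letter of its dual word shortens the prefix by one letter.\<close>
    define A where "A i = (if i < n then om i y * D (Suc i) y * E i (1 - y) else 0)" for i
    define B where "B i = (case i of 0 \<Rightarrow> 0 | Suc j \<Rightarrow> A j)" for i
    have "((\<lambda>y. D i y * E i (1 - y)) has_real_derivative A i - B i) (at y)" if i: "i \<le>
        n" for i
    proof -
      have d: "(D i has_real_derivative (if i < n then om i y * D (Suc i) y else 0)) (at y)"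
        using D'[OF _ y, of i] i D_n by (cases "i < n") (auto simp: fun_eq_iff[of "D n"] intro:
            DERIV_cong_ev[THEN iffD2, OF refl _ refl DERIV_const])
      have e: "((\<lambda>y. E i (1 - y)) has_real_derivative (case i of 0 \<Rightarrow> 0 | Suc j
          \<Rightarrow> - (om j y * E j (1 - y)))) (at y)"
        using E'[OF _ y] i by (cases i) (auto simp: E_0)
      show ?thesis
        using DERIV_mult[OF d e] i by (cases i) (auto simp: A_def B_def algebra_simps)
    qed
    then have "(Phi has_real_derivative (\<Sum>i\<le>n. A i - B i)) (at y)"
      unfolding Phi_def by (intro DERIV_sum) auto
    moreover have "(\<Sum>i\<le>m. A i - B i) = A m" for m
      by (induction m) (auto simp: B_def)
    ultimately show ?thesis by (simp add: A_def)
  qed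
  have "(Phi \<longlongrightarrow> mzv (ix (dual_word w))) (at_right 0)"
  proof -
    have refl: "filterlim (\<lambda>y::real. 1 - y) (at_left 1) (at_right 0)"
      by (auto simp: filterlim_at eventually_at_filter intro!: tendsto_eq_intros)
    have t: "((\<lambda>y. D i y * E i (1 - y)) \<longlongrightarrow> (if i = n then mzv (ix
        (dual_word w)) else 0)) (at_right 0)"
      if i: "i \<le> n" for i
    proof (cases "i = n")
      case True
      have "hd (dual_word w) \<noteq> 1" using w by (simp add: dual_word_def hd_rev last_map)
      moreover have "proper (dual_word w)" "letters (dual_word w)"
        using pe[of n] ldual[of n] by (simp_all add: n_def)
      ultimately have "(eval_fps (hpl (dual_word w)) \<longlongrightarrow> mzv (ix (dual_word w)))
          (at_left 1)"
        by (intro eval_hpl_tendsto) auto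
      from filterlim_compose[OF this refl] show ?thesis
        using True D_n by (simp add: E_def n_def)
    next
      case False
      \<comment> \<open>\<open>E i (1 - y)\<close> may be singular at \<open>y = 0\<close>. A
        nonempty suffix supplies a factor \<open>y\<close>, and \<open>y * E i (1 - y)\<close> tends
        to 0.\<close>
      define f where "f = fps_shift 1 (hpl (drop i w))"
      have z: "hpl (drop i w) $ 0 = 0"
        using False i by (cases "drop i w") (auto simp: n_def)
      have f: "hpl (drop i w) = fps_X * f"
      proof (rule fps_ext)
        fix k show "hpl (drop i w) $ k = (fps_X * f) $ k" using z by (cases k) (auto simp: f_def)
      qed
      have rf: "fps_conv_radius f \<ge> 1"
        unfolding f_def using hpl_conv_radius[OF pd ldrop] by simp
      have "isCont (eval_fps f) 0"
        using continuous_on_eval_fps_unit[OF rf] by (auto simp: continuous_on_eq_continuous_at)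
      then have 1: "(eval_fps f \<longlongrightarrow> eval_fps f 0) (at_right 0)"
        by (simp add: isCont_def filterlim_at_split)
      have 2: "((\<lambda>y. (1 - (1 - y)) * E i (1 - y)) \<longlongrightarrow> 0) (at_right 0)"
        unfolding E_def
        by (rule filterlim_compose[OF hpl_times_one_minus_tendsto_0(1)[OF pe ldual] refl])
      have "eventually (\<lambda>y::real. y \<in> {0<..<1}) (at_right 0)"
        by (rule eventually_at_right_real) simp
      then have "eventually (\<lambda>y. eval_fps f y * ((1 - (1 - y)) * E i (1 - y)) = D i y * E i
          (1 - y)) (at_right 0)"
      proof eventually_elim
        case (elim y)
        then have "D i y = y * eval_fps f y"
          unfolding D_def f using less_fps_conv_radius[OF rf, of y] by (subst eval_fps_mult) auto
        then show ?case by simp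
      qed
      from Lim_transform_eventually[OF tendsto_mult[OF 1 2] this] show ?thesis using False by simp
    qed
    have "(Phi \<longlongrightarrow> (\<Sum>i\<le>n. if i = n then mzv (ix (dual_word w)) else 0))
        (at_right 0)"
      unfolding Phi_def by (intro tendsto_sum t) auto
    then show ?thesis by simp
  qed
  moreover have "eventually (\<lambda>y. Phi x = Phi y) (at_right 0)"
  proof -
    have "eventually (\<lambda>y. y \<in> {0<..<x}) (at_right 0)"
      using x by (intro eventually_at_right_real)
    then show ?thesis
    proof eventually_elim
      case (elim y)
      then show ?case
      proof (intro DERIV_isconst_end[of y x Phi])
        have "isCont Phi z" if "z \<in> {y..x}" for z
          using that elim x by (intro DERIV_isCont[OF const]) auto
        then show "continuous_on {y..x} Phi" by (auto intro: continuous_at_imp_continuous_on)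
      qed (use elim x const in auto)
    qed
  qed
  then have "(Phi \<longlongrightarrow> Phi x) (at_right 0)"
    by (rule Lim_transform_eventually[OF tendsto_const])
  ultimately have "Phi x = mzv (ix (dual_word w))"
    using tendsto_unique[of "at_right (0::real)"] by (simp add: trivial_limit_at_right_real)
  then show ?thesis by (simp add: Phi_def D_def E_def n_def)
qed

text \<open>\<open>1/2\<close> is the fixed point of the reflection, so both factors of each summand
  are evaluated there.\<close>

lemma hpl_half_dual:
  assumes "binary w" "w \<noteq> []" "hd w = 0" "last w = 1"
  shows "(\<Sum>i\<leftarrow>[0..<Suc (length w)]. hpl_half (drop i w) * hpl_half (dual_word (take i
      w))) = mzv (ix (dual_word w))"
  using hpl_dual_sum[OF assms, of "1/2"]
  by (simp add: hpl_half_def interv_sum_list_conv_sum_set_nat atLeast0LessThan lessThan_Suc_atMost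
      del: upt_Suc)

section \<open>Values of weight at most 5\<close>

lemma mhs_singleton: "mhs [s] = (\<lambda>N. \<Sum>n<N. signed_pow s (Suc n))"
  by (rule ext) simp

lemma zeta_eq_mzv:
  assumes "p \<ge> 2"
  shows "zeta p = mzv [int p]"
proof -
  have "mhs [int p] \<longlonglongrightarrow> mzv [int p]" using assms by (intro mhs_tendsto) auto
  then have "(\<lambda>n. 1 / real (Suc n) ^ p) sums mzv [int p]"
    unfolding mhs_singleton by (simp add: sums_def signed_pow_def)
  then show ?thesis by (simp add: zeta_def sums_iff)
qed

lemma ln2_eq_mzv: "ln 2 = - mzv [-1]"
proof -
  have "mhs [-1] \<longlonglongrightarrow> mzv [-1]" by (intro mhs_tendsto) auto
  then have "(\<lambda>n. - ((-1) ^ n / real (Suc n))) sums mzv [-1]"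
    unfolding mhs_singleton by (simp add: sums_def signed_pow_def)
  from sums_unique2[OF alternating_harmonic_series_sums, of "- mzv [-1]"] sums_minus[OF this]
  show ?thesis by simp
qed

text \<open>Adding the two sums cancels the odd terms and doubles the even ones, which leaves
  \<open>2 * 2^(-p)\<close> times the original sum.\<close>

lemma mzv_uminus:
  assumes "p \<ge> 2"
  shows "mzv [- int p] = (2 / 2 ^ p - 1) * mzv [int p]"
proof -
  have "mhs [int p] (2 * N) + mhs [- int p] (2 * N) = 2 / 2 ^ p * mhs [int p] N" for N
  proof (induction N)
    case (Suc N)
    have "signed_pow (int p) (Suc (2 * N)) + signed_pow (- int p) (Suc (2 * N)) = 0"
      using assms by (simp add: signed_pow_def)
    moreover have "signed_pow (int p) (2 * Suc N) + signed_pow (- int p) (2 * Suc N) = 2 / 2 ^ p *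
        signed_pow (int p) (Suc N)"
      using assms by (simp add: signed_pow_def flip: power_mult_distrib)
    ultimately show ?case using Suc by (simp add: mhs_singleton algebra_simps)
  qed simp
  moreover have "(\<lambda>N. mhs [int p] (2 * N) + mhs [- int p] (2 * N)) \<longlonglongrightarrow>
      mzv [int p] + mzv [- int p]"
    using assms by (intro tendsto_add filterlim_compose[OF mhs_tendsto mult_nat_left_at_top]) auto
  moreover have "(\<lambda>N. 2 / 2 ^ p * mhs [int p] N) \<longlonglongrightarrow> 2 / 2 ^ p * mzv
      [int p]"
    using assms by (intro tendsto_mult_left mhs_tendsto) auto
  ultimately have "mzv [int p] + mzv [- int p] = 2 / 2 ^ p * mzv [int p]"
    using LIMSEQ_unique by simp
  then show ?thesis by (simp add: algebra_simps)
qed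

text \<open>The relations give \<open>zeta(3,1) = zeta(4) / 4\<close> and
  \<open>zeta(2,2) = 3/4 * zeta(4)\<close>, without the evaluations in terms of pi. The lemma brings
  products with two factors \<open>zeta 2\<close> to the normal form \<open>zeta 4\<close>.\<close>

lemma zeta_2_squared: "zeta 2 ^ 2 = 5/2 * zeta 4"
proof -
  have "mzv [2] * mzv [2] = 2 * mzv [2, 2] + mzv [4]"
    using mzv_stuffle[of "[2]" "[2]"] by (simp add: merge_ix_def; linarith)
  moreover have "mzv [2] * mzv [2] = 2 * mzv [2, 2] + 4 * mzv [3, 1]"
    using mzv_shuffle[of "[0, 1]" "[0, 1]"] by (simp; linarith)
  moreover have "mzv [3, 1] + mzv [2, 2] = mzv [4]"
    using mzv_regularized[of "[0, 0, 1]"] by (simp add: merge_ix_def; linarith)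
  ultimately have "mzv [2] * mzv [2] = 5/2 * mzv [4]"
    by linarith
  then show ?thesis
    using zeta_eq_mzv[of 2] zeta_eq_mzv[of 4] by (simp add: power2_eq_square)
qed

lemma mzv_weight_1: "mzv [-1] = - ln 2"
  using ln2_eq_mzv by simp

lemma mzv_weight_2:
  shows "mzv [-2] = - 1/2 * zeta 2"
    and "mzv [2] = zeta 2"
    and "mzv [-1, -1] = 1/2 * ln 2 ^ 2 - 1/2 * zeta 2"
    and "mzv [-1, 1] = 1/2 * ln 2 ^ 2"
proof -
  have z: "mzv [2] = zeta 2"
    using zeta_eq_mzv[of 2] by simp
  have nz: "mzv [-2] = - 1/2 * zeta 2"
    using mzv_uminus[of 2] z by simp
  have "mzv [-1] * mzv [-1] = 2 * mzv [-1, -1] + mzv [2]"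
    using mzv_stuffle[of "[-1]" "[-1]"] by (simp add: merge_ix_def; linarith)
  then have r1: "2 * mzv [-1, -1] + mzv [2] = ln 2 ^ 2"
    unfolding mzv_weight_1 by algebra
  have "mzv [-1] * mzv [-1] = 2 * mzv [-1, 1]"
    using mzv_shuffle[of "[-1]" "[-1]"] by (simp add: merge_ix_def; linarith)
  then have r2: "2 * mzv [-1, 1] = ln 2 ^ 2"
    unfolding mzv_weight_1 by algebra
  show "mzv [-2] = - 1/2 * zeta 2"
    using nz by linarith
  show "mzv [2] = zeta 2"
    using z by linarith
  show "mzv [-1, -1] = 1/2 * ln 2 ^ 2 - 1/2 * zeta 2"
    using z r1 by linarith
  show "mzv [-1, 1] = 1/2 * ln 2 ^ 2"
    using r2 by linarith
qed

text \<open>The word \<open>0 1\<close> is its own dual, so reflection alone determines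
  \<open>Li_2(1/2)\<close>.\<close>

lemma hpl_half_weight_2:
  shows "hpl_half [1] = ln 2" and "hpl_half [1, 1] = 1/2 * ln 2 ^ 2" and "hpl_half [0, 1] = 1/2 *
      zeta 2 - 1/2 * ln 2 ^ 2"
proof -
  show 1: "hpl_half [1] = ln 2" and "hpl_half [1, 1] = 1/2 * ln 2 ^ 2"
    using hpl_half_landen[of "[1]"] hpl_half_landen[of "[1, 1]"] by (simp_all add: mzv_weight_1
        mzv_weight_2)
  show "hpl_half [0, 1] = 1/2 * zeta 2 - 1/2 * ln 2 ^ 2"
    using hpl_half_dual[of "[0, 1]"] by (simp add: dual_word_def 1 mzv_weight_2 power2_eq_square)
qed

text \<open>The product relations \<open>r2\<close> to \<open>r4\<close> leave one degree of freedom
  among the four double sums. The missing relation \<open>r5\<close> comes from \<open>1/2\<close>: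
  reflection of the word \<open>0 1 1\<close>, with the weight 3 values rewritten by Landen's
  substitution.\<close>

lemma mzv_weight_3:
  shows "mzv [-3] = - 3/4 * zeta 3"
    and "mzv [3] = zeta 3"
    and "mzv [-2, -1] = 3/2 * zeta 2 * ln 2 - 13/8 * zeta 3"
    and "mzv [-2, 1] = 1/8 * zeta 3"
    and "mzv [-1, 2] = 1/2 * zeta 2 * ln 2 - 1/4 * zeta 3"
    and "mzv [2, -1] = - 3/2 * zeta 2 * ln 2 + zeta 3"
    and "mzv [-1, 1, 1] = - 1/6 * ln 2 ^ 3"
proof -
  have z: "mzv [3] = zeta 3"
    using zeta_eq_mzv[of 3] by simp
  have nz: "mzv [-3] = - 3/4 * zeta 3"
    using mzv_uminus[of 3] z by simp
  have "mzv [-1] * mzv [-1, 1] = 3 * mzv [-1, 1, 1]"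
    using mzv_shuffle[of "[-1]" "[-1, -1]"] by (simp add: merge_ix_def; linarith)
  then have r1: "3 * mzv [-1, 1, 1] = - 1/2 * ln 2 ^ 3"
    unfolding mzv_weight_1 mzv_weight_2 by algebra
  have "mzv [-1] * mzv [2] = mzv [2, -1] + mzv [-1, 2] + mzv [-3]"
    using mzv_stuffle[of "[-1]" "[2]"] by (simp add: merge_ix_def; linarith)
  then have r2: "mzv [2, -1] + mzv [-1, 2] + mzv [-3] = - zeta 2 * ln 2"
    unfolding mzv_weight_1 mzv_weight_2 by algebra
  have "mzv [-1] * mzv [-2] = 2 * mzv [-2, 1] + mzv [-1, 2]"
    using mzv_shuffle[of "[-1]" "[0, -1]"] by (simp add: merge_ix_def; linarith)
  then have r3: "2 * mzv [-2, 1] + mzv [-1, 2] = 1/2 * zeta 2 * ln 2"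
    unfolding mzv_weight_1 mzv_weight_2 by algebra
  have "mzv [-2, -1] + mzv [2, -1] = mzv [-2, 1] + mzv [-3]"
    using mzv_regularized[of "[0, -1]"] by (simp add: merge_ix_def; linarith)
  then have r4: "- mzv [-2, -1] + mzv [-2, 1] - mzv [2, -1] + mzv [-3] = 0"
    unfolding mzv_weight_1 mzv_weight_2 by algebra
  have e0: "hpl_half [0, 1, 1] + hpl_half [1, 1] * hpl_half [1] + hpl_half [1] * hpl_half [0, 1] +
      hpl_half [0, 0, 1] = mzv [3]"
    using hpl_half_dual[of "[0, 1, 1]"] by (simp add: dual_word_def; linarith)
  have e1: "hpl_half [0, 1, 1] = mzv [-1, 1, 1] + mzv [-2, 1]"
    using hpl_half_landen[of "[0, 1, 1]"] by (simp; linarith)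
  have e2: "hpl_half [0, 0, 1] = - mzv [-1, 1, 1] - mzv [-2, 1] - mzv [-1, 2] - mzv [-3]"
    using hpl_half_landen[of "[0, 0, 1]"] by (simp; linarith)
  have e3: "hpl_half [1, 1] * hpl_half [1] + hpl_half [1] * hpl_half [0, 1] = 1/2 * zeta 2 * ln 2"
    unfolding hpl_half_weight_2 by algebra
  have r5: "- mzv [-1, 2] - mzv [-3] - mzv [3] = - 1/2 * zeta 2 * ln 2"
    using e0 e1 e2 e3 unfolding mzv_weight_1 mzv_weight_2 by linarith
  show "mzv [-3] = - 3/4 * zeta 3"
    using nz by linarith
  show "mzv [3] = zeta 3"
    using z by linarith
  show "mzv [-2, -1] = 3/2 * zeta 2 * ln 2 - 13/8 * zeta 3"
    using z nz r2 r3 r4 r5 by linarith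
  show "mzv [-2, 1] = 1/8 * zeta 3"
    using z nz r3 r5 by linarith
  show "mzv [-1, 2] = 1/2 * zeta 2 * ln 2 - 1/4 * zeta 3"
    using z nz r5 by linarith
  show "mzv [2, -1] = - 3/2 * zeta 2 * ln 2 + zeta 3"
    using z r2 r5 by linarith
  show "mzv [-1, 1, 1] = - 1/6 * ln 2 ^ 3"
    using r1 by linarith
qed

lemma hpl_half_weight_3:
  shows "hpl_half [1, 1, 1] = 1/6 * ln 2 ^ 3"
    and "hpl_half [0, 0, 1] = 1/6 * ln 2 ^ 3 - 1/2 * zeta 2 * ln 2 + 7/8 * zeta 3"
  using hpl_half_landen[of "[1, 1, 1]"] hpl_half_landen[of "[0, 0, 1]"] by (simp_all add: mzv_weight_3)

text \<open>Only words in \<open>0\<close> and \<open>-1\<close> occur beyond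
  \<open>mzv [4]\<close>, so just the first entry of an index is negative. Landen's expansion
  \<open>r5\<close> introduces \<open>Li_4(1/2)\<close>, and reflection of \<open>0 1 1 1\<close>
  gives \<open>r6\<close>; with five shuffle relations this matches the seven unknowns of depth at
  least 2.\<close>

lemma mzv_weight_4:
  shows "mzv [-4] = - 7/8 * zeta 4"
    and "mzv [4] = zeta 4"
    and "mzv [-3, 1] = 2 * polylog 4 (1/2) + 1/12 * ln 2 ^ 4 - 15/8 * zeta 4 - 1/2 * zeta 2 * ln 2 ^
        2 + 7/4 * zeta 3 * ln 2"
    and "mzv [-2, 2] = - 4 * polylog 4 (1/2) - 1/6 * ln 2 ^ 4 + 65/16 * zeta 4 + zeta 2 * ln 2 ^ 2 -
        7/2 * zeta 3 * ln 2"
    and "mzv [-1, 3] = - 5/16 * zeta 4 + 3/4 * zeta 3 * ln 2"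
    and "mzv [-2, 1, 1] = polylog 4 (1/2) + 1/24 * ln 2 ^ 4 - zeta 4 - 1/4 * zeta 2 * ln 2 ^ 2 + 7/8
        * zeta 3 * ln 2"
    and "mzv [-1, 1, 2] = 3 * polylog 4 (1/2) + 1/8 * ln 2 ^ 4 - 3 * zeta 4 - zeta 2 * ln 2 ^ 2 +
        23/8 * zeta 3 * ln 2"
    and "mzv [-1, 2, 1] = - 3 * polylog 4 (1/2) - 1/8 * ln 2 ^ 4 + 3 * zeta 4 + 3/4 * zeta 2 * ln 2
        ^ 2 - 11/4 * zeta 3 * ln 2"
    and "mzv [-1, 1, 1, 1] = 1/24 * ln 2 ^ 4"
proof -
  have z: "mzv [4] = zeta 4"
    using zeta_eq_mzv[of 4] by simp
  have nz: "mzv [-4] = - 7/8 * zeta 4"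
    using mzv_uminus[of 4] z by simp
  have "mzv [-2] * mzv [-1, 1] = 3 * mzv [-2, 1, 1] + 2 * mzv [-1, 2, 1] + mzv [-1, 1, 2]"
    using mzv_shuffle[of "[0, -1]" "[-1, -1]"] by (simp add: merge_ix_def; linarith)
  then have r1: "3 * mzv [-2, 1, 1] + 2 * mzv [-1, 2, 1] + mzv [-1, 1, 2] = - 1/4 * zeta 2 * ln 2 ^ 2"
    unfolding mzv_weight_1 mzv_weight_2 mzv_weight_3 by algebra
  have "mzv [-1] * mzv [-1, 2] = 2 * mzv [-1, 2, 1] + 2 * mzv [-1, 1, 2]"
    using mzv_shuffle[of "[-1]" "[-1, 0, -1]"] by (simp add: merge_ix_def; linarith)
  then have r2: "2 * mzv [-1, 2, 1] + 2 * mzv [-1, 1, 2] = - 1/2 * zeta 2 * ln 2 ^ 2 + 1/4 * zeta 3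
      * ln 2"
    unfolding mzv_weight_1 mzv_weight_2 mzv_weight_3 by algebra
  have "mzv [-2] * mzv [-2] = 4 * mzv [-3, 1] + 2 * mzv [-2, 2]"
    using mzv_shuffle[of "[0, -1]" "[0, -1]"] by (simp add: merge_ix_def; linarith)
  then have r3: "4 * mzv [-3, 1] + 2 * mzv [-2, 2] = 5/8 * zeta 4"
    using zeta_2_squared unfolding mzv_weight_1 mzv_weight_2 mzv_weight_3 by algebra
  have "mzv [-1] * mzv [-3] = 2 * mzv [-3, 1] + mzv [-2, 2] + mzv [-1, 3]"
    using mzv_shuffle[of "[-1]" "[0, 0, -1]"] by (simp add: merge_ix_def; linarith)
  then have r4: "2 * mzv [-3, 1] + mzv [-2, 2] + mzv [-1, 3] = 3/4 * zeta 3 * ln 2"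
    unfolding mzv_weight_1 mzv_weight_2 mzv_weight_3 by algebra
  have "polylog 4 (1/2) = - mzv [-1, 1, 1, 1] - mzv [-2, 1, 1] - mzv [-1, 2, 1] - mzv [-1, 1, 2] -
      mzv [-3, 1] - mzv [-2, 2] - mzv [-1, 3] - mzv [-4]"
    using polylog_eq_hpl_half[of 3] hpl_half_landen[of "[0, 0, 0, 1]"]
    by (simp add: numeral_eq_Suc; linarith)
  then have r5: "- mzv [-1, 1, 1, 1] - mzv [-2, 1, 1] - mzv [-1, 2, 1] - mzv [-1, 1, 2] - mzv [-3,
      1] - mzv [-2, 2] - mzv [-1, 3] - mzv [-4] = polylog 4 (1/2)"
    unfolding mzv_weight_1 mzv_weight_2 mzv_weight_3 by algebra
  have e0: "hpl_half [0, 1, 1, 1] + hpl_half [1, 1, 1] * hpl_half [1] + hpl_half [1, 1] * hpl_half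
      [0, 1] + hpl_half [1] * hpl_half [0, 0, 1] + hpl_half [0, 0, 0, 1] = mzv [4]"
    using hpl_half_dual[of "[0, 1, 1, 1]"] by (simp add: dual_word_def; linarith)
  have e1: "hpl_half [0, 1, 1, 1] = - mzv [-1, 1, 1, 1] - mzv [-2, 1, 1]"
    using hpl_half_landen[of "[0, 1, 1, 1]"] by (simp; linarith)
  have e2: "hpl_half [0, 0, 0, 1] = - mzv [-1, 1, 1, 1] - mzv [-2, 1, 1] - mzv [-1, 2, 1] - mzv [-1,
      1, 2] - mzv [-3, 1] - mzv [-2, 2] - mzv [-1, 3] - mzv [-4]"
    using hpl_half_landen[of "[0, 0, 0, 1]"] by (simp; linarith)
  have e3: "hpl_half [1, 1, 1] * hpl_half [1] + hpl_half [1, 1] * hpl_half [0, 1] + hpl_half [1] *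
      hpl_half [0, 0, 1] = 1/12 * ln 2 ^ 4 - 1/4 * zeta 2 * ln 2 ^ 2 + 7/8 * zeta 3 * ln 2"
    unfolding hpl_half_weight_2 hpl_half_weight_3 by algebra
  have r6: "- 2 * mzv [-1, 1, 1, 1] - 2 * mzv [-2, 1, 1] - mzv [-1, 2, 1] - mzv [-1, 1, 2] - mzv
      [-3, 1] - mzv [-2, 2] - mzv [-1, 3] - mzv [-4] - mzv [4] = - 1/12 * ln 2 ^ 4 + 1/4 * zeta 2 * ln 2
      ^ 2 - 7/8 * zeta 3 * ln 2"
    using e0 e1 e2 e3 unfolding mzv_weight_1 mzv_weight_2 mzv_weight_3 by linarith
  have "mzv [-1, 1] * mzv [-1, 1] = 6 * mzv [-1, 1, 1, 1]"
    using mzv_shuffle[of "[-1, -1]" "[-1, -1]"] by (simp add: merge_ix_def; linarith)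
  then have r7: "6 * mzv [-1, 1, 1, 1] = 1/4 * ln 2 ^ 4"
    unfolding mzv_weight_1 mzv_weight_2 mzv_weight_3 by algebra
  show "mzv [-4] = - 7/8 * zeta 4"
    using nz by linarith
  show "mzv [4] = zeta 4"
    using z by linarith
  show "mzv [-3, 1] = 2 * polylog 4 (1/2) + 1/12 * ln 2 ^ 4 - 15/8 * zeta 4 - 1/2 * zeta 2 * ln 2 ^
      2 + 7/4 * zeta 3 * ln 2"
    using z nz r2 r4 r5 r6 by linarith
  show "mzv [-2, 2] = - 4 * polylog 4 (1/2) - 1/6 * ln 2 ^ 4 + 65/16 * zeta 4 + zeta 2 * ln 2 ^ 2 -
      7/2 * zeta 3 * ln 2"
    using z nz r2 r3 r4 r5 r6 by linarith
  show "mzv [-1, 3] = - 5/16 * zeta 4 + 3/4 * zeta 3 * ln 2"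
    using r3 r4 by linarith
  show "mzv [-2, 1, 1] = polylog 4 (1/2) + 1/24 * ln 2 ^ 4 - zeta 4 - 1/4 * zeta 2 * ln 2 ^ 2 + 7/8
      * zeta 3 * ln 2"
    using z r5 r6 r7 by linarith
  show "mzv [-1, 1, 2] = 3 * polylog 4 (1/2) + 1/8 * ln 2 ^ 4 - 3 * zeta 4 - zeta 2 * ln 2 ^ 2 +
      23/8 * zeta 3 * ln 2"
    using z r1 r2 r5 r6 r7 by linarith
  show "mzv [-1, 2, 1] = - 3 * polylog 4 (1/2) - 1/8 * ln 2 ^ 4 + 3 * zeta 4 + 3/4 * zeta 2 * ln 2 ^
      2 - 11/4 * zeta 3 * ln 2"
    using z r1 r2 r5 r6 r7 by linarith
  show "mzv [-1, 1, 1, 1] = 1/24 * ln 2 ^ 4"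
    using r7 by linarith
qed

lemma hpl_half_weight_4:
  shows "hpl_half [1, 1, 1, 1] = 1/24 * ln 2 ^ 4" and "hpl_half [0, 0, 0, 1] = polylog 4 (1/2)"
  using hpl_half_landen[of "[1, 1, 1, 1]"] polylog_eq_hpl_half[of 3]
  by (simp_all add: mzv_weight_4 numeral_eq_Suc)

lemmas mzv_low_weights = mzv_weight_1 mzv_weight_2 mzv_weight_3 mzv_weight_4

text \<open>Weight and depth have opposite parity, so products and single zeta values suffice and no
  value at \<open>1/2\<close> is used. \<open>r1\<close> to \<open>r12\<close> expand six products
  in both ways; \<open>r13\<close> and \<open>r14\<close> are the regularized relations for
  \<open>zeta(4)\<close> and \<open>zeta(-4)\<close>.\<close>

lemma mzv_weight_5_depth_2:
  shows "mzv [-5] = - 15/16 * zeta 5"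
    and "mzv [5] = zeta 5"
    and "mzv [-4, -1] = - 91/32 * zeta 5 + 3/4 * zeta 2 * zeta 3 + 15/8 * zeta 4 * ln 2"
    and "mzv [-4, 1] = - 29/32 * zeta 5 + 1/2 * zeta 2 * zeta 3"
    and "mzv [-3, -2] = 67/16 * zeta 5 - 9/4 * zeta 2 * zeta 3"
    and "mzv [-3, 2] = 41/32 * zeta 5 - 5/8 * zeta 2 * zeta 3"
    and "mzv [-2, -3] = - 83/16 * zeta 5 + 21/8 * zeta 2 * zeta 3"
    and "mzv [-2, 3] = 51/32 * zeta 5 - 3/4 * zeta 2 * zeta 3"
    and "mzv [-1, -4] = 59/32 * zeta 5 - 3/4 * zeta 2 * zeta 3 - zeta 4 * ln 2"
    and "mzv [-1, 4] = - 17/16 * zeta 5 + 3/8 * zeta 2 * zeta 3 + 7/8 * zeta 4 * ln 2"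
    and "mzv [2, -3] = - 11/32 * zeta 5 - 1/8 * zeta 2 * zeta 3"
    and "mzv [2, 3] = 9/2 * zeta 5 - 2 * zeta 2 * zeta 3"
    and "mzv [3, -2] = - 21/32 * zeta 5 + 1/4 * zeta 2 * zeta 3"
    and "mzv [3, 2] = - 11/2 * zeta 5 + 3 * zeta 2 * zeta 3"
    and "mzv [4, -1] = 2 * zeta 5 - 3/8 * zeta 2 * zeta 3 - 15/8 * zeta 4 * ln 2"
    and "mzv [4, 1] = 2 * zeta 5 - zeta 2 * zeta 3"
proof -
  have z: "mzv [5] = zeta 5"
    using zeta_eq_mzv[of 5] by simp
  have nz: "mzv [-5] = - 15/16 * zeta 5"
    using mzv_uminus[of 5] z by simp
  have "mzv [-1] * mzv [4] = mzv [4, -1] + mzv [-1, 4] + mzv [-5]"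
    using mzv_stuffle[of "[-1]" "[4]"] by (simp add: merge_ix_def; linarith)
  then have r1: "mzv [4, -1] + mzv [-1, 4] + mzv [-5] = - zeta 4 * ln 2"
    unfolding mzv_low_weights by algebra
  have "mzv [-1] * mzv [4] = mzv [-4, -1] + mzv [4, -1] + mzv [-3, -2] + mzv [-2, -3] + mzv [-1, -4]"
    using mzv_shuffle[of "[-1]" "[0, 0, 0, 1]"] by (simp add: merge_ix_def; linarith)
  then have r2: "mzv [-4, -1] + mzv [4, -1] + mzv [-3, -2] + mzv [-2, -3] + mzv [-1, -4] = - zeta 4
      * ln 2"
    unfolding mzv_low_weights by algebra
  have "mzv [-1] * mzv [-4] = mzv [-4, -1] + mzv [-1, -4] + mzv [5]"
    using mzv_stuffle[of "[-1]" "[-4]"] by (simp add: merge_ix_def; linarith)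
  then have r3: "mzv [-4, -1] + mzv [-1, -4] + mzv [5] = 7/8 * zeta 4 * ln 2"
    unfolding mzv_low_weights by algebra
  have "mzv [-1] * mzv [-4] = 2 * mzv [-4, 1] + mzv [-3, 2] + mzv [-2, 3] + mzv [-1, 4]"
    using mzv_shuffle[of "[-1]" "[0, 0, 0, -1]"] by (simp add: merge_ix_def; linarith)
  then have r4: "2 * mzv [-4, 1] + mzv [-3, 2] + mzv [-2, 3] + mzv [-1, 4] = 7/8 * zeta 4 * ln 2"
    unfolding mzv_low_weights by algebra
  have "mzv [2] * mzv [3] = mzv [3, 2] + mzv [2, 3] + mzv [5]"
    using mzv_stuffle[of "[2]" "[3]"] by (simp add: merge_ix_def; linarith)
  then have r5: "mzv [3, 2] + mzv [2, 3] + mzv [5] = zeta 2 * zeta 3"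
    unfolding mzv_low_weights by algebra
  have "mzv [2] * mzv [3] = 6 * mzv [4, 1] + 3 * mzv [3, 2] + mzv [2, 3]"
    using mzv_shuffle[of "[0, 1]" "[0, 0, 1]"] by (simp add: merge_ix_def; linarith)
  then have r6: "6 * mzv [4, 1] + 3 * mzv [3, 2] + mzv [2, 3] = zeta 2 * zeta 3"
    unfolding mzv_low_weights by algebra
  have "mzv [2] * mzv [-3] = mzv [-3, 2] + mzv [2, -3] + mzv [-5]"
    using mzv_stuffle[of "[2]" "[-3]"] by (simp add: merge_ix_def; linarith)
  then have r7: "mzv [-3, 2] + mzv [2, -3] + mzv [-5] = - 3/4 * zeta 2 * zeta 3"
    unfolding mzv_low_weights by algebra
  have "mzv [2] * mzv [-3] = 3 * mzv [-4, -1] + 3 * mzv [4, -1] + mzv [-3, -2] + 2 * mzv [3, -2] +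
      mzv [2, -3]"
    using mzv_shuffle[of "[0, 1]" "[0, 0, -1]"] by (simp add: merge_ix_def; linarith)
  then have r8: "3 * mzv [-4, -1] + 3 * mzv [4, -1] + mzv [-3, -2] + 2 * mzv [3, -2] + mzv [2, -3] =
      - 3/4 * zeta 2 * zeta 3"
    unfolding mzv_low_weights by algebra
  have "mzv [-2] * mzv [3] = mzv [3, -2] + mzv [-2, 3] + mzv [-5]"
    using mzv_stuffle[of "[-2]" "[3]"] by (simp add: merge_ix_def; linarith)
  then have r9: "mzv [3, -2] + mzv [-2, 3] + mzv [-5] = - 1/2 * zeta 2 * zeta 3"
    unfolding mzv_low_weights by algebra
  have "mzv [-2] * mzv [3] = 3 * mzv [-4, -1] + 3 * mzv [4, -1] + 2 * mzv [-3, -2] + mzv [3, -2] +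
      mzv [-2, -3]"
    using mzv_shuffle[of "[0, -1]" "[0, 0, 1]"] by (simp add: merge_ix_def; linarith)
  then have r10: "3 * mzv [-4, -1] + 3 * mzv [4, -1] + 2 * mzv [-3, -2] + mzv [3, -2] + mzv [-2, -3]
      = - 1/2 * zeta 2 * zeta 3"
    unfolding mzv_low_weights by algebra
  have "mzv [-2] * mzv [-3] = mzv [-3, -2] + mzv [-2, -3] + mzv [5]"
    using mzv_stuffle[of "[-2]" "[-3]"] by (simp add: merge_ix_def; linarith)
  then have r11: "mzv [-3, -2] + mzv [-2, -3] + mzv [5] = 3/8 * zeta 2 * zeta 3"
    unfolding mzv_low_weights by algebra
  have "mzv [-2] * mzv [-3] = 6 * mzv [-4, 1] + 3 * mzv [-3, 2] + mzv [-2, 3]"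
    using mzv_shuffle[of "[0, -1]" "[0, 0, -1]"] by (simp add: merge_ix_def; linarith)
  then have r12: "6 * mzv [-4, 1] + 3 * mzv [-3, 2] + mzv [-2, 3] = 3/8 * zeta 2 * zeta 3"
    unfolding mzv_low_weights by algebra
  have "2 * mzv [4, 1] + mzv [3, 2] + mzv [2, 3] = mzv [4, 1] + mzv [5]"
    using mzv_regularized[of "[0, 0, 0, 1]"] by (simp add: merge_ix_def; linarith)
  then have r13: "- mzv [4, 1] - mzv [3, 2] - mzv [2, 3] + mzv [5] = 0"
    unfolding mzv_low_weights by algebra
  have "mzv [-4, -1] + mzv [4, -1] + mzv [3, -2] + mzv [2, -3] = mzv [-4, 1] + mzv [-5]"
    using mzv_regularized[of "[0, 0, 0, -1]"] by (simp add: merge_ix_def; linarith)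
  then have r14: "- mzv [-4, -1] + mzv [-4, 1] - mzv [4, -1] - mzv [3, -2] - mzv [2, -3] + mzv [-5] = 0"
    unfolding mzv_low_weights by algebra
  show "mzv [-5] = - 15/16 * zeta 5"
    using nz by linarith
  show "mzv [5] = zeta 5"
    using z by linarith
  show "mzv [-4, -1] = - 91/32 * zeta 5 + 3/4 * zeta 2 * zeta 3 + 15/8 * zeta 4 * ln 2"
    using z nz r1 r2 r3 r4 r7 r8 r9 r10 r14 by linarith
  show "mzv [-4, 1] = - 29/32 * zeta 5 + 1/2 * zeta 2 * zeta 3"
    using z nz r1 r2 r3 r4 r7 r8 r9 r10 by linarith
  show "mzv [-3, -2] = 67/16 * zeta 5 - 9/4 * zeta 2 * zeta 3"
    using z nz r7 r8 r9 r10 r11 r12 r14 by linarith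
  show "mzv [-3, 2] = 41/32 * zeta 5 - 5/8 * zeta 2 * zeta 3"
    using z nz r1 r2 r3 r4 r7 r8 r9 r10 r11 r12 by linarith
  show "mzv [-2, -3] = - 83/16 * zeta 5 + 21/8 * zeta 2 * zeta 3"
    using z nz r7 r8 r9 r10 r11 r12 r14 by linarith
  show "mzv [-2, 3] = 51/32 * zeta 5 - 3/4 * zeta 2 * zeta 3"
    using z nz r1 r2 r3 r4 r11 r12 by linarith
  show "mzv [-1, -4] = 59/32 * zeta 5 - 3/4 * zeta 2 * zeta 3 - zeta 4 * ln 2"
    using z nz r1 r2 r3 r4 r7 r8 r9 r10 r14 by linarith
  show "mzv [-1, 4] = - 17/16 * zeta 5 + 3/8 * zeta 2 * zeta 3 + 7/8 * zeta 4 * ln 2"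
    using z nz r1 r2 r3 r11 by linarith
  show "mzv [2, -3] = - 11/32 * zeta 5 - 1/8 * zeta 2 * zeta 3"
    using z nz r1 r2 r3 r4 r8 r9 r10 r11 r12 by linarith
  show "mzv [2, 3] = 9/2 * zeta 5 - 2 * zeta 2 * zeta 3"
    using z r5 r6 r13 by linarith
  show "mzv [3, -2] = - 21/32 * zeta 5 + 1/4 * zeta 2 * zeta 3"
    using z nz r1 r2 r3 r4 r9 r11 r12 by linarith
  show "mzv [3, 2] = - 11/2 * zeta 5 + 3 * zeta 2 * zeta 3"
    using z r5 r6 r13 by linarith
  show "mzv [4, -1] = 2 * zeta 5 - 3/8 * zeta 2 * zeta 3 - 15/8 * zeta 4 * ln 2"
    using z r2 r3 r11 by linarith
  show "mzv [4, 1] = 2 * zeta 5 - zeta 2 * zeta 3"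
    using z r5 r13 by linarith
qed

lemma mzv_uminus_1_1_1_1_1:
  shows "mzv [-1, 1, 1, 1, 1] = - 1/120 * ln 2 ^ 5"
proof -
  have "mzv [-1] * mzv [-1, 1, 1, 1] = 5 * mzv [-1, 1, 1, 1, 1]"
    using mzv_shuffle[of "[-1]" "[-1, -1, -1, -1]"] by (simp add: merge_ix_def; linarith)
  then have r1: "5 * mzv [-1, 1, 1, 1, 1] = - 1/24 * ln 2 ^ 5"
    unfolding mzv_low_weights mzv_weight_5_depth_2 by algebra
  show "mzv [-1, 1, 1, 1, 1] = - 1/120 * ln 2 ^ 5"
    using r1 by linarith
qed

text \<open>The six relations do not fix all ten unknowns, but they fix this one.
  \<open>r5 - r6\<close> isolates \<open>zeta(-2,1,1,1)\<close>. Then \<open>r2 + r4\<close>,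
  divided by 3, gives the sum of the other three depth 4 values, and half of \<open>r1 + r3\<close>
  gives the sum of the remaining five depth 3 values. These are exactly the sums that occur in
  \<open>r6\<close>.\<close>

lemma mzv_uminus_3_1_1:
  shows "mzv [-3, 1, 1] = - 2 * polylog 5 (1/2) - 2 * polylog 4 (1/2) * ln 2 - 1/15 * ln 2 ^ 5 +
      33/32 * zeta 5 + 1/3 * zeta 2 * ln 2 ^ 3 + 1/2 * zeta 2 * zeta 3 - 7/8 * zeta 3 * ln 2 ^ 2"
proof -
  have "mzv [-1] * mzv [-1, 3] = 2 * mzv [-1, 3, 1] + mzv [-1, 2, 2] + 2 * mzv [-1, 1, 3]"
    using mzv_shuffle[of "[-1]" "[-1, 0, 0, -1]"] by (simp add: merge_ix_def; linarith)
  then have r1: "2 * mzv [-1, 3, 1] + mzv [-1, 2, 2] + 2 * mzv [-1, 1, 3] = - 3/4 * zeta 3 * ln 2 ^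
      2 + 5/16 * zeta 4 * ln 2"
    unfolding mzv_low_weights mzv_weight_5_depth_2 mzv_uminus_1_1_1_1_1 by algebra
  have "mzv [-1] * mzv [-1, 1, 2] = 2 * mzv [-1, 1, 2, 1] + 3 * mzv [-1, 1, 1, 2]"
    using mzv_shuffle[of "[-1]" "[-1, -1, 0, -1]"] by (simp add: merge_ix_def; linarith)
  then have r2: "2 * mzv [-1, 1, 2, 1] + 3 * mzv [-1, 1, 1, 2] = - 3 * polylog 4 (1/2) * ln 2 - 1/8
      * ln 2 ^ 5 + zeta 2 * ln 2 ^ 3 - 23/8 * zeta 3 * ln 2 ^ 2 + 3 * zeta 4 * ln 2"
    unfolding mzv_low_weights mzv_weight_5_depth_2 mzv_uminus_1_1_1_1_1 by algebra
  have "mzv [-1] * mzv [-2, 2] = 2 * mzv [-2, 2, 1] + 2 * mzv [-2, 1, 2] + mzv [-1, 2, 2]"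
    using mzv_shuffle[of "[-1]" "[0, -1, 0, -1]"] by (simp add: merge_ix_def; linarith)
  then have r3: "2 * mzv [-2, 2, 1] + 2 * mzv [-2, 1, 2] + mzv [-1, 2, 2] = 4 * polylog 4 (1/2) * ln
      2 + 1/6 * ln 2 ^ 5 - zeta 2 * ln 2 ^ 3 + 7/2 * zeta 3 * ln 2 ^ 2 - 65/16 * zeta 4 * ln 2"
    unfolding mzv_low_weights mzv_weight_5_depth_2 mzv_uminus_1_1_1_1_1 by algebra
  have "mzv [-1, 1] * mzv [-2, 1] = 6 * mzv [-2, 1, 1, 1] + 3 * mzv [-1, 2, 1, 1] + mzv [-1, 1, 2, 1]"
    using mzv_shuffle[of "[-1, -1]" "[0, -1, -1]"] by (simp add: merge_ix_def; linarith)
  then have r4: "6 * mzv [-2, 1, 1, 1] + 3 * mzv [-1, 2, 1, 1] + mzv [-1, 1, 2, 1] = 1/16 * zeta 3 *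
      ln 2 ^ 2"
    unfolding mzv_low_weights mzv_weight_5_depth_2 mzv_uminus_1_1_1_1_1 by algebra
  have "polylog 5 (1/2) = - mzv [-1, 1, 1, 1, 1] - mzv [-2, 1, 1, 1] - mzv [-1, 2, 1, 1] - mzv [-1,
      1, 2, 1] - mzv [-1, 1, 1, 2] - mzv [-3, 1, 1] - mzv [-2, 2, 1] - mzv [-2, 1, 2] - mzv [-1, 3, 1] -
      mzv [-1, 2, 2] - mzv [-1, 1, 3] - mzv [-4, 1] - mzv [-3, 2] - mzv [-2, 3] - mzv [-1, 4] - mzv
      [-5]"
    using polylog_eq_hpl_half[of 4] hpl_half_landen[of "[0, 0, 0, 0, 1]"]
    by (simp add: numeral_eq_Suc; linarith)
  then have r5: "- mzv [-2, 1, 1, 1] - mzv [-1, 2, 1, 1] - mzv [-1, 1, 2, 1] - mzv [-1, 1, 1, 2] -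
      mzv [-3, 1, 1] - mzv [-2, 2, 1] - mzv [-2, 1, 2] - mzv [-1, 3, 1] - mzv [-1, 2, 2] - mzv [-1, 1,
      3] = polylog 5 (1/2) - 1/120 * ln 2 ^ 5 - 1/32 * zeta 5 - 1/2 * zeta 2 * zeta 3 + 7/8 * zeta 4 *
      ln 2"
    unfolding mzv_low_weights mzv_weight_5_depth_2 mzv_uminus_1_1_1_1_1 by algebra
  have e0: "hpl_half [0, 1, 1, 1, 1] + hpl_half [1, 1, 1, 1] * hpl_half [1] + hpl_half [1, 1, 1] *
      hpl_half [0, 1] + hpl_half [1, 1] * hpl_half [0, 0, 1] + hpl_half [1] * hpl_half [0, 0, 0, 1] +
      hpl_half [0, 0, 0, 0, 1] = mzv [5]"
    using hpl_half_dual[of "[0, 1, 1, 1, 1]"] by (simp add: dual_word_def; linarith)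
  have e1: "hpl_half [0, 1, 1, 1, 1] = mzv [-1, 1, 1, 1, 1] + mzv [-2, 1, 1, 1]"
    using hpl_half_landen[of "[0, 1, 1, 1, 1]"] by (simp; linarith)
  have e2: "hpl_half [0, 0, 0, 0, 1] = - mzv [-1, 1, 1, 1, 1] - mzv [-2, 1, 1, 1] - mzv [-1, 2, 1,
      1] - mzv [-1, 1, 2, 1] - mzv [-1, 1, 1, 2] - mzv [-3, 1, 1] - mzv [-2, 2, 1] - mzv [-2, 1, 2] -
      mzv [-1, 3, 1] - mzv [-1, 2, 2] - mzv [-1, 1, 3] - mzv [-4, 1] - mzv [-3, 2] - mzv [-2, 3] - mzv
      [-1, 4] - mzv [-5]"
    using hpl_half_landen[of "[0, 0, 0, 0, 1]"] by (simp; linarith)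
  have e3: "hpl_half [1, 1, 1, 1] * hpl_half [1] + hpl_half [1, 1, 1] * hpl_half [0, 1] + hpl_half
      [1, 1] * hpl_half [0, 0, 1] + hpl_half [1] * hpl_half [0, 0, 0, 1] = polylog 4 (1/2) * ln 2 + 1/24
      * ln 2 ^ 5 - 1/6 * zeta 2 * ln 2 ^ 3 + 7/16 * zeta 3 * ln 2 ^ 2"
    unfolding hpl_half_weight_2 hpl_half_weight_3 hpl_half_weight_4 by algebra
  have r6: "- mzv [-1, 2, 1, 1] - mzv [-1, 1, 2, 1] - mzv [-1, 1, 1, 2] - mzv [-3, 1, 1] - mzv [-2,
      2, 1] - mzv [-2, 1, 2] - mzv [-1, 3, 1] - mzv [-1, 2, 2] - mzv [-1, 1, 3] = - polylog 4 (1/2) * ln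
      2 - 1/24 * ln 2 ^ 5 + 31/32 * zeta 5 + 1/6 * zeta 2 * ln 2 ^ 3 - 1/2 * zeta 2 * zeta 3 - 7/16 *
      zeta 3 * ln 2 ^ 2 + 7/8 * zeta 4 * ln 2"
    using e0 e1 e2 e3 unfolding mzv_low_weights mzv_weight_5_depth_2 mzv_uminus_1_1_1_1_1 by linarith
  show "mzv [-3, 1, 1] = - 2 * polylog 5 (1/2) - 2 * polylog 4 (1/2) * ln 2 - 1/15 * ln 2 ^ 5 +
      33/32 * zeta 5 + 1/3 * zeta 2 * ln 2 ^ 3 + 1/2 * zeta 2 * zeta 3 - 7/8 * zeta 3 * ln 2 ^ 2"
    using r1 r2 r3 r4 r5 r6 by linarith
qed

lemmas mzv_known = mzv_low_weights mzv_weight_5_depth_2 mzv_uminus_3_1_1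

text \<open>The relations \<open>r\<close> are solved by forward elimination (\<open>p\<close>) and back substitution (\<open>q\<close>). Five values
  remain free; they cancel in the eight sums.\<close>

lemma mzv_euler_sums:
  shows "mzv [-3, 1, -1] + mzv [-3, -1, 1] + mzv [-3, -2] + mzv [-4, -1] + mzv [4, 1] + mzv [5] = 2
      * polylog 5 (1/2) - 1/60 * ln 2 ^ 5 - 37/16 * zeta 5 + 1/6 * zeta 2 * ln 2 ^ 3 - 1/8 * zeta 2 *
      zeta 3 - 7/8 * zeta 3 * ln 2 ^ 2 + 4 * zeta 4 * ln 2"
    and "mzv [3, 1, -1] + mzv [3, -1, 1] + mzv [3, -2] + mzv [4, -1] + mzv [-4, 1] + mzv [-5] = - 2
        * polylog 5 (1/2) + 1/60 * ln 2 ^ 5 + 193/64 * zeta 5 - 1/6 * zeta 2 * ln 2 ^ 3 - 3/8 * zeta 2 *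
        zeta 3 + 7/8 * zeta 3 * ln 2 ^ 2 - 4 * zeta 4 * ln 2"
    and "mzv [-1, 1, -3] + mzv [-1, -3, 1] + mzv [-1, -4] + mzv [-2, -3] + mzv [4, 1] + mzv [5] = 2
        * polylog 5 (1/2) - 1/60 * ln 2 ^ 5 - 37/16 * zeta 5 + 1/6 * zeta 2 * ln 2 ^ 3 + zeta 2 * zeta 3
        - 3/8 * zeta 3 * ln 2 ^ 2 + 1/4 * zeta 4 * ln 2"
    and "mzv [-1, 1, 3] + mzv [-1, 3, 1] + mzv [-1, 4] + mzv [-2, 3] + mzv [-4, 1] + mzv [-5] = 4 *
        polylog 5 (1/2) + 2 * polylog 4 (1/2) * ln 2 + 1/20 * ln 2 ^ 5 - 167/32 * zeta 5 - 1/6 * zeta 2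
        * ln 2 ^ 3 + 1/16 * zeta 2 * zeta 3 - 3/8 * zeta 3 * ln 2 ^ 2 + 49/16 * zeta 4 * ln 2"
    and "mzv [-2, 1, 2] + mzv [-2, 2, 1] + mzv [-2, 3] + mzv [-3, 2] + mzv [-4, 1] + mzv [-5] = 4 *
        polylog 5 (1/2) + 4 * polylog 4 (1/2) * ln 2 + 2/15 * ln 2 ^ 5 - 23/8 * zeta 5 - 2/3 * zeta 2 *
        ln 2 ^ 3 - 15/16 * zeta 2 * zeta 3 + 7/4 * zeta 3 * ln 2 ^ 2"
    and "mzv [2, -1, -2] + mzv [2, -2, -1] + mzv [2, 3] + mzv [-3, -2] + mzv [-4, -1] + mzv [5] = 4
        * polylog 5 (1/2) - 1/30 * ln 2 ^ 5 - 23/8 * zeta 5 + 1/3 * zeta 2 * ln 2 ^ 3 - 3/4 * zeta 2 *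
        zeta 3 - 7/4 * zeta 3 * ln 2 ^ 2 + 49/8 * zeta 4 * ln 2"
    and "mzv [-2, 2, -1] + mzv [-2, -1, 2] + mzv [-2, -3] + mzv [-4, -1] + mzv [3, 2] + mzv [5] = -
        4 * polylog 5 (1/2) + 1/30 * ln 2 ^ 5 - 29/64 * zeta 5 - 1/3 * zeta 2 * ln 2 ^ 3 + 15/8 * zeta 2
        * zeta 3 + 7/4 * zeta 3 * ln 2 ^ 2 - 23/16 * zeta 4 * ln 2"
    and "mzv [-2, -1, -2] + mzv [-2, -2, -1] + mzv [-2, 3] + mzv [3, -2] + mzv [4, -1] + mzv [-5] =
        - 8 * polylog 5 (1/2) - 4 * polylog 4 (1/2) * ln 2 - 1/10 * ln 2 ^ 5 + 35/4 * zeta 5 + 1/3 *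
        zeta 2 * ln 2 ^ 3 - 1/16 * zeta 2 * zeta 3 - 49/8 * zeta 4 * ln 2"
proof -
  have "mzv [-1] * mzv [-1, 3] = 2 * mzv [-1, 3, 1] + mzv [-1, 2, 2] + 2 * mzv [-1, 1, 3]"
    using mzv_shuffle[of "[-1]" "[-1, 0, 0, -1]"] by (simp add: merge_ix_def; linarith)
  then have r1: "2 * mzv [-1, 3, 1] + mzv [-1, 2, 2] + 2 * mzv [-1, 1, 3] = - 3/4 * zeta 3 * ln 2 ^
      2 + 5/16 * zeta 4 * ln 2"
    unfolding mzv_known by algebra
  have "mzv [-1] * mzv [-2, 2] = 2 * mzv [-2, 2, 1] + 2 * mzv [-2, 1, 2] + mzv [-1, 2, 2]"
    using mzv_shuffle[of "[-1]" "[0, -1, 0, -1]"] by (simp add: merge_ix_def; linarith)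
  then have r2: "2 * mzv [-2, 2, 1] + 2 * mzv [-2, 1, 2] + mzv [-1, 2, 2] = 4 * polylog 4 (1/2) * ln
      2 + 1/6 * ln 2 ^ 5 - zeta 2 * ln 2 ^ 3 + 7/2 * zeta 3 * ln 2 ^ 2 - 65/16 * zeta 4 * ln 2"
    unfolding mzv_known by algebra
  have "mzv [-1, -1] * mzv [3] = 2 * mzv [-3, -1, 1] + mzv [3, -1, -1] + 2 * mzv [-2, -2, 1] + mzv
      [-2, -1, 2] + 2 * mzv [-1, -3, 1] + mzv [-1, -2, 2] + mzv [-1, -1, 3]"
    using mzv_shuffle[of "[-1, 1]" "[0, 0, 1]"] by (simp add: merge_ix_def; linarith)
  then have r3: "2 * mzv [-3, -1, 1] + mzv [3, -1, -1] + 2 * mzv [-2, -2, 1] + mzv [-2, -1, 2] + 2 *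
      mzv [-1, -3, 1] + mzv [-1, -2, 2] + mzv [-1, -1, 3] = - 1/2 * zeta 2 * zeta 3 + 1/2 * zeta 3 * ln
      2 ^ 2"
    unfolding mzv_known by algebra
  have "mzv [2] * mzv [-1, 2] = mzv [2, -1, 2] + 2 * mzv [-1, 2, 2] + mzv [-3, 2] + mzv [-1, 4]"
    using mzv_stuffle[of "[2]" "[-1, 2]"] by (simp add: merge_ix_def; linarith)
  then have r4: "mzv [2, -1, 2] + 2 * mzv [-1, 2, 2] = - 7/32 * zeta 5 + 3/8 * zeta 4 * ln 2"
    using zeta_2_squared unfolding mzv_known by algebra
  have "mzv [2] * mzv [-2, 1] = mzv [-2, 2, 1] + mzv [2, -2, 1] + mzv [-2, 1, 2] + mzv [-4, 1] + mzv
      [-2, 3]"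
    using mzv_stuffle[of "[2]" "[-2, 1]"] by (simp add: merge_ix_def; linarith)
  then have r5: "mzv [-2, 2, 1] + mzv [2, -2, 1] + mzv [-2, 1, 2] = - 11/16 * zeta 5 + 3/8 * zeta 2
      * zeta 3"
    unfolding mzv_known by algebra
  have "mzv [2] * mzv [-2, 1] = 2 * mzv [-3, -1, -1] + 2 * mzv [-3, 1, -1] + 2 * mzv [3, -1, 1] +
      mzv [-2, -2, -1] + mzv [-2, 2, -1] + mzv [2, -2, 1] + mzv [-2, 1, -2]"
    using mzv_shuffle[of "[0, 1]" "[0, -1, -1]"] by (simp add: merge_ix_def; linarith)
  then have r6: "2 * mzv [-3, -1, -1] + 2 * mzv [-3, 1, -1] + 2 * mzv [3, -1, 1] + mzv [-2, -2, -1]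
      + mzv [-2, 2, -1] + mzv [2, -2, 1] + mzv [-2, 1, -2] = 1/8 * zeta 2 * zeta 3"
    unfolding mzv_known by algebra
  have "mzv [2] * mzv [2, -1] = 2 * mzv [2, 2, -1] + mzv [2, -1, 2] + mzv [4, -1] + mzv [2, -3]"
    using mzv_stuffle[of "[2]" "[2, -1]"] by (simp add: merge_ix_def; linarith)
  then have r7: "2 * mzv [2, 2, -1] + mzv [2, -1, 2] = - 53/32 * zeta 5 + 3/2 * zeta 2 * zeta 3 -
      15/8 * zeta 4 * ln 2"
    using zeta_2_squared unfolding mzv_known by algebra
  have "mzv [2] * mzv [2, -1] = 2 * mzv [3, -1, -1] + 4 * mzv [3, 1, -1] + mzv [2, -2, -1] + 2 * mzv
      [2, 2, -1] + mzv [2, -1, -2]"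
    using mzv_shuffle[of "[0, 1]" "[0, 1, -1]"] by (simp add: merge_ix_def; linarith)
  then have r8: "2 * mzv [3, -1, -1] + 4 * mzv [3, 1, -1] + mzv [2, -2, -1] + 2 * mzv [2, 2, -1] +
      mzv [2, -1, -2] = zeta 2 * zeta 3 - 15/4 * zeta 4 * ln 2"
    using zeta_2_squared unfolding mzv_known by algebra
  have "mzv [2] * mzv [-2, -1] = mzv [-2, 2, -1] + mzv [2, -2, -1] + mzv [-2, -1, 2] + mzv [-4, -1]
      + mzv [-2, -3]"
    using mzv_stuffle[of "[2]" "[-2, -1]"] by (simp add: merge_ix_def; linarith)
  then have r9: "mzv [-2, 2, -1] + mzv [2, -2, -1] + mzv [-2, -1, 2] = 257/32 * zeta 5 - 5 * zeta 2
      * zeta 3 + 15/8 * zeta 4 * ln 2"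
    using zeta_2_squared unfolding mzv_known by algebra
  have "mzv [2] * mzv [-2, -1] = 4 * mzv [-3, -1, 1] + 2 * mzv [3, -1, -1] + 2 * mzv [-2, -2, 1] +
      mzv [2, -2, -1] + mzv [-2, -1, 2]"
    using mzv_shuffle[of "[0, 1]" "[0, -1, 1]"] by (simp add: merge_ix_def; linarith)
  then have r10: "4 * mzv [-3, -1, 1] + 2 * mzv [3, -1, -1] + 2 * mzv [-2, -2, 1] + mzv [2, -2, -1]
      + mzv [-2, -1, 2] = - 13/8 * zeta 2 * zeta 3 + 15/4 * zeta 4 * ln 2"
    using zeta_2_squared unfolding mzv_known by algebra
  have "mzv [-2] * mzv [-2, 1] = 2 * mzv [-2, -2, 1] + mzv [-2, 1, -2] + mzv [4, 1] + mzv [-2, -3]"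
    using mzv_stuffle[of "[-2]" "[-2, 1]"] by (simp add: merge_ix_def; linarith)
  then have r11: "2 * mzv [-2, -2, 1] + mzv [-2, 1, -2] = 51/16 * zeta 5 - 27/16 * zeta 2 * zeta 3"
    unfolding mzv_known by algebra
  have "mzv [-2] * mzv [2, -1] = mzv [-2, 2, -1] + mzv [2, -2, -1] + mzv [2, -1, -2] + mzv [-4, -1]
      + mzv [2, 3]"
    using mzv_stuffle[of "[-2]" "[2, -1]"] by (simp add: merge_ix_def; linarith)
  then have r12: "mzv [-2, 2, -1] + mzv [2, -2, -1] + mzv [2, -1, -2] = - 53/32 * zeta 5 + 3/4 *
      zeta 2 * zeta 3"
    using zeta_2_squared unfolding mzv_known by algebra
  have "mzv [-2] * mzv [2, -1] = 2 * mzv [-3, -1, -1] + 4 * mzv [3, -1, 1] + mzv [-2, -2, -1] + 2 *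
      mzv [2, -2, 1] + mzv [2, -1, 2]"
    using mzv_shuffle[of "[0, -1]" "[0, 1, -1]"] by (simp add: merge_ix_def; linarith)
  then have r13: "2 * mzv [-3, -1, -1] + 4 * mzv [3, -1, 1] + mzv [-2, -2, -1] + 2 * mzv [2, -2, 1]
      + mzv [2, -1, 2] = - 1/2 * zeta 2 * zeta 3 + 15/8 * zeta 4 * ln 2"
    using zeta_2_squared unfolding mzv_known by algebra
  have "mzv [-2] * mzv [-2, -1] = 2 * mzv [-2, -2, -1] + mzv [-2, -1, -2] + mzv [4, -1] + mzv [-2, 3]"
    using mzv_stuffle[of "[-2]" "[-2, -1]"] by (simp add: merge_ix_def; linarith)
  then have r14: "2 * mzv [-2, -2, -1] + mzv [-2, -1, -2] = - 115/32 * zeta 5 + 31/16 * zeta 2 * zeta 3"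
    using zeta_2_squared unfolding mzv_known by algebra
  have "mzv [-2] * mzv [-2, -1] = 2 * mzv [-3, -1, -1] + 4 * mzv [-3, 1, -1] + mzv [-2, -2, -1] + 2
      * mzv [-2, 2, -1] + mzv [-2, -1, -2]"
    using mzv_shuffle[of "[0, -1]" "[0, -1, 1]"] by (simp add: merge_ix_def; linarith)
  then have r15: "2 * mzv [-3, -1, -1] + 4 * mzv [-3, 1, -1] + mzv [-2, -2, -1] + 2 * mzv [-2, 2,
      -1] + mzv [-2, -1, -2] = 13/16 * zeta 2 * zeta 3 - 15/8 * zeta 4 * ln 2"
    using zeta_2_squared unfolding mzv_known by algebra
  have "2 * mzv [-1, -3, 1] + mzv [-1, -2, 2] + mzv [-1, -1, 3] = mzv [-1, -3, 1] + mzv [-1, 1, -3]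
      + mzv [-2, -3] + mzv [-1, -4]"
    using mzv_regularized[of "[-1, 0, 0, 1]"] by (simp add: merge_ix_def; linarith)
  then have r16: "- mzv [-1, -3, 1] - mzv [-1, -2, 2] - mzv [-1, -1, 3] + mzv [-1, 1, -3] = 107/32 *
      zeta 5 - 15/8 * zeta 2 * zeta 3 + zeta 4 * ln 2"
    unfolding mzv_known by algebra
  have "mzv [-2, -2, -1] + mzv [-2, 2, -1] + mzv [-2, -1, -2] + mzv [2, -1, 2] = mzv [-2, 2, 1] +
      mzv [-2, 1, 2] + mzv [-3, 2] + mzv [-2, 3]"
    using mzv_regularized[of "[0, -1, 0, -1]"] by (simp add: merge_ix_def; linarith)
  then have r17: "- mzv [-2, -2, -1] - mzv [-2, 2, -1] + mzv [-2, 2, 1] - mzv [-2, -1, -2] + mzv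
      [-2, 1, 2] - mzv [2, -1, 2] = - 23/8 * zeta 5 + 11/8 * zeta 2 * zeta 3"
    unfolding mzv_known by algebra
  have "2 * mzv [-2, -2, 1] + mzv [-2, -1, 2] + mzv [2, -1, -2] = mzv [-2, -2, 1] + mzv [-2, 1, -2]
      + mzv [-3, -2] + mzv [-2, -3]"
    using mzv_regularized[of "[0, -1, 0, 1]"] by (simp add: merge_ix_def; linarith)
  then have r18: "- mzv [-2, -2, 1] - mzv [-2, -1, 2] + mzv [-2, 1, -2] - mzv [2, -1, -2] = zeta 5 -
      3/8 * zeta 2 * zeta 3"
    unfolding mzv_known by algebra
  \<comment> \<open>The only relation that contains \<open>zeta(-3,1,1)\<close>, and hence the only
    place where \<open>Li_5(1/2)\<close> enters the system.\<close>
  have "mzv [-3, -1, -1] + mzv [-3, 1, -1] + mzv [3, -1, 1] + mzv [2, -2, 1] = 2 * mzv [-3, 1, 1] +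
      mzv [-4, 1] + mzv [-3, 2]"
    using mzv_regularized[of "[0, 0, -1, -1]"] by (simp add: merge_ix_def; linarith)
  then have r19: "- mzv [-3, -1, -1] - mzv [-3, 1, -1] - mzv [3, -1, 1] - mzv [2, -2, 1] = 4 *
      polylog 5 (1/2) + 4 * polylog 4 (1/2) * ln 2 + 2/15 * ln 2 ^ 5 - 39/16 * zeta 5 - 2/3 * zeta 2 *
      ln 2 ^ 3 - 7/8 * zeta 2 * zeta 3 + 7/4 * zeta 3 * ln 2 ^ 2"
    unfolding mzv_known by algebra
  have "mzv [3, -1, -1] + 2 * mzv [3, 1, -1] + mzv [2, 2, -1] = mzv [3, -1, 1] + mzv [3, 1, -1] +
      mzv [4, -1] + mzv [3, -2]"
    using mzv_regularized[of "[0, 0, 1, -1]"] by (simp add: merge_ix_def; linarith)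
  then have r20: "- mzv [3, -1, -1] + mzv [3, -1, 1] - mzv [3, 1, -1] - mzv [2, 2, -1] = - 43/32 *
      zeta 5 + 1/8 * zeta 2 * zeta 3 + 15/8 * zeta 4 * ln 2"
    unfolding mzv_known by algebra
  have "2 * mzv [-3, -1, 1] + mzv [3, -1, -1] + mzv [2, -2, -1] = mzv [-3, -1, 1] + mzv [-3, 1, -1]
      + mzv [-4, -1] + mzv [-3, -2]"
    using mzv_regularized[of "[0, 0, -1, 1]"] by (simp add: merge_ix_def; linarith)
  then have r21: "- mzv [-3, -1, 1] + mzv [-3, 1, -1] - mzv [3, -1, -1] - mzv [2, -2, -1] = - 43/32
      * zeta 5 + 3/2 * zeta 2 * zeta 3 - 15/8 * zeta 4 * ln 2"
    unfolding mzv_known by algebra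
  have p1: "mzv [-1, 3, 1] = - 1/2 * mzv [-1, 2, 2] - mzv [-1, 1, 3] - 3/8 * zeta 3 * ln 2 ^ 2 +
      5/32 * zeta 4 * ln 2"
    using r1 by linarith
  have p2: "mzv [-1, 1, -3] = mzv [-1, -3, 1] + mzv [-1, -2, 2] + mzv [-1, -1, 3] + 107/32 * zeta 5
      - 15/8 * zeta 2 * zeta 3 + zeta 4 * ln 2"
    using r16 by linarith
  have p3: "mzv [-1, -2, 2] = - 2 * mzv [-3, -1, 1] - mzv [3, -1, -1] - 2 * mzv [-2, -2, 1] - mzv
      [-2, -1, 2] - 2 * mzv [-1, -3, 1] - mzv [-1, -1, 3] - 1/2 * zeta 2 * zeta 3 + 1/2 * zeta 3 * ln 2
      ^ 2"
    using r3 by linarith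
  have p4: "mzv [-1, 2, 2] = - 1/2 * mzv [2, -1, 2] - 7/64 * zeta 5 + 3/16 * zeta 4 * ln 2"
    using r4 by linarith
  have p5: "mzv [-2, -1, -2] = - 2 * mzv [-2, -2, -1] - 115/32 * zeta 5 + 31/16 * zeta 2 * zeta 3"
    using r14 by linarith
  have p6: "mzv [-2, -2, 1] = - 1/2 * mzv [-2, 1, -2] + 51/32 * zeta 5 - 27/32 * zeta 2 * zeta 3"
    using r11 by linarith
  have p7: "mzv [2, 2, -1] = - 1/2 * mzv [2, -1, 2] - 53/64 * zeta 5 + 3/4 * zeta 2 * zeta 3 - 15/16
      * zeta 4 * ln 2"
    using r7 by linarith
  have p8: "mzv [-3, -1, 1] = mzv [-3, 1, -1] - mzv [3, -1, -1] - mzv [2, -2, -1] + 43/32 * zeta 5 -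
      3/2 * zeta 2 * zeta 3 + 15/8 * zeta 4 * ln 2"
    using r21 by linarith
  have p9: "mzv [3, 1, -1] = - mzv [3, -1, -1] + mzv [3, -1, 1] + 1/2 * mzv [2, -1, 2] + 139/64 *
      zeta 5 - 7/8 * zeta 2 * zeta 3 - 15/16 * zeta 4 * ln 2"
    using r20 p7 by linarith
  have p10: "mzv [-2, -1, 2] = - mzv [-2, 2, -1] - mzv [2, -2, -1] + 257/32 * zeta 5 - 5 * zeta 2 *
      zeta 3 + 15/8 * zeta 4 * ln 2"
    using r9 by linarith
  have p11: "mzv [2, -1, -2] = - mzv [-2, 2, -1] - mzv [2, -2, -1] - 53/32 * zeta 5 + 3/4 * zeta 2 *
      zeta 3"
    using r12 by linarith
  have p12: "mzv [2, -2, -1] = - mzv [-2, 2, -1] - 3/4 * mzv [-2, 1, -2] + 287/64 * zeta 5 - 175/64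
      * zeta 2 * zeta 3 + 15/16 * zeta 4 * ln 2"
    using r18 p6 p10 p11 by linarith
  have p13: "mzv [-2, 1, -2] = - 2 * mzv [-3, 1, -1] + mzv [3, -1, -1] - 3/2 * mzv [-2, 2, -1] +
      43/64 * zeta 5 + 1/16 * zeta 2 * zeta 3 - 15/16 * zeta 4 * ln 2"
    using r10 p8 p6 p10 p12 by linarith
  have p14: "mzv [-3, 1, -1] = - mzv [-3, -1, -1] - mzv [3, -1, 1] - mzv [2, -2, 1] - 4 * polylog 5
      (1/2) - 4 * polylog 4 (1/2) * ln 2 - 2/15 * ln 2 ^ 5 + 39/16 * zeta 5 + 2/3 * zeta 2 * ln 2 ^ 3 +
      7/8 * zeta 2 * zeta 3 - 7/4 * zeta 3 * ln 2 ^ 2"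
    using r19 by linarith
  have p15: "mzv [3, -1, -1] = 2 * mzv [3, -1, 1] - 1/2 * mzv [-2, 2, -1] + 1/2 * mzv [2, -1, 2] +
      43/16 * zeta 5 - 9/8 * zeta 2 * zeta 3 - 15/16 * zeta 4 * ln 2"
    using r8 p7 p9 p11 by linarith
  have p16: "mzv [-2, 2, 1] = - mzv [-2, 1, 2] + 1/4 * mzv [2, -1, 2] + 2 * polylog 4 (1/2) * ln 2 +
      1/12 * ln 2 ^ 5 + 7/128 * zeta 5 - 1/2 * zeta 2 * ln 2 ^ 3 + 7/4 * zeta 3 * ln 2 ^ 2 - 17/8 * zeta
      4 * ln 2"
    using r2 p4 by linarith
  have p17: "mzv [2, -1, 2] = - 4 * mzv [2, -2, 1] - 8 * polylog 4 (1/2) * ln 2 - 1/3 * ln 2 ^ 5 -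
      95/32 * zeta 5 + 2 * zeta 2 * ln 2 ^ 3 + 3/2 * zeta 2 * zeta 3 - 7 * zeta 3 * ln 2 ^ 2 + 17/2 *
      zeta 4 * ln 2"
    using r5 p16 by linarith
  have p18: "mzv [-2, 2, -1] = mzv [-2, -2, -1] + 3 * mzv [2, -2, 1] + 8 * polylog 4 (1/2) * ln 2 +
      1/3 * ln 2 ^ 5 + 35/4 * zeta 5 - 2 * zeta 2 * ln 2 ^ 3 - 71/16 * zeta 2 * zeta 3 + 7 * zeta 3 * ln
      2 ^ 2 - 17/2 * zeta 4 * ln 2"
    using r17 p5 p17 p16 by linarith
  have p19: "mzv [-2, -2, -1] = 2 * mzv [-3, -1, -1] + 4 * mzv [3, -1, 1] - 2 * mzv [2, -2, 1] + 16
      * polylog 5 (1/2) - 2/15 * ln 2 ^ 5 - 757/32 * zeta 5 + 4/3 * zeta 2 * ln 2 ^ 3 + 17/4 * zeta 2 *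
      zeta 3 - 7 * zeta 3 * ln 2 ^ 2 + 121/8 * zeta 4 * ln 2"
    using r15 p5 p18 p14 by linarith
  have p20: "mzv [3, -1, 1] = - 1/2 * mzv [-3, -1, -1] + mzv [2, -2, 1] + 3 * polylog 4 (1/2) * ln 2
      + 1/8 * ln 2 ^ 5 + 55/32 * zeta 5 - 3/4 * zeta 2 * ln 2 ^ 3 - zeta 2 * zeta 3 + 21/8 * zeta 3 * ln
      2 ^ 2 - 87/32 * zeta 4 * ln 2"
    using r6 p15 p13 p18 p17 by linarith
  \<comment> \<open>The elimination closes: the multiples of \<open>zeta(-3,-1,-1)\<close> cancel,
    and this is the first depth 3 value of the system that comes out free of unknowns.\<close>
  have p21: "mzv [2, -2, 1] = - 4 * polylog 5 (1/2) - 4 * polylog 4 (1/2) * ln 2 - 2/15 * ln 2 ^ 5 +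
      103/32 * zeta 5 + 2/3 * zeta 2 * ln 2 ^ 3 + 7/16 * zeta 2 * zeta 3 - 7/4 * zeta 3 * ln 2 ^ 2"
    using r13 p19 p17 p20 by linarith
  have q20: "mzv [3, -1, 1] = - 1/2 * mzv [-3, -1, -1] - 4 * polylog 5 (1/2) - polylog 4 (1/2) * ln
      2 - 1/120 * ln 2 ^ 5 + 79/16 * zeta 5 - 1/12 * zeta 2 * ln 2 ^ 3 - 9/16 * zeta 2 * zeta 3 + 7/8 *
      zeta 3 * ln 2 ^ 2 - 87/32 * zeta 4 * ln 2"
    using p20 p21 by linarith
  have q19: "mzv [-2, -2, -1] = 8 * polylog 5 (1/2) + 4 * polylog 4 (1/2) * ln 2 + 1/10 * ln 2 ^ 5 -
      331/32 * zeta 5 - 1/3 * zeta 2 * ln 2 ^ 3 + 9/8 * zeta 2 * zeta 3 + 17/4 * zeta 4 * ln 2"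
    using p19 p21 q20 by linarith
  have q18: "mzv [-2, 2, -1] = - 4 * polylog 5 (1/2) + 1/30 * ln 2 ^ 5 + 129/16 * zeta 5 - 1/3 *
      zeta 2 * ln 2 ^ 3 - 2 * zeta 2 * zeta 3 + 7/4 * zeta 3 * ln 2 ^ 2 - 17/4 * zeta 4 * ln 2"
    using p18 q19 p21 by linarith
  have q17: "mzv [2, -1, 2] = 16 * polylog 5 (1/2) + 8 * polylog 4 (1/2) * ln 2 + 1/5 * ln 2 ^ 5 -
      507/32 * zeta 5 - 2/3 * zeta 2 * ln 2 ^ 3 - 1/4 * zeta 2 * zeta 3 + 17/2 * zeta 4 * ln 2"
    using p17 p21 by linarith
  have q16: "mzv [-2, 2, 1] = - mzv [-2, 1, 2] + 4 * polylog 5 (1/2) + 4 * polylog 4 (1/2) * ln 2 +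
      2/15 * ln 2 ^ 5 - 125/32 * zeta 5 - 2/3 * zeta 2 * ln 2 ^ 3 - 1/16 * zeta 2 * zeta 3 + 7/4 * zeta
      3 * ln 2 ^ 2"
    using p16 q17 by linarith
  have q15: "mzv [3, -1, -1] = - mzv [-3, -1, -1] + 2 * polylog 5 (1/2) + 2 * polylog 4 (1/2) * ln 2
      + 1/15 * ln 2 ^ 5 + 39/64 * zeta 5 - 1/3 * zeta 2 * ln 2 ^ 3 - 11/8 * zeta 2 * zeta 3 + 7/8 * zeta
      3 * ln 2 ^ 2"
    using p15 q17 q20 q18 by linarith
  have q14: "mzv [-3, 1, -1] = - 1/2 * mzv [-3, -1, -1] + 4 * polylog 5 (1/2) + polylog 4 (1/2) * ln
      2 + 1/120 * ln 2 ^ 5 - 183/32 * zeta 5 + 1/12 * zeta 2 * ln 2 ^ 3 + zeta 2 * zeta 3 - 7/8 * zeta 3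
      * ln 2 ^ 2 + 87/32 * zeta 4 * ln 2"
    using p14 p21 q20 by linarith
  have q13: "mzv [-2, 1, -2] = 5/8 * zeta 5 - 5/16 * zeta 2 * zeta 3"
    using p13 q15 q14 q18 by linarith
  have q12: "mzv [2, -2, -1] = 4 * polylog 5 (1/2) - 1/30 * ln 2 ^ 5 - 259/64 * zeta 5 + 1/3 * zeta
      2 * ln 2 ^ 3 - 1/2 * zeta 2 * zeta 3 - 7/4 * zeta 3 * ln 2 ^ 2 + 83/16 * zeta 4 * ln 2"
    using p12 q13 q18 by linarith
  have q11: "mzv [2, -1, -2] = - 363/64 * zeta 5 + 13/4 * zeta 2 * zeta 3 - 15/16 * zeta 4 * ln 2"
    using p11 q18 q12 by linarith
  have q10: "mzv [-2, -1, 2] = 257/64 * zeta 5 - 5/2 * zeta 2 * zeta 3 + 15/16 * zeta 4 * ln 2"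
    using p10 q12 q18 by linarith
  have q9: "mzv [3, 1, -1] = 1/2 * mzv [-3, -1, -1] + 2 * polylog 5 (1/2) + polylog 4 (1/2) * ln 2 +
      1/40 * ln 2 ^ 5 - 91/64 * zeta 5 - 1/12 * zeta 2 * ln 2 ^ 3 - 3/16 * zeta 2 * zeta 3 + 19/32 *
      zeta 4 * ln 2"
    using p9 q20 q15 q17 by linarith
  have q8: "mzv [-3, -1, 1] = 1/2 * mzv [-3, -1, -1] - 2 * polylog 5 (1/2) - polylog 4 (1/2) * ln 2
      - 1/40 * ln 2 ^ 5 - 15/16 * zeta 5 + 1/12 * zeta 2 * ln 2 ^ 3 + 11/8 * zeta 2 * zeta 3 - 19/32 *
      zeta 4 * ln 2"
    using p8 q14 q12 q15 by linarith
  have q7: "mzv [2, 2, -1] = - 8 * polylog 5 (1/2) - 4 * polylog 4 (1/2) * ln 2 - 1/10 * ln 2 ^ 5 +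
      227/32 * zeta 5 + 1/3 * zeta 2 * ln 2 ^ 3 + 7/8 * zeta 2 * zeta 3 - 83/16 * zeta 4 * ln 2"
    using p7 q17 by linarith
  have q6: "mzv [-2, -2, 1] = 41/32 * zeta 5 - 11/16 * zeta 2 * zeta 3"
    using p6 q13 by linarith
  have q5: "mzv [-2, -1, -2] = - 16 * polylog 5 (1/2) - 8 * polylog 4 (1/2) * ln 2 - 1/5 * ln 2 ^ 5
      + 547/32 * zeta 5 + 2/3 * zeta 2 * ln 2 ^ 3 - 5/16 * zeta 2 * zeta 3 - 17/2 * zeta 4 * ln 2"
    using p5 q19 by linarith
  have q4: "mzv [-1, 2, 2] = - 8 * polylog 5 (1/2) - 4 * polylog 4 (1/2) * ln 2 - 1/10 * ln 2 ^ 5 +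
      125/16 * zeta 5 + 1/3 * zeta 2 * ln 2 ^ 3 + 1/8 * zeta 2 * zeta 3 - 65/16 * zeta 4 * ln 2"
    using p4 q17 by linarith
  have q3: "mzv [-1, -2, 2] = - 2 * mzv [-1, -3, 1] - mzv [-1, -1, 3] + 2 * polylog 5 (1/2) - 1/60 *
      ln 2 ^ 5 - 85/16 * zeta 5 + 1/6 * zeta 2 * ln 2 ^ 3 + 2 * zeta 2 * zeta 3 - 3/8 * zeta 3 * ln 2 ^
      2 + 1/4 * zeta 4 * ln 2"
    using p3 q10 q6 q8 q15 by linarith
  have q2: "mzv [-1, 1, -3] = - mzv [-1, -3, 1] + 2 * polylog 5 (1/2) - 1/60 * ln 2 ^ 5 - 63/32 *
      zeta 5 + 1/6 * zeta 2 * ln 2 ^ 3 + 1/8 * zeta 2 * zeta 3 - 3/8 * zeta 3 * ln 2 ^ 2 + 5/4 * zeta 4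
      * ln 2"
    using p2 q3 by linarith
  have q1: "mzv [-1, 3, 1] = - mzv [-1, 1, 3] + 4 * polylog 5 (1/2) + 2 * polylog 4 (1/2) * ln 2 +
      1/20 * ln 2 ^ 5 - 125/32 * zeta 5 - 1/6 * zeta 2 * ln 2 ^ 3 - 1/16 * zeta 2 * zeta 3 - 3/8 * zeta
      3 * ln 2 ^ 2 + 35/16 * zeta 4 * ln 2"
    using p1 q4 by linarith
  have "mzv [-3, -1, 1] + mzv [-3, 1, -1] = 2 * polylog 5 (1/2) - 1/60 * ln 2 ^ 5 - 213/32 * zeta 5
      + 1/6 * zeta 2 * ln 2 ^ 3 + 19/8 * zeta 2 * zeta 3 - 7/8 * zeta 3 * ln 2 ^ 2 + 17/8 * zeta 4 * ln
      2"
    using q14 q8 by linarith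
  then show "mzv [-3, 1, -1] + mzv [-3, -1, 1] + mzv [-3, -2] + mzv [-4, -1] + mzv [4, 1] + mzv [5]
      = 2 * polylog 5 (1/2) - 1/60 * ln 2 ^ 5 - 37/16 * zeta 5 + 1/6 * zeta 2 * ln 2 ^ 3 - 1/8 * zeta 2
      * zeta 3 - 7/8 * zeta 3 * ln 2 ^ 2 + 4 * zeta 4 * ln 2"
    unfolding mzv_known by linarith
  have "mzv [3, -1, 1] + mzv [3, 1, -1] = - 2 * polylog 5 (1/2) + 1/60 * ln 2 ^ 5 + 225/64 * zeta 5
      - 1/6 * zeta 2 * ln 2 ^ 3 - 3/4 * zeta 2 * zeta 3 + 7/8 * zeta 3 * ln 2 ^ 2 - 17/8 * zeta 4 * ln
      2"
    using q9 q20 by linarith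
  then show "mzv [3, 1, -1] + mzv [3, -1, 1] + mzv [3, -2] + mzv [4, -1] + mzv [-4, 1] + mzv [-5] =
      - 2 * polylog 5 (1/2) + 1/60 * ln 2 ^ 5 + 193/64 * zeta 5 - 1/6 * zeta 2 * ln 2 ^ 3 - 3/8 * zeta 2
      * zeta 3 + 7/8 * zeta 3 * ln 2 ^ 2 - 4 * zeta 4 * ln 2"
    unfolding mzv_known by linarith
  have "mzv [-1, -3, 1] + mzv [-1, 1, -3] = 2 * polylog 5 (1/2) - 1/60 * ln 2 ^ 5 - 63/32 * zeta 5 +
      1/6 * zeta 2 * ln 2 ^ 3 + 1/8 * zeta 2 * zeta 3 - 3/8 * zeta 3 * ln 2 ^ 2 + 5/4 * zeta 4 * ln 2"
    using q2 by linarith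
  then show "mzv [-1, 1, -3] + mzv [-1, -3, 1] + mzv [-1, -4] + mzv [-2, -3] + mzv [4, 1] + mzv [5]
      = 2 * polylog 5 (1/2) - 1/60 * ln 2 ^ 5 - 37/16 * zeta 5 + 1/6 * zeta 2 * ln 2 ^ 3 + zeta 2 * zeta
      3 - 3/8 * zeta 3 * ln 2 ^ 2 + 1/4 * zeta 4 * ln 2"
    unfolding mzv_known by linarith
  have "mzv [-1, 3, 1] + mzv [-1, 1, 3] = 4 * polylog 5 (1/2) + 2 * polylog 4 (1/2) * ln 2 + 1/20 *
      ln 2 ^ 5 - 125/32 * zeta 5 - 1/6 * zeta 2 * ln 2 ^ 3 - 1/16 * zeta 2 * zeta 3 - 3/8 * zeta 3 * ln
      2 ^ 2 + 35/16 * zeta 4 * ln 2"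
    using q1 by linarith
  then show "mzv [-1, 1, 3] + mzv [-1, 3, 1] + mzv [-1, 4] + mzv [-2, 3] + mzv [-4, 1] + mzv [-5] =
      4 * polylog 5 (1/2) + 2 * polylog 4 (1/2) * ln 2 + 1/20 * ln 2 ^ 5 - 167/32 * zeta 5 - 1/6 * zeta
      2 * ln 2 ^ 3 + 1/16 * zeta 2 * zeta 3 - 3/8 * zeta 3 * ln 2 ^ 2 + 49/16 * zeta 4 * ln 2"
    unfolding mzv_known by linarith
  have "mzv [-2, 2, 1] + mzv [-2, 1, 2] = 4 * polylog 5 (1/2) + 4 * polylog 4 (1/2) * ln 2 + 2/15 *
      ln 2 ^ 5 - 125/32 * zeta 5 - 2/3 * zeta 2 * ln 2 ^ 3 - 1/16 * zeta 2 * zeta 3 + 7/4 * zeta 3 * ln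
      2 ^ 2"
    using q16 by linarith
  then show "mzv [-2, 1, 2] + mzv [-2, 2, 1] + mzv [-2, 3] + mzv [-3, 2] + mzv [-4, 1] + mzv [-5] =
      4 * polylog 5 (1/2) + 4 * polylog 4 (1/2) * ln 2 + 2/15 * ln 2 ^ 5 - 23/8 * zeta 5 - 2/3 * zeta 2
      * ln 2 ^ 3 - 15/16 * zeta 2 * zeta 3 + 7/4 * zeta 3 * ln 2 ^ 2"
    unfolding mzv_known by linarith
  have "mzv [2, -2, -1] + mzv [2, -1, -2] = 4 * polylog 5 (1/2) - 1/30 * ln 2 ^ 5 - 311/32 * zeta 5
      + 1/3 * zeta 2 * ln 2 ^ 3 + 11/4 * zeta 2 * zeta 3 - 7/4 * zeta 3 * ln 2 ^ 2 + 17/4 * zeta 4 * ln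
      2"
    using q11 q12 by linarith
  then show "mzv [2, -1, -2] + mzv [2, -2, -1] + mzv [2, 3] + mzv [-3, -2] + mzv [-4, -1] + mzv [5]
      = 4 * polylog 5 (1/2) - 1/30 * ln 2 ^ 5 - 23/8 * zeta 5 + 1/3 * zeta 2 * ln 2 ^ 3 - 3/4 * zeta 2 *
      zeta 3 - 7/4 * zeta 3 * ln 2 ^ 2 + 49/8 * zeta 4 * ln 2"
    unfolding mzv_known by linarith
  have "mzv [-2, 2, -1] + mzv [-2, -1, 2] = - 4 * polylog 5 (1/2) + 1/30 * ln 2 ^ 5 + 773/64 * zeta
      5 - 1/3 * zeta 2 * ln 2 ^ 3 - 9/2 * zeta 2 * zeta 3 + 7/4 * zeta 3 * ln 2 ^ 2 - 53/16 * zeta 4 *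
      ln 2"
    using q18 q10 by linarith
  then show "mzv [-2, 2, -1] + mzv [-2, -1, 2] + mzv [-2, -3] + mzv [-4, -1] + mzv [3, 2] + mzv [5]
      = - 4 * polylog 5 (1/2) + 1/30 * ln 2 ^ 5 - 29/64 * zeta 5 - 1/3 * zeta 2 * ln 2 ^ 3 + 15/8 * zeta
      2 * zeta 3 + 7/4 * zeta 3 * ln 2 ^ 2 - 23/16 * zeta 4 * ln 2"
    unfolding mzv_known by linarith
  have "mzv [-2, -2, -1] + mzv [-2, -1, -2] = - 8 * polylog 5 (1/2) - 4 * polylog 4 (1/2) * ln 2 -
      1/10 * ln 2 ^ 5 + 27/4 * zeta 5 + 1/3 * zeta 2 * ln 2 ^ 3 + 13/16 * zeta 2 * zeta 3 - 17/4 * zeta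
      4 * ln 2"
    using q5 q19 by linarith
  then show "mzv [-2, -1, -2] + mzv [-2, -2, -1] + mzv [-2, 3] + mzv [3, -2] + mzv [4, -1] + mzv
      [-5] = - 8 * polylog 5 (1/2) - 4 * polylog 4 (1/2) * ln 2 - 1/10 * ln 2 ^ 5 + 35/4 * zeta 5 + 1/3
      * zeta 2 * ln 2 ^ 3 - 1/16 * zeta 2 * zeta 3 - 49/8 * zeta 4 * ln 2"
    unfolding mzv_known by linarith
qed

section \<open>Euler sums\<close>

lemma harm_eq_mhs: "harm n = mhs [1] n"
  by (simp add: harm_altdef signed_pow_def inverse_eq_divide)

lemma gen_harm_eq_mhs: "p > 0 \<Longrightarrow> gen_harm p n = mhs [int p] n"
  by (simp add: gen_harm_def signed_pow_def sum.atLeast1_atMost_eq atLeast0LessThan)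

lemma alt_harm_eq_mhs: "p > 0 \<Longrightarrow> alt_harm p n = - mhs [- int p] n"
  by (simp add: alt_harm_def signed_pow_def sum.atLeast1_atMost_eq atLeast0LessThan sum_negf)

text \<open>The harmonic factors run up to \<open>n\<close> itself, whereas nested sums are strict.
  Splitting off the terms equal to \<open>n\<close> merges one or both entries into
  \<open>s\<close>; the stuffle product of the strict parts gives the other three sums.\<close>

lemma sum_mhs_product:
  assumes "s \<noteq> 0" "a \<noteq> 0" "b \<noteq> 0"
  shows "(\<Sum>n=1..N. signed_pow s n * (mhs [a] n * mhs [b] n)) =
    mhs [s, a, b] N + mhs [s, b, a] N + mhs [s, merge_ix a b] N
      + mhs [merge_ix s a, b] N + mhs [merge_ix s b, a] N + mhs [merge_ix s (merge_ix a b)] N"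
proof (induction N)
  case (Suc N)
  have m: "merge_ix a b \<noteq> 0" using assms by (auto simp: merge_ix_def)
  have "mhs [a] N * mhs [b] N = mhs [a, b] N + mhs [b, a] N + mhs [merge_ix a b] N"
    using mhs_stuffle[of "[a]" "[b]" N] assms by simp
  then have "(mhs [a] N + signed_pow a (Suc N)) * (mhs [b] N + signed_pow b (Suc N)) =
      mhs [a, b] N + mhs [b, a] N + mhs [merge_ix a b] N
        + signed_pow a (Suc N) * mhs [b] N + signed_pow b (Suc N) * mhs [a] N + signed_pow a (Suc N)
            * signed_pow b (Suc N)"
    by (simp add: algebra_simps)
  then show ?case
    using Suc.IH by (simp add: signed_pow_merge assms m algebra_simps del: mhs.simps(2))
      (simp add: algebra_simps signed_pow_merge assms m)
qed simp

text \<open>The merged entries are separate variables so that the numerals of the evaluated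
  combinations unify directly. The sign \<open>q\<close> collects one factor \<open>-1\<close> for
  each alternating harmonic number and one for \<open>(-1)^(n - 1)\<close>, since
  \<open>signed_pow\<close> uses \<open>(-1)^n\<close>.\<close>

lemma euler_sum_tendsto:
  assumes val: "mzv [s, a, b] + mzv [s, b, a] + mzv [s, ab] + mzv [sa, b] + mzv [sb, a] + mzv [sab] = c"
    and merge: "ab = merge_ix a b" "sa = merge_ix s a" "sb = merge_ix s b" "sab = merge_ix s ab"
    and nz: "s \<noteq> 0" "a \<noteq> 0" "b \<noteq> 0" "s \<noteq> 1"
    and f: "\<And>n. n \<ge> 1 \<Longrightarrow> f n = q * (signed_pow s n * (mhs [a] n * mhs [b] n))"
    and L: "L = q * c"
  shows "(\<lambda>N. \<Sum>n=1..N. f n) \<longlonglongrightarrow> L"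
proof -
  \<comment> \<open>A merged entry has absolute value at least 2, so a leading one never causes
    divergence; for the unmerged leading entry this is \<open>s \<noteq> 1\<close>.\<close>
  have "merge_ix x y \<noteq> 0 \<and> merge_ix x y \<noteq> 1" if "x \<noteq> 0" "y \<noteq> 0" for x y
    using that by (auto simp: merge_ix_def)
  then have "(\<lambda>N. \<Sum>n=1..N. signed_pow s n * (mhs [a] n * mhs [b] n))
      \<longlonglongrightarrow> c"
    unfolding sum_mhs_product[OF nz(1-3)] val[unfolded merge, symmetric]
    using nz by (intro tendsto_add mhs_tendsto) auto
  then have "(\<lambda>N. q * (\<Sum>n=1..N. signed_pow s n * (mhs [a] n * mhs [b] n)))
      \<longlonglongrightarrow> L"
    unfolding L by (rule tendsto_mult_left)
  then show ?thesis
    using f by (simp add: sum_distrib_left)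
qed

lemma minus_one_power_diff_1: "n \<ge> 1 \<Longrightarrow> (-1 :: real) ^ n = - ((-1) ^ (n - 1))"
  by (cases n) auto

theorem mainTheorem3:
  shows "((\<lambda>N. \<Sum>n=1..N. harm n * alt_harm 1 n / real n ^ 3 * (-1) ^ (n - 1))
      \<longlonglongrightarrow> 2 * polylog 5 (1/2) - 1/60 * ln 2 ^ 5 - 37/16 * zeta 5
        - 7/8 * zeta 3 * ln 2 ^ 2 + 1/6 * zeta 2 * ln 2 ^ 3 + 4 * zeta 4 * ln 2 - 1/8 * zeta 2 * zeta 3)
    \<and> ((\<lambda>N. \<Sum>n=1..N. harm n * alt_harm 1 n / real n ^ 3)
      \<longlonglongrightarrow> 2 * polylog 5 (1/2) - 1/60 * ln 2 ^ 5 - 193/64 * zeta 5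
        - 7/8 * zeta 3 * ln 2 ^ 2 + 1/6 * zeta 2 * ln 2 ^ 3 + 4 * zeta 4 * ln 2 + 3/8 * zeta 2 * zeta 3)
    \<and> ((\<lambda>N. \<Sum>n=1..N. harm n * alt_harm 3 n / real n * (-1) ^ (n - 1))
      \<longlonglongrightarrow> 2 * polylog 5 (1/2) - 1/60 * ln 2 ^ 5 - 3/8 * zeta 3 * ln 2 ^ 2
        - 37/16 * zeta 5 + 1/6 * zeta 2 * ln 2 ^ 3 + zeta 2 * zeta 3 + 1/4 * zeta 4 * ln 2)
    \<and> ((\<lambda>N. \<Sum>n=1..N. harm n * gen_harm 3 n / real n * (-1) ^ (n - 1))
      \<longlonglongrightarrow> - 4 * polylog 5 (1/2) - 2 * polylog 4 (1/2) * ln 2 - 1/20 * ln 2 ^ 5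
        + 3/8 * zeta 3 * ln 2 ^ 2 + 167/32 * zeta 5 + 1/6 * zeta 2 * ln 2 ^ 3 - 1/16 * zeta 2 * zeta 3 - 49/16 * zeta 4 * ln 2)
    \<and> ((\<lambda>N. \<Sum>n=1..N. harm n * gen_harm 2 n / real n ^ 2 * (-1) ^ (n - 1))
      \<longlonglongrightarrow> - 4 * polylog 5 (1/2) - 4 * polylog 4 (1/2) * ln 2 - 2/15 * ln 2 ^ 5
        - 7/4 * zeta 3 * ln 2 ^ 2 + 23/8 * zeta 5 + 2/3 * zeta 2 * ln 2 ^ 3 + 15/16 * zeta 2 * zeta 3)
    \<and> ((\<lambda>N. \<Sum>n=1..N. alt_harm 1 n * alt_harm 2 n / real n ^ 2)
      \<longlonglongrightarrow> 4 * polylog 5 (1/2) - 1/30 * ln 2 ^ 5 - 7/4 * zeta 3 * ln 2 ^ 2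
        - 23/8 * zeta 5 + 1/3 * zeta 2 * ln 2 ^ 3 - 3/4 * zeta 2 * zeta 3 + 49/8 * zeta 4 * ln 2)
    \<and> ((\<lambda>N. \<Sum>n=1..N. gen_harm 2 n * alt_harm 1 n / real n ^ 2 * (-1) ^ (n - 1))
      \<longlonglongrightarrow> - 4 * polylog 5 (1/2) + 1/30 * ln 2 ^ 5 + 7/4 * zeta 3 * ln 2 ^ 2
        - 29/64 * zeta 5 - 1/3 * zeta 2 * ln 2 ^ 3 + 15/8 * zeta 2 * zeta 3 - 23/16 * zeta 4 * ln 2)
    \<and> ((\<lambda>N. \<Sum>n=1..N. alt_harm 1 n * alt_harm 2 n / real n ^ 2 * (-1) ^ (n - 1))
      \<longlonglongrightarrow> 8 * polylog 5 (1/2) + 4 * polylog 4 (1/2) * ln 2 + 1/10 * ln 2 ^ 5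
        - 35/4 * zeta 5 - 1/3 * zeta 2 * ln 2 ^ 3 + 1/16 * zeta 2 * zeta 3 + 49/8 * zeta 4 * ln 2)"
proof (intro conjI)
  show "(\<lambda>N. \<Sum>n=1..N. harm n * alt_harm 1 n / real n ^ 3 * (-1) ^ (n - 1))
      \<longlonglongrightarrow> 2 * polylog 5 (1/2) - 1/60 * ln 2 ^ 5 - 37/16 * zeta 5
        - 7/8 * zeta 3 * ln 2 ^ 2 + 1/6 * zeta 2 * ln 2 ^ 3 + 4 * zeta 4 * ln 2 - 1/8 * zeta 2 * zeta 3"
    by (rule euler_sum_tendsto[OF mzv_euler_sums(1), where q = "1"])
       (simp_all add: merge_ix_def signed_pow_def harm_eq_mhs gen_harm_eq_mhs alt_harm_eq_mhs
         minus_one_power_diff_1 del: mhs.simps(2))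
  show "(\<lambda>N. \<Sum>n=1..N. harm n * alt_harm 1 n / real n ^ 3)
      \<longlonglongrightarrow> 2 * polylog 5 (1/2) - 1/60 * ln 2 ^ 5 - 193/64 * zeta 5
        - 7/8 * zeta 3 * ln 2 ^ 2 + 1/6 * zeta 2 * ln 2 ^ 3 + 4 * zeta 4 * ln 2 + 3/8 * zeta 2 * zeta 3"
    by (rule euler_sum_tendsto[OF mzv_euler_sums(2), where q = "-1"])
       (simp_all add: merge_ix_def signed_pow_def harm_eq_mhs gen_harm_eq_mhs alt_harm_eq_mhs
         minus_one_power_diff_1 del: mhs.simps(2))
  show "(\<lambda>N. \<Sum>n=1..N. harm n * alt_harm 3 n / real n * (-1) ^ (n - 1))
      \<longlonglongrightarrow> 2 * polylog 5 (1/2) - 1/60 * ln 2 ^ 5 - 3/8 * zeta 3 * ln 2 ^ 2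
        - 37/16 * zeta 5 + 1/6 * zeta 2 * ln 2 ^ 3 + zeta 2 * zeta 3 + 1/4 * zeta 4 * ln 2"
    by (rule euler_sum_tendsto[OF mzv_euler_sums(3), where q = "1"])
       (simp_all add: merge_ix_def signed_pow_def harm_eq_mhs gen_harm_eq_mhs alt_harm_eq_mhs
         minus_one_power_diff_1 del: mhs.simps(2))
  show "(\<lambda>N. \<Sum>n=1..N. harm n * gen_harm 3 n / real n * (-1) ^ (n - 1))
      \<longlonglongrightarrow> - 4 * polylog 5 (1/2) - 2 * polylog 4 (1/2) * ln 2 - 1/20 * ln 2 ^ 5
        + 3/8 * zeta 3 * ln 2 ^ 2 + 167/32 * zeta 5 + 1/6 * zeta 2 * ln 2 ^ 3 - 1/16 * zeta 2 * zeta 3 - 49/16 * zeta 4 * ln 2"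
    by (rule euler_sum_tendsto[OF mzv_euler_sums(4), where q = "-1"])
       (simp_all add: merge_ix_def signed_pow_def harm_eq_mhs gen_harm_eq_mhs alt_harm_eq_mhs
         minus_one_power_diff_1 del: mhs.simps(2))
  show "(\<lambda>N. \<Sum>n=1..N. harm n * gen_harm 2 n / real n ^ 2 * (-1) ^ (n - 1))
      \<longlonglongrightarrow> - 4 * polylog 5 (1/2) - 4 * polylog 4 (1/2) * ln 2 - 2/15 * ln 2 ^ 5
        - 7/4 * zeta 3 * ln 2 ^ 2 + 23/8 * zeta 5 + 2/3 * zeta 2 * ln 2 ^ 3 + 15/16 * zeta 2 * zeta 3"
    by (rule euler_sum_tendsto[OF mzv_euler_sums(5), where q = "-1"])
       (simp_all add: merge_ix_def signed_pow_def harm_eq_mhs gen_harm_eq_mhs alt_harm_eq_mhs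
         minus_one_power_diff_1 del: mhs.simps(2))
  show "(\<lambda>N. \<Sum>n=1..N. alt_harm 1 n * alt_harm 2 n / real n ^ 2)
      \<longlonglongrightarrow> 4 * polylog 5 (1/2) - 1/30 * ln 2 ^ 5 - 7/4 * zeta 3 * ln 2 ^ 2
        - 23/8 * zeta 5 + 1/3 * zeta 2 * ln 2 ^ 3 - 3/4 * zeta 2 * zeta 3 + 49/8 * zeta 4 * ln 2"
    by (rule euler_sum_tendsto[OF mzv_euler_sums(6), where q = "1"])
       (simp_all add: merge_ix_def signed_pow_def harm_eq_mhs gen_harm_eq_mhs alt_harm_eq_mhs
         minus_one_power_diff_1 del: mhs.simps(2))
  show "(\<lambda>N. \<Sum>n=1..N. gen_harm 2 n * alt_harm 1 n / real n ^ 2 * (-1) ^ (n - 1))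
      \<longlonglongrightarrow> - 4 * polylog 5 (1/2) + 1/30 * ln 2 ^ 5 + 7/4 * zeta 3 * ln 2 ^ 2
        - 29/64 * zeta 5 - 1/3 * zeta 2 * ln 2 ^ 3 + 15/8 * zeta 2 * zeta 3 - 23/16 * zeta 4 * ln 2"
    by (rule euler_sum_tendsto[OF mzv_euler_sums(7), where q = "1"])
       (simp_all add: merge_ix_def signed_pow_def harm_eq_mhs gen_harm_eq_mhs alt_harm_eq_mhs
         minus_one_power_diff_1 del: mhs.simps(2))
  show "(\<lambda>N. \<Sum>n=1..N. alt_harm 1 n * alt_harm 2 n / real n ^ 2 * (-1) ^ (n - 1))
      \<longlonglongrightarrow> 8 * polylog 5 (1/2) + 4 * polylog 4 (1/2) * ln 2 + 1/10 * ln 2 ^ 5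
        - 35/4 * zeta 5 - 1/3 * zeta 2 * ln 2 ^ 3 + 1/16 * zeta 2 * zeta 3 + 49/8 * zeta 4 * ln 2"
    by (rule euler_sum_tendsto[OF mzv_euler_sums(8), where q = "-1"])
       (simp_all add: merge_ix_def signed_pow_def harm_eq_mhs gen_harm_eq_mhs alt_harm_eq_mhs
         minus_one_power_diff_1 del: mhs.simps(2))
qed

end
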